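(* $\deg^{\mathrm{sym}}_{\mathrm{exp}}(S^2\times\mathbb{D}^2)=0$. Here $\deg^{\mathrm{sym}}_{\mathrm{exp}}(S^2\times\mathbb{D}^2)$ is the topological degree of the continuous proper map $F:(0,\infty)\times(0,\infty)\to(0,\infty)\times(0,\infty)$, $F(b_0,-f_0)=(a'_\infty,b'_\infty)$, attached to the $S^2\times\mathbb{R}^2$ boundary conditions.
   Context: Consider smooth functions $a,b,f$ of $r\ge 0$, with $a,b>0$ for $r>0$, satisfying for $r>0$ the soliton equations $$f''=\frac{a''}{a}+2\frac{b''}{b}-1,\qquad a''=-2\frac{a'b'}{b}+a'f'+a,\qquad b''=\frac{1-(b')^2}{b}-\frac{a'b'}{a}+b'f'+b.$$ These are equivalent to the metric $g=dr^2+a(r)^2g_{S^1}+b(r)^2g_{S^2}$ ($g_{S^1}=d\theta^2$ the standard metric on the circle, $g_{S^2}$ the round unit sphere metric) being a gradient expanding Ricci soliton, $\mathrm{Ric}_g+\nabla^2f+g=0$, with potential $f=f(r)$. $S^2\times\mathbb{R}^2$ boundary conditions with parameters $b_0>0$, $f_0<0$: $a(0)=0$, $a'(0)=1$, $b(0)=b_0$, $b'(0)=0$, $f(0)=f'(0)=0$, $f''(0)=f_0$. For all such parameters there is a unique solution, it is defined on $[0,\infty)$, and the limits $a'_\infty=\lim_{r\to\infty}a'(r)$ and $b'_\infty=\lim_{r\to\infty}b'(r)$ exist and are finite and positive. The map $F:(0,\infty)\times(0,\infty)\to(0,\infty)\times(0,\infty)$ is defined by $F(b_0,-f_0)=(a'_\infty,b'_\infty)$.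 It is continuous and proper, so it has a well-defined topological degree as a proper continuous map between connected oriented $2$-manifolds. The cohomogeneity one expander degree $\deg^{\mathrm{sym}}_{\mathrm{exp}}(S^2\times\mathbb{D}^2)$ is defined to be this degree. *)

theory Defs
  imports "HOL-Analysis.Analysis" "HOL-Homology.Homology"
begin

section \<open>Smooth functions on the closed half-line\<close>

text \<open>The derivative along \<open>[0,\<infinity>)\<close>: one-sided at \<open>0\<close>, the usual derivative at \<open>r > 0\<close>.
  Values of functions on the negative axis play no role anywhere below.\<close>

definition hderiv :: "(real \<Rightarrow> real) \<Rightarrow> real \<Rightarrow> real" where
  "hderiv u r = vector_derivative u (at r within {0..})"

definition smooth_halfline :: "(real \<Rightarrow> real) \<Rightarrow> bool" where
  "smooth_halfline u \<longleftrightarrow> (\<forall>n. (hderiv ^^ n) u differentiable_on {0..})"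


section \<open>The soliton equations\<close>

text \<open>The equations for \<open>Ric + Hess f + g = 0\<close> with \<open>g = dr\<^sup>2 + a(r)\<^sup>2 g\<^sub>S\<^sub>1 + b(r)\<^sup>2 g\<^sub>S\<^sub>2\<close>.\<close>

definition soliton_equations ::
    "(real \<Rightarrow> real) \<Rightarrow> (real \<Rightarrow> real) \<Rightarrow> (real \<Rightarrow> real) \<Rightarrow> real \<Rightarrow> bool" where
  "soliton_equations a b f r \<longleftrightarrow>
     hderiv (hderiv f) r = hderiv (hderiv a) r / a r + 2 * (hderiv (hderiv b) r / b r) - 1 \<and>
     hderiv (hderiv a) r = - 2 * (hderiv a r * hderiv b r / b r) + hderiv a r * hderiv f r + a r \<and>
     hderiv (hderiv b) r = (1 - (hderiv b r)\<^sup>2) / b r - hderiv a r * hderiv b r / a r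
                           + hderiv b r * hderiv f r + b r"

definition S2xR2_boundary_conditions ::
    "real \<Rightarrow> real \<Rightarrow> (real \<Rightarrow> real) \<Rightarrow> (real \<Rightarrow> real) \<Rightarrow> (real \<Rightarrow> real) \<Rightarrow> bool" where
  "S2xR2_boundary_conditions b0 f0 a b f \<longleftrightarrow>
     a 0 = 0 \<and> hderiv a 0 = 1 \<and>
     b 0 = b0 \<and> hderiv b 0 = 0 \<and>
     f 0 = 0 \<and> hderiv f 0 = 0 \<and> hderiv (hderiv f) 0 = f0"

definition S2xR2_expander ::
    "real \<Rightarrow> real \<Rightarrow> (real \<Rightarrow> real) \<Rightarrow> (real \<Rightarrow> real) \<Rightarrow> (real \<Rightarrow> real) \<Rightarrow> bool" where
  "S2xR2_expander b0 f0 a b f \<longleftrightarrow>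
     smooth_halfline a \<and> smooth_halfline b \<and> smooth_halfline f \<and>
     (\<forall>r>0. a r > 0 \<and> b r > 0 \<and> soliton_equations a b f r) \<and>
     S2xR2_boundary_conditions b0 f0 a b f"


section \<open>The map sending the parameters to the asymptotic cone angles\<close>

definition quadrant :: "(real \<times> real) set" where
  "quadrant = {0<..} \<times> {0<..}"

text \<open>The argument is \<open>(b\<^sub>0, - f\<^sub>0)\<close> and the value is \<open>(a'\<^sub>\<infinity>, b'\<^sub>\<infinity>)\<close>.\<close>

definition asymptotic_map :: "real \<times> real \<Rightarrow> real \<times> real" where
  "asymptotic_map = (\<lambda>(b0, m).
     THE (\<alpha>, \<beta>). \<exists>a b f. S2xR2_expander b0 (- m) a b f \<and>
        (hderiv a \<longlongrightarrow> \<alpha>) at_top \<and> (hderiv b \<longlongrightarrow> \<beta>) at_top)"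


section \<open>The degree of a proper continuous self-map of the quadrant\<close>

text \<open>The quadrant is identified with the 2-sphere minus its north pole, by taking logarithms of
  both coordinates and then applying inverse stereographic projection. A proper continuous
  self-map of the quadrant extends to the one-point compactification by fixing the pole, and its
  degree is the Brouwer degree of this extension. As the same chart is used on both sides, neither
  the choice of the chart nor its orientation matters.\<close>

definition north_pole :: "nat \<Rightarrow> real" where
  "north_pole = (\<lambda>i. if i = 2 then 1 else 0)"

definition quadrant_chart :: "real \<times> real \<Rightarrow> nat \<Rightarrow> real" where
  "quadrant_chart = (\<lambda>(x, y).
     let u = ln x; v = ln y; s = u\<^sup>2 + v\<^sup>2 in
     (\<lambda>i. if i = 0 then 2 * u / (s + 1)
          else if i = 1 then 2 * v / (s + 1)
          else if i = 2 then (s - 1) / (s + 1)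
          else 0))"

definition compactified_map :: "(real \<times> real \<Rightarrow> real \<times> real) \<Rightarrow> (nat \<Rightarrow> real) \<Rightarrow> nat \<Rightarrow> real" where
  "compactified_map F p =
     (if p = north_pole then north_pole
      else quadrant_chart (F (inv_into quadrant quadrant_chart p)))"

text \<open>The guard is essential: \<^const>\<open>Brouwer_degree2\<close> is \<open>0\<close> on maps of the sphere that
  are not continuous. Here the degree is unspecified unless \<open>F\<close> is continuous and proper from the
  open quadrant to itself.\<close>

definition quadrant_degree :: "(real \<times> real \<Rightarrow> real \<times> real) \<Rightarrow> int" where
  "quadrant_degree F =
     (if continuous_map (top_of_set quadrant) (top_of_set quadrant) F \<and>
         proper_map (top_of_set quadrant) (top_of_set quadrant) F
      then Brouwer_degree2 2 (compactified_map F)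
      else undefined)"

definition deg_sym_exp_S2xD2 :: int where
  "deg_sym_exp_S2xD2 = quadrant_degree asymptotic_map"

end

theory Submission
  imports Defs "HOL-Real_Asymp.Real_Asymp"
begin

text \<open>
  Put \<open>m = - f\<^sub>0\<close>, \<open>x = a'/a\<close>, \<open>y = b'/b\<close>, \<open>u = - f'\<close>, \<open>k = 1/b\<^sup>2\<close>, \<open>\<phi> = m - f\<close> and \<open>\<xi> = x + 2y + u\<close>.
  The soliton equations become \<open>x' = 1 - \<xi>x\<close>, \<open>y' = 1 + k - \<xi>y\<close>, \<open>u' = 2\<phi> - \<xi>u\<close>, together with the
  constraint \<open>\<xi>\<^sup>2 = x\<^sup>2 + 2y\<^sup>2 + 2 + 2k + 2\<phi>\<close>. After splitting off \<open>\<xi> = 1/r + \<zeta>\<close> the only singular terms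
  are of the form \<open>- \<lambda>w/r\<close> with \<open>\<lambda> \<ge> 0\<close>, so existence, uniqueness, smoothness and continuous dependence are
  those of a regular equation.

  With \<open>v = \<surd>(2\<phi>)\<close>, the quotients \<open>a/v\<close> and \<open>b/v\<close> are increasing and \<open>v' \<longlonglongrightarrow> 1\<close>, so their limits are \<open>a'\<^sub>\<infinity>\<close> and \<open>b'\<^sub>\<infinity>\<close>;
  explicit tail bounds make the convergence locally uniform in the parameters, whence \<open>F\<close> is continuous.
  Properness follows from \<open>b\<^sub>0\<^sup>2 + 1 \<le> 2m b'\<^sub>\<infinity>\<^sup>2\<close>, from \<open>2m a'\<^sub>\<infinity>\<^sup>2 \<le> e\<^sup>6\<close> for \<open>m \<ge> 4\<close>, and from
  \<open>a'\<^sub>\<infinity> \<le> C b\<^sub>0\<close> with \<open>C\<close> locally bounded in \<open>m\<close>. Finally, in the variable \<open>dt = dr/b\<close> the quotient \<open>s = a/b\<close> is a damped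
  oscillator with \<open>s(0) = 0\<close>, \<open>s'(0) = 1\<close>, so \<open>s \<le> 1\<close>. Hence \<open>a'\<^sub>\<infinity> \<le> b'\<^sub>\<infinity>\<close>, \<open>F\<close> misses the point \<open>(2, 1)\<close>, and its degree is \<open>0\<close>.
\<close>

text \<open>For the degree itself one missed value of \<open>F\<close> is enough; nearly all of the
  work shows that \<open>F\<close> is total, continuous and proper, without which
  \<open>quadrant_degree\<close> is unspecified. The obstacle is \<open>r = 0\<close>, where
  \<open>x = a'/a\<close> blows up. The soliton equations give \<open>u'\<close> with
  \<open>x^2\<close> in it. The constraint turns this into \<open>2\<phi> - \<xi>u\<close>, and
  adding up the equations for \<open>x\<close>, \<open>2y\<close> and \<open>u\<close> yields
  \<open>\<xi>' = 3 + 2k + 2\<phi> - \<xi>^2\<close>, where \<open>x\<close> no longer occurs. The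
  reduced system is therefore closed and quadratic; the price is that the constraint has to be
  recovered from it, and has to be derived separately for a given expander. Most estimates are
  comparisons for \<open>z' = S - \<xi>z\<close>, with \<open>\<xi>\<close> caught between
  \<open>v\<close> and \<open>3/r + \<surd>(2m) + r\<close>. All constants are explicit in the
  parameters, because continuity and properness need uniformity. The inequality
  \<open>\<alpha> \<le> \<beta>\<close> comes from the sphere factor:
  \<open>(x - y)' = - k - \<xi>(x - y)\<close>, so its curvature \<open>k = 1/b^2\<close> pulls
  \<open>a/b\<close> back, and \<open>2y + u \<ge> 0\<close> is the damping.\<close>

section \<open>Calculus on the half-line\<close>

text \<open>The sign of \<open>z'\<close> is asked for only where \<open>z < 0\<close>. This fits
  \<open>z' = S - \<xi> * z\<close> with \<open>S, \<xi> \<ge> 0\<close>, whose damping term then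
  helps, and derivatives on the open interval only leave room for equations that are singular at
  \<open>R = 0\<close>.\<close>

lemma barrier:
  fixes z :: "real \<Rightarrow> real"
  assumes cont: "continuous_on {R..T} z" and z0: "z R \<ge> 0"
    and der: "\<And>r. R < r \<Longrightarrow> r < T \<Longrightarrow> (z has_real_derivative z' r) (at r)"
    and pos: "\<And>r. R < r \<Longrightarrow> r < T \<Longrightarrow> z r < 0 \<Longrightarrow> z' r \<ge> 0"
    and r: "R \<le> r" "r \<le> T"
  shows "z r \<ge> 0"
proof (rule ccontr)
  assume neg: "\<not> z r \<ge> 0"
  have c: "continuous_on {R..r} z" using cont r by (auto intro: continuous_on_subset)
  \<comment> \<open>Beyond the last point of \<open>S\<close>, up to \<open>r\<close>,
    \<open>z\<close> is negative and hence nondecreasing.\<close>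
  define S where "S = {R..r} \<inter> z -` {0..}"
  have "closed S" unfolding S_def
    by (rule continuous_closed_preimage[OF c]) auto
  moreover have "bounded S" unfolding S_def by (rule bounded_subset[of "{R..r}"]) auto
  ultimately have "compact S" by (simp add: compact_eq_bounded_closed)
  moreover have "R \<in> S" using z0 r by (auto simp: S_def)
  ultimately obtain s where s: "s \<in> S" "\<And>t. t \<in> S \<Longrightarrow> t \<le> s"
    by (metis compact_attains_sup empty_iff)
  have s1: "R \<le> s" "s \<le> r" "z s \<ge> 0" using s by (auto simp: S_def)
  have sr: "s < r" using s1 neg by (cases "s = r") auto
  have "z s \<le> z r"
  proof (rule DERIV_nonneg_imp_increasing_open[where f = z and a = s and b = r])
    fix t assume t: "s < t" "t < r"
    then have "t \<notin> S" using s(2) by force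
    then have "z t < 0" using t s1 by (auto simp: S_def)
    then show "\<exists>y. (z has_real_derivative y) (at t) \<and> 0 \<le> y"
      using der[of t] pos[of t] t s1 r by auto
  next
    show "continuous_on {s..r} z" using c s1 by (auto intro: continuous_on_subset)
  qed (use sr in auto)
  then show False using s1 neg by auto
qed

section \<open>Differentiability classes on the half-line\<close>

text \<open>The derivative is an existential witness, so the closure properties require no
  computation of \<open>hderiv\<close>, and only values on the half-line matter.\<close>

primrec Ck :: "nat \<Rightarrow> (real \<Rightarrow> real) \<Rightarrow> bool" where
  "Ck 0 u = continuous_on {0..} u"
| "Ck (Suc n) u = (\<exists>u'. (\<forall>r\<ge>0. (u has_real_derivative u' r) (at r within {0..})) \<and> Ck n u')"

lemma Ck_cong: "(\<And>r. r \<ge> 0 \<Longrightarrow> u r = v r) \<Longrightarrow> Ck n u \<longleftrightarrow> Ck n v"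
proof (induction n)
  case 0 then show ?case using continuous_on_cong[of "{0..}" "{0..}" u v] by simp
next
  case (Suc n)
  have "(u has_real_derivative d) (at r within {0..}) \<longleftrightarrow> (v has_real_derivative d) (at r within {0..})"
    if "r \<ge> 0" for r d
    by (rule has_field_derivative_cong_eventually) (use Suc.prems that in \<open>auto simp: eventually_at_filter\<close>)
  then show ?case by simp
qed

lemma Ck_lower: "Ck (Suc n) u \<Longrightarrow> Ck n u"
proof (induction n arbitrary: u)
  case 0
  then obtain u' where "\<forall>r\<ge>0. (u has_real_derivative u' r) (at r within {0..})" by auto
  then have "continuous_on {0..} u" by (intro DERIV_continuous_on) auto
  then show ?case by simp
next
  case (Suc n)
  obtain u' where "\<forall>r\<ge>0. (u has_real_derivative u' r) (at r within {0..})" "Ck (Suc n) u'"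
    using Suc.prems by (auto simp only: Ck.simps(2)[of "Suc n"])
  then show ?case using Suc.IH[of u'] by (auto simp only: Ck.simps(2)[of n])
qed

lemma Ck_continuous: "Ck n u \<Longrightarrow> continuous_on {0..} u"
  by (induction n) (auto dest: Ck_lower simp del: Ck.simps(2))

lemma Ck_const: "Ck n (\<lambda>_. c)"
proof (induction n arbitrary: c)
  case (Suc n)
  show ?case by (simp, intro exI[of _ "\<lambda>_. 0"]) (auto intro: Suc)
qed auto

lemma Ck_add: "Ck n u \<Longrightarrow> Ck n v \<Longrightarrow> Ck n (\<lambda>r. u r + v r)"
proof (induction n arbitrary: u v)
  case 0 then show ?case by (auto intro: continuous_intros)
next
  case (Suc n)
  then obtain u' v' where "\<forall>r\<ge>0. (u has_real_derivative u' r) (at r within {0..})" "Ck n u'"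
    "\<forall>r\<ge>0. (v has_real_derivative v' r) (at r within {0..})" "Ck n v'" by auto
  then show ?case using Suc.IH[of u' v']
    by (auto intro!: exI[of _ "\<lambda>r. u' r + v' r"] derivative_eq_intros)
qed

lemma Ck_mult: "Ck n u \<Longrightarrow> Ck n v \<Longrightarrow> Ck n (\<lambda>r. u r * v r)"
proof (induction n arbitrary: u v)
  case 0 then show ?case by (auto intro: continuous_intros)
next
  case (Suc n)
  then obtain u' v' where *: "\<forall>r\<ge>0. (u has_real_derivative u' r) (at r within {0..})" "Ck n u'"
    "\<forall>r\<ge>0. (v has_real_derivative v' r) (at r within {0..})" "Ck n v'" by auto
  have "Ck n (\<lambda>r. u' r * v r + u r * v' r)"
    using Suc.IH[OF *(2) Ck_lower[OF Suc.prems(2)]] Suc.IH[OF Ck_lower[OF Suc.prems(1)] *(4)] by (rule Ck_add)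
  moreover have "((\<lambda>r. u r * v r) has_real_derivative u' r * v r + u r * v' r) (at r within {0..})"
    if "r \<ge> 0" for r
    using DERIV_mult[of u "u' r" r "{0..}" v "v' r"] * that by (simp add: algebra_simps)
  ultimately show ?case unfolding Ck.simps by (intro exI[of _ "\<lambda>r. u' r * v r + u r * v' r"]) simp
qed

lemma Ck_uminus: "Ck n u \<Longrightarrow> Ck n (\<lambda>r. - u r)"
proof -
  assume "Ck n u"
  then have "Ck n (\<lambda>r. (-1) * u r)" by (rule Ck_mult[OF Ck_const])
  then show "Ck n (\<lambda>r. - u r)" by simp
qed

lemma Ck_diff:
  assumes "Ck n u" "Ck n v" shows "Ck n (\<lambda>r. u r - v r)"
proof -
  have "Ck n (\<lambda>r. u r + - v r)" by (intro Ck_add Ck_uminus assms)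
  then show ?thesis by simp
qed

lemma Ck_id: "Ck n (\<lambda>r. r)"
proof (cases n)
  case (Suc k)
  have "\<forall>r\<ge>0. ((\<lambda>r. r) has_real_derivative 1) (at r within {0..})" by simp
  then show ?thesis unfolding Suc Ck.simps using Ck_const[of k 1] by (intro exI[of _ "\<lambda>_. 1"]) simp
qed simp

text \<open>Bootstrapping: if \<open>u\<close> has class \<open>n\<close>, so has its derivative
  \<open>q * u\<close>, and \<open>u\<close> gains one order.\<close>

lemma Ck_linear_ode:
  assumes u: "\<And>r. r \<ge> 0 \<Longrightarrow> (u has_real_derivative q r * u r) (at r within {0..})" and q: "\<And>n. Ck n q"
  shows "Ck n u"
proof (induction n)
  case 0
  have "continuous_on {0..} u" by (rule DERIV_continuous_on[OF u]) auto
  then show ?case by simp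
next
  case (Suc n)
  then show ?case using u Ck_mult[OF q Suc] unfolding Ck.simps by (intro exI[of _ "\<lambda>r. q r * u r"]) simp
qed

lemma hderiv_eq:
  assumes "(u has_real_derivative d) (at r within {0..})" "r \<ge> 0"
  shows "hderiv u r = d"
  unfolding hderiv_def
proof (rule vector_derivative_within)
  show "at r within {0..} \<noteq> bot"
    using at_le[of "{r<..}" "{0..}" r] assms(2) trivial_limit_at_right_real[of r]
    by (metis atLeast_iff bot.extremum_uniqueI greaterThan_iff less_eq_real_def order_trans subsetI)
  show "(u has_vector_derivative d) (at r within {0..})"
    using assms(1) by (simp add: has_real_derivative_iff_has_vector_derivative)
qed

lemma hderiv_cong:
  assumes "\<And>r. r \<ge> 0 \<Longrightarrow> u r = v r" "r \<ge> 0"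
  shows "hderiv u r = hderiv v r"
proof -
  have "(u has_vector_derivative d) (at r within {0..}) \<longleftrightarrow> (v has_vector_derivative d) (at r within {0..})" for d
    by (rule has_vector_derivative_cong_ev) (use assms in \<open>auto simp: eventually_at_filter\<close>)
  then show ?thesis by (simp add: hderiv_def vector_derivative_def)
qed

lemma Ck_hderiv: "Ck (Suc n) u \<Longrightarrow> Ck n (hderiv u)"
proof -
  assume "Ck (Suc n) u"
  then obtain u' where u': "\<forall>r\<ge>0. (u has_real_derivative u' r) (at r within {0..})" "Ck n u'" by auto
  then have "hderiv u r = u' r" if "r \<ge> 0" for r using hderiv_eq that by blast
  then show ?thesis using u' Ck_cong[of "hderiv u" u'] by simp
qed

lemma smooth_halfline_Ck:
  assumes "\<And>n. Ck n u" shows "smooth_halfline u"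
  unfolding smooth_halfline_def
proof
  fix n
  have "Ck k ((hderiv ^^ n) u)" for k
  proof (induction n arbitrary: k)
    case (Suc n) then show ?case using Ck_hderiv[OF Suc[of "Suc k"]] by simp
  qed (use assms in auto)
  from this[of 1] show "(hderiv ^^ n) u differentiable_on {0..}"
    by (auto simp: differentiable_on_def real_differentiable_def)
qed

text \<open>\<open>r * avg l g r\<close> is the solution of \<open>w' = g - l w/r\<close>, \<open>w(0) = 0\<close>.\<close>

definition avg :: "nat \<Rightarrow> (real \<Rightarrow> real) \<Rightarrow> real \<Rightarrow> real" where
  "avg l g r = integral {0..1} (\<lambda>s. s ^ l * g (s * r))"

lemma continuous_on_scaled:
  fixes g :: "real \<Rightarrow> 'a::topological_space"
  assumes "continuous_on {0..} g"
  shows "continuous_on ({0..} \<times> {0..1}) (\<lambda>(r, s). g (s * r))"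
  unfolding case_prod_beta
  by (rule continuous_on_compose2[OF assms]) (auto intro!: continuous_intros)

lemma continuous_on_scaled1:
  fixes g :: "real \<Rightarrow> 'a::topological_space"
  assumes "continuous_on {0..} g" "r \<ge> 0"
  shows "continuous_on {0..1} (\<lambda>s. g (s * r))"
  by (rule continuous_on_compose2[OF assms(1)]) (use assms in \<open>auto intro!: continuous_intros\<close>)

lemma continuous_avg:
  assumes "continuous_on {0..} g" shows "continuous_on {0..} (avg l g)"
proof -
  have "continuous_on {0..} (\<lambda>r. integral (cbox 0 1) (\<lambda>s. s ^ l * g (s * r)))"
    using continuous_on_scaled[OF assms]
    by (intro integral_continuous_on_param) (auto simp: case_prod_beta intro!: continuous_intros)
  then show ?thesis by (simp add: avg_def[abs_def])
qed

text \<open>Differentiation under the integral brings out a factor \<open>s\<close>, which raises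
  the weight from \<open>l\<close> to \<open>Suc l\<close>. Hence the induction in
  \<open>Ck_avg\<close> runs over all weights at once.\<close>

lemma avg_has_derivative:
  assumes g: "\<And>r. r \<ge> 0 \<Longrightarrow> (g has_real_derivative g' r) (at r within {0..})"
    and g': "continuous_on {0..} g'" and r: "r \<ge> 0"
  shows "(avg l g has_real_derivative avg (Suc l) g' r) (at r within {0..})"
proof -
  have gc: "continuous_on {0..} g" by (rule DERIV_continuous_on) (use g in auto)
  have "((\<lambda>r. integral (cbox 0 1) (\<lambda>s. s ^ l * g (s * r))) has_real_derivative
      integral (cbox 0 1) (\<lambda>s. s ^ Suc l * g' (s * r))) (at r within {0..})"
  proof (rule leibniz_rule_field_derivative)
    fix x t :: real assume xt: "x \<in> {0..}" "t \<in> cbox 0 1"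
    have 1: "((\<lambda>x. t * x) has_real_derivative t) (at x within {0..})"
      by (auto intro!: derivative_eq_intros)
    have 2: "(g has_real_derivative g' (t * x)) (at (t * x) within (\<lambda>x. t * x) ` {0..})"
      by (rule DERIV_subset[OF g]) (use xt in auto)
    show "((\<lambda>x. t ^ l * g (t * x)) has_real_derivative t ^ Suc l * g' (t * x)) (at x within {0..})"
      using DERIV_cmult[OF DERIV_image_chain[OF 2 1], of "t ^ l"] by (simp add: o_def mult_ac)
  next
    fix x :: real assume "x \<in> {0..}"
    then show "(\<lambda>s. s ^ l * g (s * x)) integrable_on cbox 0 1"
      using continuous_on_scaled1[OF gc] by (auto intro!: integrable_continuous_real continuous_intros)
  next
    show "continuous_on ({0..} \<times> cbox 0 1) (\<lambda>(x, t). t ^ Suc l * g' (t * x))"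
      using continuous_on_scaled[OF g'] by (auto simp: case_prod_beta intro!: continuous_intros)
  qed (use r in auto)
  then show ?thesis by (simp add: avg_def[abs_def])
qed

lemma Ck_avg: "Ck n g \<Longrightarrow> Ck n (avg l g)"
proof (induction n arbitrary: g l)
  case 0 then show ?case by (simp add: continuous_avg)
next
  case (Suc n)
  then obtain g' where *: "\<forall>r\<ge>0. (g has_real_derivative g' r) (at r within {0..})" "Ck n g'" by auto
  then show ?case using avg_has_derivative[of g g' _ l] Ck_continuous[OF *(2)] Suc.IH[OF *(2), of "Suc l"] by auto
qed

lemma avg_0: "avg l g 0 = g 0 / (l + 1)"
proof -
  have "((\<lambda>s. s ^ l * g 0) has_integral (1 ^ Suc l / Suc l * g 0 - 0 ^ Suc l / Suc l * g 0)) {0..1::real}"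
  proof (rule fundamental_theorem_of_calculus)
    fix x :: real
    show "((\<lambda>x. x ^ Suc l / Suc l * g 0) has_vector_derivative x ^ l * g 0) (at x within {0..1})"
      unfolding has_real_derivative_iff_has_vector_derivative[symmetric]
      by (rule derivative_eq_intros refl | simp)+
  qed auto
  from integral_unique[OF this] show ?thesis by (simp add: avg_def add.commute)
qed

lemma avg_primitive_has_derivative:
  assumes g: "continuous_on {0..} g" and r: "r > 0"
  shows "((\<lambda>r. r * avg l g r) has_real_derivative g r - l * (r * avg l g r) / r) (at r)"
proof -
  define F where "F t = integral {0..t} (\<lambda>s. s ^ l * g s)" for t
  have c: "continuous_on {0..} (\<lambda>s. s ^ l * g s)" by (intro continuous_intros g)
  have F: "(F has_real_derivative t ^ l * g t) (at t within {0..T})" if "0 \<le> t" "t \<le> T" for t T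
    unfolding F_def
    by (rule integral_has_real_derivative) (use c that in \<open>auto intro: continuous_on_subset\<close>)
  \<comment> \<open>Substitution in the integral: \<open>r * avg l g r\<close> is
    \<open>r^(-l)\<close> times the integral of \<open>s^l * g s\<close> over \<open>[0, r]\<close>,
    the usual variation of constants formula.\<close>
  have Favg: "F t = t ^ Suc l * avg l g t" if "t \<ge> 0" for t
  proof -
    have "((\<lambda>s. t * ((s * t) ^ l * g (s * t))) has_integral F (1 * t) - F (0 * t)) {0..1}"
    proof (rule fundamental_theorem_of_calculus)
      fix s :: real assume s: "s \<in> {0..1}"
      have 1: "((\<lambda>s. s * t) has_real_derivative t) (at s within {0..1})"
        by (auto intro!: derivative_eq_intros)
      have 2: "(F has_real_derivative (s * t) ^ l * g (s * t)) (at (s * t) within (\<lambda>s. s * t) ` {0..1})"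
        by (rule DERIV_subset[OF F[of "s * t" t]]) (use s that in \<open>auto simp: mult_left_le_one_le\<close>)
      show "((\<lambda>s. F (s * t)) has_vector_derivative t * ((s * t) ^ l * g (s * t))) (at s within {0..1})"
        using DERIV_image_chain[OF 2 1]
        by (simp add: o_def mult_ac has_real_derivative_iff_has_vector_derivative)
    qed auto
    from integral_unique[OF this] have "F t = integral {0..1} (\<lambda>s. t * ((s * t) ^ l * g (s * t)))"
      by (simp add: F_def)
    also have "\<dots> = integral {0..1} (\<lambda>s. t ^ Suc l * (s ^ l * g (s * t)))"
      by (simp add: power_mult_distrib mult_ac)
    finally show ?thesis by (simp add: avg_def)
  qed
  have "(F has_real_derivative r ^ l * g r) (at r within {0..r+1})" using F r by simp
  then have F': "(F has_real_derivative r ^ l * g r) (at r)"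
    using r by (simp add: at_within_Icc_at)
  have "((\<lambda>r. F r / r ^ l) has_real_derivative g r - l * (r * avg l g r) / r) (at r)"
  proof -
    have "((\<lambda>r. F r / r ^ l) has_real_derivative
        (r ^ l * g r * r ^ l - F r * (l * r ^ (l - 1))) / (r ^ l * r ^ l)) (at r)"
      using r by (auto intro!: derivative_eq_intros F')
    also have "(r ^ l * g r * r ^ l - F r * (l * r ^ (l - 1))) / (r ^ l * r ^ l) = g r - l * (r * avg l g r) / r"
      using r unfolding Favg[OF less_imp_le[OF r]] by (cases l) (auto simp: field_simps)
    finally show ?thesis .
  qed
  then show ?thesis
  proof (rule has_field_derivative_transform_within[of _ _ _ _ r])
    fix x assume "dist x r < r"
    then have "x > 0" by (auto simp: dist_real_def)
    then show "F x / x ^ l = x * avg l g x" using Favg[of x] by simp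
  qed (use r in auto)
qed

section \<open>A Volterra equation\<close>

text \<open>\<open>K s\<close> will be \<open>weight s\<close>, which absorbs the singular terms, so
  that the fixed point passes through \<open>r = 0\<close> without a local analysis there.
  Boundedness of \<open>G\<close> keeps the weighted iterates bounded; its Lipschitz constant fixes
  the exponential weight.\<close>

lemma volterra_exists:
  fixes G :: "'a::euclidean_space \<Rightarrow> 'a" and K :: "real \<Rightarrow> 'a \<Rightarrow> 'a"
  assumes L: "L \<ge> 1" and G: "\<And>x y. norm (G x - G y) \<le> L * norm (x - y)"
    and M: "\<And>x. norm (G x) \<le> M"
    and K: "\<And>s x. 0 \<le> s \<Longrightarrow> s \<le> 1 \<Longrightarrow> norm (K s x) \<le> norm x"
    and Kd: "\<And>s x y. K s (x - y) = K s x - K s y"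
    and Kc: "continuous_on ({0..1} \<times> UNIV) (\<lambda>(s, x). K s x)"
  obtains V where "continuous_on {0..} V"
    "\<And>r. r \<ge> 0 \<Longrightarrow> V r = V0 + r *\<^sub>R integral {0..1} (\<lambda>s. K s (G (V (s * r))))"
proof -
  have Gc: "continuous_on UNIV G"
    by (rule lipschitz_on_continuous_on[of L]) (use G L in \<open>auto simp: lipschitz_on_def dist_norm\<close>)
  \<comment> \<open>\<open>bcontfun\<close> consists of functions on the whole line, so
    \<open>\<bar>r\<bar>\<close> extends the problem evenly. \<open>U\<close> is the sought solution
    divided by \<open>exp (2 * L * r)\<close>.\<close>
  define I where "I U r s = K s (G (exp (2 * L * (s * \<bar>r\<bar>)) *\<^sub>R U (s * \<bar>r\<bar>)))" for U :: "real \<Rightarrow> 'a" and r s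
  define P where "P U r = V0 + \<bar>r\<bar> *\<^sub>R integral {0..1} (I U r)"
    for U :: "real \<Rightarrow> 'a" and r
  have Ic: "continuous_on (UNIV \<times> {0..1}) (\<lambda>(r, s). I U r s)"
    if U: "continuous_on UNIV U" for U :: "real \<Rightarrow> 'a"
  proof -
    have "continuous_on (UNIV \<times> {0..1}) (\<lambda>p::real \<times> real. (snd p, G (exp (2 * L * (snd p * \<bar>fst p\<bar>)) *\<^sub>R U (snd p * \<bar>fst p\<bar>))))"
      by (intro continuous_intros continuous_on_compose2[OF Gc] continuous_on_compose2[OF U]) auto
    from continuous_on_compose2[OF Kc this] show ?thesis by (simp add: I_def case_prod_beta image_subset_iff)
  qed
  have Ii: "I U r integrable_on {0..1}"
    if U: "continuous_on UNIV U" for U :: "real \<Rightarrow> 'a" and r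
  proof (rule integrable_continuous_real)
    have "continuous_on {0..1} (\<lambda>s. (r, s))" by (intro continuous_intros)
    from continuous_on_compose2[OF Ic[OF U] this]
    show "continuous_on {0..1} (I U r)" by auto
  qed
  have Pc: "continuous_on UNIV (P U)" if U: "continuous_on UNIV U" for U
  proof -
    have "continuous_on UNIV (\<lambda>r. integral (cbox 0 1) (I U r))"
      by (rule integral_continuous_on_param) (use Ic[OF U] in simp)
    then show ?thesis unfolding P_def[abs_def] by (auto intro!: continuous_intros)
  qed
  have Pn: "norm (P U r) \<le> norm V0 + \<bar>r\<bar> * M" if U: "continuous_on UNIV U" for U r
  proof -
    have "norm (integral {0..1} (I U r)) \<le> integral {0..1} (\<lambda>s::real. M)"
      by (rule integral_norm_bound_integral[OF Ii[OF U]]) (use K M order_trans in \<open>fastforce simp: I_def\<close>)+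
    then have "norm (integral {0..1} (I U r)) \<le> M" by simp
    then have "\<bar>r\<bar> * norm (integral {0..1} (I U r)) \<le> \<bar>r\<bar> * M"
      by (intro mult_left_mono) auto
    then show ?thesis unfolding P_def
      by (intro order_trans[OF norm_triangle_ineq]) auto
  qed
  have M0: "M \<ge> 0" using M[of 0] norm_ge_zero order_trans by blast
  \<comment> \<open>The exponential weight has to absorb the linear growth
    \<open>\<bar>r\<bar> * M\<close> of \<open>P\<close>.\<close>
  have expb: "\<bar>r\<bar> * exp (- (2 * L * \<bar>r\<bar>)) \<le> 1" for r :: real
  proof -
    have "\<bar>r\<bar> \<le> 2 * L * \<bar>r\<bar>" using mult_right_mono[of 1 "2 * L" "\<bar>r\<bar>"] L by auto
    also have "\<dots> \<le> exp (2 * L * \<bar>r\<bar>)" using exp_ge_add_one_self[of "2 * L * \<bar>r\<bar>"] by linarith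
    finally show ?thesis by (simp add: exp_minus field_simps)
  qed
  \<comment> \<open>Conjugating by \<open>exp (2Lr)\<close> turns the operator into a contraction of bounded continuous functions.\<close>
  define F where "F U = Bcontfun (\<lambda>r. exp (- (2 * L * \<bar>r\<bar>)) *\<^sub>R P (apply_bcontfun U) r)" for U
  have Uc: "continuous_on UNIV (apply_bcontfun U)" for U :: "real \<Rightarrow>\<^sub>C 'a" by simp
  have F: "apply_bcontfun (F U) r = exp (- (2 * L * \<bar>r\<bar>)) *\<^sub>R P (apply_bcontfun U) r" for U r
  proof -
    have "(\<lambda>r. exp (- (2 * L * \<bar>r\<bar>)) *\<^sub>R P (apply_bcontfun U) r) \<in> bcontfun"
    proof (rule bcontfun_normI)
      show "continuous_on UNIV (\<lambda>r. exp (- (2 * L * \<bar>r\<bar>)) *\<^sub>R P (apply_bcontfun U) r)"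
        by (intro continuous_intros Pc[OF Uc])
      fix r
      have "norm (exp (- (2 * L * \<bar>r\<bar>)) *\<^sub>R P (apply_bcontfun U) r) \<le> exp (- (2 * L * \<bar>r\<bar>)) * (norm V0 + \<bar>r\<bar> * M)"
        using Pn[OF Uc] by (auto intro: mult_left_mono)
      also have "\<dots> = exp (- (2 * L * \<bar>r\<bar>)) * norm V0 + (\<bar>r\<bar> * exp (- (2 * L * \<bar>r\<bar>))) * M"
        by (simp add: algebra_simps)
      also have "\<dots> \<le> 1 * norm V0 + 1 * M"
        using L M0 by (intro add_mono mult_right_mono expb) auto
      finally show "norm (exp (- (2 * L * \<bar>r\<bar>)) *\<^sub>R P (apply_bcontfun U) r) \<le> norm V0 + M" by simp
    qed
    then show ?thesis unfolding F_def by (simp add: Bcontfun_inverse)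
  qed
  have contr: "dist (F U) (F W) \<le> (1/2) * dist U W" for U W
  proof (rule dist_bound)
    fix r
    let ?k = "\<lambda>U. I (apply_bcontfun U) r"
    let ?d = "dist U W"
    \<comment> \<open>Doubling \<open>L\<close> in the exponent makes the primitive carry a factor
      \<open>1/2\<close>, which becomes the contraction constant.\<close>
    have int: "((\<lambda>s. \<bar>r\<bar> * (L * exp (2 * L * (s * \<bar>r\<bar>)) * ?d)) has_integral
        exp (2 * L * (1 * \<bar>r\<bar>)) * ?d / 2 - exp (2 * L * (0 * \<bar>r\<bar>)) * ?d / 2) {0..1}"
      by (rule fundamental_theorem_of_calculus)
        (auto intro!: derivative_eq_intros simp: has_real_derivative_iff_has_vector_derivative[symmetric])
    have le: "norm (\<bar>r\<bar> *\<^sub>R (?k U s - ?k W s)) \<le> \<bar>r\<bar> * (L * exp (2 * L * (s * \<bar>r\<bar>)) * ?d)"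
      if "s \<in> {0..1}" for s
    proof -
      let ?g = "\<lambda>U. G (exp (2 * L * (s * \<bar>r\<bar>)) *\<^sub>R apply_bcontfun U (s * \<bar>r\<bar>))"
      have "norm (?k U s - ?k W s) = norm (K s (?g U - ?g W))" by (simp add: I_def Kd)
      also have "\<dots> \<le> norm (?g U - ?g W)" using that by (intro K) auto
      also have "\<dots> \<le> L * norm (exp (2 * L * (s * \<bar>r\<bar>)) *\<^sub>R apply_bcontfun U (s * \<bar>r\<bar>) - exp (2 * L * (s * \<bar>r\<bar>)) *\<^sub>R apply_bcontfun W (s * \<bar>r\<bar>))"
        by (rule G)
      also have "\<dots> = L * (exp (2 * L * (s * \<bar>r\<bar>)) * dist (apply_bcontfun U (s * \<bar>r\<bar>)) (apply_bcontfun W (s * \<bar>r\<bar>)))"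
        by (simp add: dist_norm flip: scaleR_diff_right)
      also have "\<dots> \<le> L * (exp (2 * L * (s * \<bar>r\<bar>)) * ?d)"
        using L by (intro mult_left_mono dist_bounded) auto
      finally have "norm (?k U s - ?k W s) \<le> L * (exp (2 * L * (s * \<bar>r\<bar>)) * ?d)" .
      then have "\<bar>r\<bar> * norm (?k U s - ?k W s) \<le> \<bar>r\<bar> * (L * (exp (2 * L * (s * \<bar>r\<bar>)) * ?d))"
        by (intro mult_left_mono) auto
      then show ?thesis by (simp add: mult.assoc)
    qed
    have "P (apply_bcontfun U) r - P (apply_bcontfun W) r = integral {0..1} (\<lambda>s. \<bar>r\<bar> *\<^sub>R (?k U s - ?k W s))"
      unfolding integral_cmul integral_diff[OF Ii[OF Uc] Ii[OF Uc]] by (simp add: P_def scaleR_diff_right)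
    also have "norm \<dots> \<le> exp (2 * L * (1 * \<bar>r\<bar>)) * ?d / 2 - exp (2 * L * (0 * \<bar>r\<bar>)) * ?d / 2"
    proof (rule order_trans[OF integral_norm_bound_integral])
      show "(\<lambda>s. \<bar>r\<bar> *\<^sub>R (?k U s - ?k W s)) integrable_on {0..1}"
        using Ii[OF Uc] by (intro integrable_cmul integrable_diff)
      show "(\<lambda>s. \<bar>r\<bar> * (L * exp (2 * L * (s * \<bar>r\<bar>)) * ?d)) integrable_on {0..1}"
        using int by blast
      show "integral {0..1} (\<lambda>s. \<bar>r\<bar> * (L * exp (2 * L * (s * \<bar>r\<bar>)) * ?d)) \<le> 
        exp (2 * L * (1 * \<bar>r\<bar>)) * ?d / 2 - exp (2 * L * (0 * \<bar>r\<bar>)) * ?d / 2"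
        unfolding integral_unique[OF int] ..
    qed (use le in auto)
    also have "\<dots> \<le> exp (2 * L * \<bar>r\<bar>) * ?d / 2" by simp
    finally have "exp (- (2 * L * \<bar>r\<bar>)) * norm (P (apply_bcontfun U) r - P (apply_bcontfun W) r)
        \<le> exp (- (2 * L * \<bar>r\<bar>)) * (exp (2 * L * \<bar>r\<bar>) * ?d / 2)"
      by (intro mult_left_mono) auto
    also have "\<dots> = ?d / 2" by (simp add: exp_minus)
    finally show "dist (apply_bcontfun (F U) r) (apply_bcontfun (F W) r) \<le> (1/2) * ?d"
      by (simp add: F dist_norm flip: scaleR_diff_right)
  qed
  obtain U where U: "F U = U"
    using banach_fix_type[of "1/2" F] contr by auto
  have Ur: "apply_bcontfun U r = exp (- (2 * L * \<bar>r\<bar>)) *\<^sub>R P (apply_bcontfun U) r" for r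
    using F[of U r] U by simp
  define V where "V r = exp (2 * L * r) *\<^sub>R apply_bcontfun U r" for r
  show thesis
  proof
    show "continuous_on {0..} V" unfolding V_def by (auto intro!: continuous_intros)
    fix r :: real assume r: "r \<ge> 0"
    have "V r = P (apply_bcontfun U) r"
      using Ur[of r] r unfolding V_def by (simp add: exp_minus)
    also have "\<dots> = V0 + r *\<^sub>R integral {0..1} (\<lambda>s. K s (G (V (s * r))))"
      using r by (simp add: P_def I_def[abs_def] V_def)
    finally show "V r = V0 + r *\<^sub>R integral {0..1} (\<lambda>s. K s (G (V (s * r))))" .
  qed
qed

section \<open>The reduced system\<close>

text \<open>For an expander, \<open>\<zeta> = a'/a + 2b'/b - f' - 1/r\<close>, \<open>y = b'/b\<close>, \<open>u = - f'\<close>, \<open>\<phi> = - f\<^sub>0 - f\<close>,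
  \<open>k = 1/b\<^sup>2\<close> and \<open>\<Lambda> = ln (a/r)\<close>.\<close>

definition flow_on :: "real \<Rightarrow> (real \<Rightarrow> real) \<Rightarrow> (real \<Rightarrow> real) \<Rightarrow> (real \<Rightarrow> real) \<Rightarrow> (real \<Rightarrow> real)
    \<Rightarrow> (real \<Rightarrow> real) \<Rightarrow> (real \<Rightarrow> real) \<Rightarrow> bool" where
  "flow_on T \<zeta> y u \<phi> k \<Lambda> \<longleftrightarrow>
     continuous_on {0..T} \<zeta> \<and> continuous_on {0..T} y \<and> continuous_on {0..T} u \<and>
     continuous_on {0..T} \<phi> \<and> continuous_on {0..T} k \<and> continuous_on {0..T} \<Lambda> \<and>
     (\<forall>r. 0 < r \<and> r < T \<longrightarrow>
       (\<zeta> has_real_derivative - 2 * \<zeta> r / r - (\<zeta> r)\<^sup>2 + 3 + 2 * k r + 2 * \<phi> r) (at r) \<and>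
       (y has_real_derivative - y r / r - \<zeta> r * y r + 1 + k r) (at r) \<and>
       (u has_real_derivative - u r / r - \<zeta> r * u r + 2 * \<phi> r) (at r) \<and>
       (\<phi> has_real_derivative u r) (at r) \<and>
       (k has_real_derivative - 2 * k r * y r) (at r) \<and>
       (\<Lambda> has_real_derivative \<zeta> r - 2 * y r - u r) (at r))"

lemma coeff_prod_le:
  fixes c C :: real
  assumes "\<bar>c\<bar> \<le> C" "p\<^sup>2 \<le> N" "q\<^sup>2 \<le> N" shows "c * (p * q) \<le> C * N"
proof -
  have "\<bar>p * q\<bar> \<le> N"
    using assms(2,3) sum_squares_bound[of "\<bar>p\<bar>" "\<bar>q\<bar>"] by (simp add: abs_mult)
  then have "\<bar>c\<bar> * \<bar>p * q\<bar> \<le> C * N" using assms by (intro mult_mono) auto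
  then show ?thesis by (simp add: abs_mult[symmetric] abs_le_iff)
qed

text \<open>The singular terms only decrease the squared distance of two solutions.\<close>

lemma flow_dist:
  assumes F: "flow_on T \<zeta>1 y1 u1 \<phi>1 k1 \<Lambda>1" and G: "flow_on T \<zeta>2 y2 u2 \<phi>2 k2 \<Lambda>2"
    and B: "\<And>r. 0 \<le> r \<Longrightarrow> r \<le> T \<Longrightarrow> \<bar>\<zeta>1 r\<bar> \<le> B \<and> \<bar>k1 r\<bar> \<le> B \<and> \<bar>\<zeta>2 r\<bar> \<le> B \<and> \<bar>y2 r\<bar> \<le> B \<and> \<bar>u2 r\<bar> \<le> B"
    and r: "0 \<le> r" "r \<le> T"
  defines "N \<equiv> \<lambda>r. (\<zeta>1 r - \<zeta>2 r)\<^sup>2 + (y1 r - y2 r)\<^sup>2 + (u1 r - u2 r)\<^sup>2 + (\<phi>1 r - \<phi>2 r)\<^sup>2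
      + (k1 r - k2 r)\<^sup>2 + (\<Lambda>1 r - \<Lambda>2 r)\<^sup>2"
  shows "N r \<le> N 0 * exp ((20 * B + 24) * r)"
proof -
  \<comment> \<open>Twice the sum of the fifteen coefficient bounds \<open>a\<close> below:
    \<open>10 * B\<close> from the quadratic terms of the field and \<open>12\<close> from the
    linear ones.\<close>
  define C where "C = 20 * B + 24"
  note F' = F[unfolded flow_on_def] and G' = G[unfolded flow_on_def]
  have Nc: "continuous_on {0..r} (\<lambda>r. N r * exp (- C * r))"
    unfolding N_def using F' G' r
    by (intro continuous_intros) (auto elim!: continuous_on_subset)
  have "N r * exp (- C * r) \<le> N 0 * exp (- C * 0)"
  proof (rule DERIV_nonpos_imp_decreasing_open[where f = "\<lambda>r. N r * exp (- C * r)" and a = 0 and b = r])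
    fix s assume s: "0 < s" "s < r"
    define d1 d2 d3 d4 d5 d6 where d: "d1 = \<zeta>1 s - \<zeta>2 s" "d2 = y1 s - y2 s" "d3 = u1 s - u2 s"
      "d4 = \<phi>1 s - \<phi>2 s" "d5 = k1 s - k2 s" "d6 = \<Lambda>1 s - \<Lambda>2 s"
    \<comment> \<open>Differences of products are split as in
      \<open>\<zeta>1 y1 - \<zeta>2 y2 = \<zeta>1 d2 + y2 d1\<close>; this decides which five
      functions \<open>B\<close> has to bound.\<close>
    define D where "D = 2 * (d1 * (- 2 * d1 / s - (\<zeta>1 s + \<zeta>2 s) * d1 + 2 * d5 + 2 * d4)
      + d2 * (- d2 / s - \<zeta>1 s * d2 - y2 s * d1 + d5) + d3 * (- d3 / s - \<zeta>1 s * d3 - u2 s * d1 + 2 * d4)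
      + d4 * d3 + d5 * (- 2 * k1 s * d2 - 2 * y2 s * d5) + d6 * (d1 - 2 * d2 - d3))"
    have ND: "(N has_real_derivative D) (at s)"
    proof -
      have sq: "((\<lambda>r. (p r - q r)\<^sup>2) has_real_derivative 2 * (p s - q s) * (p' - q')) (at s)"
        if "(p has_real_derivative p') (at s)" "(q has_real_derivative q') (at s)" for p q :: "real \<Rightarrow> real" and p' q'
        using that by (auto intro!: derivative_eq_intros)
      have f: "0 < s \<and> s < T" using s r by auto
      note f' = F'[THEN conjunct2, THEN conjunct2, THEN conjunct2, THEN conjunct2, THEN conjunct2, THEN conjunct2, rule_format, OF f]
      note g' = G'[THEN conjunct2, THEN conjunct2, THEN conjunct2, THEN conjunct2, THEN conjunct2, THEN conjunct2, rule_format, OF f]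
      have "(N has_real_derivative
          2 * (\<zeta>1 s - \<zeta>2 s) * ((- 2 * \<zeta>1 s / s - (\<zeta>1 s)\<^sup>2 + 3 + 2 * k1 s + 2 * \<phi>1 s) - (- 2 * \<zeta>2 s / s - (\<zeta>2 s)\<^sup>2 + 3 + 2 * k2 s + 2 * \<phi>2 s))
        + 2 * (y1 s - y2 s) * ((- y1 s / s - \<zeta>1 s * y1 s + 1 + k1 s) - (- y2 s / s - \<zeta>2 s * y2 s + 1 + k2 s))
        + 2 * (u1 s - u2 s) * ((- u1 s / s - \<zeta>1 s * u1 s + 2 * \<phi>1 s) - (- u2 s / s - \<zeta>2 s * u2 s + 2 * \<phi>2 s))
        + 2 * (\<phi>1 s - \<phi>2 s) * (u1 s - u2 s)
        + 2 * (k1 s - k2 s) * ((- 2 * k1 s * y1 s) - (- 2 * k2 s * y2 s))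
        + 2 * (\<Lambda>1 s - \<Lambda>2 s) * ((\<zeta>1 s - 2 * y1 s - u1 s) - (\<zeta>2 s - 2 * y2 s - u2 s))) (at s)"
        unfolding N_def by (intro DERIV_add sq) (use f' g' in blast)+
      then show ?thesis
        by (rule DERIV_cong) (use s in \<open>simp add: D_def d field_simps power2_eq_square\<close>)
    qed
    have Ns: "N s = d1\<^sup>2 + d2\<^sup>2 + d3\<^sup>2 + d4\<^sup>2 + d5\<^sup>2 + d6\<^sup>2" by (simp add: N_def d)
    have le: "d1\<^sup>2 \<le> N s" "d2\<^sup>2 \<le> N s" "d3\<^sup>2 \<le> N s" "d4\<^sup>2 \<le> N s" "d5\<^sup>2 \<le> N s" "d6\<^sup>2 \<le> N s"
      unfolding Ns by simp_all
    have Bs: "\<bar>\<zeta>1 s\<bar> \<le> B" "\<bar>k1 s\<bar> \<le> B" "\<bar>\<zeta>2 s\<bar> \<le> B" "\<bar>y2 s\<bar> \<le> B" "\<bar>u2 s\<bar> \<le> B"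
      using B[of s] s r by auto
    have D2: "D \<le> C * N s"
    proof -
      have a: "(- (\<zeta>1 s + \<zeta>2 s)) * (d1 * d1) \<le> (2 * B) * N s"
        "2 * (d1 * d5) \<le> 2 * N s" "2 * (d1 * d4) \<le> 2 * N s"
        "(- \<zeta>1 s) * (d2 * d2) \<le> B * N s" "(- y2 s) * (d2 * d1) \<le> B * N s" "1 * (d2 * d5) \<le> 1 * N s"
        "(- \<zeta>1 s) * (d3 * d3) \<le> B * N s" "(- u2 s) * (d3 * d1) \<le> B * N s" "2 * (d3 * d4) \<le> 2 * N s"
        "1 * (d4 * d3) \<le> 1 * N s" "(- 2 * k1 s) * (d5 * d2) \<le> (2 * B) * N s" "(- 2 * y2 s) * (d5 * d5) \<le> (2 * B) * N s"
        "1 * (d6 * d1) \<le> 1 * N s" "(- 2) * (d6 * d2) \<le> 2 * N s" "(- 1) * (d6 * d3) \<le> 1 * N s"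
        by (rule coeff_prod_le; (rule le)?; use Bs in linarith)+
      have b: "d1 * (- 2 * d1 / s) \<le> 0" "d2 * (- d2 / s) \<le> 0" "d3 * (- d3 / s) \<le> 0"
        using s by (simp_all add: field_simps)
      have "D = 2 * (d1 * (- 2 * d1 / s) + (- (\<zeta>1 s + \<zeta>2 s)) * (d1 * d1) + 2 * (d1 * d5) + 2 * (d1 * d4)
        + d2 * (- d2 / s) + (- \<zeta>1 s) * (d2 * d2) + (- y2 s) * (d2 * d1) + 1 * (d2 * d5)
        + d3 * (- d3 / s) + (- \<zeta>1 s) * (d3 * d3) + (- u2 s) * (d3 * d1) + 2 * (d3 * d4)
        + 1 * (d4 * d3) + (- 2 * k1 s) * (d5 * d2) + (- 2 * y2 s) * (d5 * d5)
        + 1 * (d6 * d1) + (- 2) * (d6 * d2) + (- 1) * (d6 * d3))"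
        unfolding D_def by (simp add: algebra_simps)
      also have "\<dots> \<le> 2 * (0 + (2 * B) * N s + 2 * N s + 2 * N s + 0 + B * N s + B * N s + 1 * N s
        + 0 + B * N s + B * N s + 2 * N s + 1 * N s + (2 * B) * N s + (2 * B) * N s + 1 * N s + 2 * N s + 1 * N s)"
        by (intro mult_left_mono add_mono a b) auto
      also have "\<dots> = C * N s" by (simp add: C_def algebra_simps)
      finally show ?thesis .
    qed
    have "((\<lambda>r. N r * exp (- C * r)) has_real_derivative (D - C * N s) * exp (- C * s)) (at s)"
      by (rule derivative_eq_intros ND refl | simp add: algebra_simps)+
    moreover have "(D - C * N s) * exp (- C * s) \<le> 0" using D2 by (simp add: mult_nonpos_nonneg)
    ultimately show "\<exists>l. ((\<lambda>r. N r * exp (- C * r)) has_real_derivative l) (at s) \<and> l \<le> 0" by blast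
  qed (use r Nc in auto)
  then have "N r * exp (- C * r) * exp (C * r) \<le> N 0 * exp (C * r)" by (intro mult_right_mono) auto
  moreover have "exp (- C * r) * exp (C * r) = 1" by (simp flip: exp_add)
  ultimately show ?thesis by (simp only: mult.assoc mult_1_right C_def[symmetric])
qed

section \<open>Truncation of the vector field\<close>

text \<open>Cutting at \<open>0\<close> from below makes every product with a negative component
  vanish, which is how nonnegativity is propagated in \<open>local_picard\<close>.\<close>

definition clamp_to :: "real \<Rightarrow> real \<Rightarrow> real" where
  "clamp_to B t = max 0 (min B t)"

lemma clamp_to: "B \<ge> 0 \<Longrightarrow> 0 \<le> clamp_to B t" "B \<ge> 0 \<Longrightarrow> clamp_to B t \<le> B"
    "\<bar>clamp_to B s - clamp_to B t\<bar> \<le> \<bar>s - t\<bar>" "0 \<le> t \<Longrightarrow> t \<le> B \<Longrightarrow> clamp_to B t = t"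
    "t \<le> 0 \<Longrightarrow> B \<ge> 0 \<Longrightarrow> clamp_to B t = 0" "t \<ge> 0 \<Longrightarrow> clamp_to B t \<le> t"
  by (auto simp: clamp_to_def)

lemma clamp_to_mult:
  assumes "B \<ge> 0"
  shows "\<bar>clamp_to B s * clamp_to B t - clamp_to B s' * clamp_to B t'\<bar> \<le> B * (\<bar>s - s'\<bar> + \<bar>t - t'\<bar>)"
proof -
  have "clamp_to B s * clamp_to B t - clamp_to B s' * clamp_to B t' =
    clamp_to B s * (clamp_to B t - clamp_to B t') + clamp_to B t' * (clamp_to B s - clamp_to B s')"
    by (simp add: algebra_simps)
  also have "\<bar>\<dots>\<bar> \<le> \<bar>clamp_to B s\<bar> * \<bar>clamp_to B t - clamp_to B t'\<bar> + \<bar>clamp_to B t'\<bar> * \<bar>clamp_to B s - clamp_to B s'\<bar>"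
    by (rule order_trans[OF abs_triangle_ineq]) (simp add: abs_mult)
  also have "\<dots> \<le> B * \<bar>t - t'\<bar> + B * \<bar>s - s'\<bar>"
    using assms clamp_to(1,2)[OF assms] by (intro add_mono mult_mono clamp_to(3)) (auto simp: abs_le_iff order_trans[of _ 0])
  finally show ?thesis by (simp add: algebra_simps)
qed

type_synonym state = "real \<times> real \<times> real \<times> real \<times> real \<times> real"

text \<open>Truncation makes the field bounded and Lipschitz; the a priori bounds of the truncated solution
  show that for large \<open>B\<close> it is never active on a given interval.\<close>

definition trunc_field :: "real \<Rightarrow> state \<Rightarrow> state" where
  "trunc_field B = (\<lambda>(\<zeta>, y, u, \<phi>, k, \<Lambda>).
     (3 + 2 * clamp_to B k + 2 * clamp_to B \<phi> - clamp_to B \<zeta> * clamp_to B \<zeta>,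
      1 + clamp_to B k - clamp_to B \<zeta> * clamp_to B y,
      2 * clamp_to B \<phi> - clamp_to B \<zeta> * clamp_to B u,
      clamp_to B u,
      - 2 * (clamp_to B k * clamp_to B y),
      clamp_to B \<zeta> - 2 * clamp_to B y - clamp_to B u))"

text \<open>The exponents \<open>2, 1, 1, 0, 0, 0\<close> are the coefficients of the singular terms
  \<open>- l * w / r\<close>; under the integral, \<open>s ^ l\<close> is the kernel of
  \<open>avg l\<close>.\<close>

definition weight :: "real \<Rightarrow> state \<Rightarrow> state" where
  "weight s = (\<lambda>(\<zeta>, y, u, \<phi>, k, \<Lambda>). (s\<^sup>2 * \<zeta>, s * y, s * u, \<phi>, k, \<Lambda>))"

lemma norm_state_le:
  "norm ((c1, c2, c3, c4, c5, c6) :: state) \<le> \<bar>c1\<bar> + \<bar>c2\<bar> + \<bar>c3\<bar> + \<bar>c4\<bar> + \<bar>c5\<bar> + \<bar>c6\<bar>"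
  using norm_Pair_le[of c1 "(c2, c3, c4, c5, c6)"] norm_Pair_le[of c2 "(c3, c4, c5, c6)"]
    norm_Pair_le[of c3 "(c4, c5, c6)"] norm_Pair_le[of c4 "(c5, c6)"] norm_Pair_le[of c5 c6] by simp

lemma norm_state_ge:
  fixes c1 :: real
  shows "\<bar>c1\<bar> \<le> norm (c1, c2, c3, c4, c5, c6)" "\<bar>c2\<bar> \<le> norm (c1, c2, c3, c4, c5, c6)"
    "\<bar>c3\<bar> \<le> norm (c1, c2, c3, c4, c5, c6)" "\<bar>c4\<bar> \<le> norm (c1, c2, c3, c4, c5, c6)"
    "\<bar>c5\<bar> \<le> norm (c1, c2, c3, c4, c5, c6)" "\<bar>c6\<bar> \<le> norm (c1, c2, c3, c4, c5, c6)"
proof -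
  have *: "norm a \<le> norm (a, b)" "norm b \<le> norm (a, b)" for a :: "'x::real_normed_vector" and b :: "'y::real_normed_vector"
    using norm_fst_le[of a b] norm_snd_le[of b a] by auto
  have 2: "norm (c2, c3, c4, c5, c6) \<le> norm (c1, c2, c3, c4, c5, c6)"
    and 3: "norm (c3, c4, c5, c6) \<le> norm (c2, c3, c4, c5, c6)"
    and 4: "norm (c4, c5, c6) \<le> norm (c3, c4, c5, c6)"
    and 5: "norm (c5, c6) \<le> norm (c4, c5, c6)" by (rule *)+
  have "\<bar>c1\<bar> \<le> norm (c1, c2, c3, c4, c5, c6)" "\<bar>c2\<bar> \<le> norm (c2, c3, c4, c5, c6)"
    "\<bar>c3\<bar> \<le> norm (c3, c4, c5, c6)" "\<bar>c4\<bar> \<le> norm (c4, c5, c6)" "\<bar>c5\<bar> \<le> norm (c5, c6)" "\<bar>c6\<bar> \<le> norm (c5, c6)"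
    unfolding real_norm_def[symmetric] by (rule *)+
  with 2 3 4 5 show "\<bar>c1\<bar> \<le> norm (c1, c2, c3, c4, c5, c6)" "\<bar>c2\<bar> \<le> norm (c1, c2, c3, c4, c5, c6)"
    "\<bar>c3\<bar> \<le> norm (c1, c2, c3, c4, c5, c6)" "\<bar>c4\<bar> \<le> norm (c1, c2, c3, c4, c5, c6)"
    "\<bar>c5\<bar> \<le> norm (c1, c2, c3, c4, c5, c6)" "\<bar>c6\<bar> \<le> norm (c1, c2, c3, c4, c5, c6)" by linarith+
qed

lemma trunc_field_lipschitz:
  assumes B: "B \<ge> 0"
  shows "norm (trunc_field B v - trunc_field B w) \<le> (12 + 10 * B) * norm (v - w)"
proof -
  obtain z y u p k l z' y' u' p' k' l' where vw: "v = (z, y, u, p, k, l)" "w = (z', y', u', p', k', l')"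
    by (metis prod_cases6)
  define n where "n = norm (v - w)"
  have n: "\<bar>z - z'\<bar> \<le> n" "\<bar>y - y'\<bar> \<le> n" "\<bar>u - u'\<bar> \<le> n" "\<bar>p - p'\<bar> \<le> n" "\<bar>k - k'\<bar> \<le> n"
    unfolding n_def vw by (simp_all add: norm_state_ge)
  note c = clamp_to(3)[of B, THEN order_trans]
  have m: "\<bar>clamp_to B s * clamp_to B t - clamp_to B s' * clamp_to B t'\<bar> \<le> 2 * (B * n)"
    if "\<bar>s - s'\<bar> \<le> n" "\<bar>t - t'\<bar> \<le> n" for s t s' t'
  proof -
    have "B * (\<bar>s - s'\<bar> + \<bar>t - t'\<bar>) \<le> B * (n + n)" using that B by (intro mult_left_mono add_mono)
    then show ?thesis using clamp_to_mult[OF B, of s t s' t'] by (simp add: algebra_simps)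
  qed
  have "\<bar>(3 + 2 * clamp_to B k + 2 * clamp_to B p - clamp_to B z * clamp_to B z) - (3 + 2 * clamp_to B k' + 2 * clamp_to B p' - clamp_to B z' * clamp_to B z')\<bar> \<le> 4 * n + 2 * (B * n)"
    using c[OF n(5)] c[OF n(4)] m[OF n(1) n(1)] unfolding abs_le_iff by argo
  moreover have "\<bar>(1 + clamp_to B k - clamp_to B z * clamp_to B y) - (1 + clamp_to B k' - clamp_to B z' * clamp_to B y')\<bar> \<le> n + 2 * (B * n)"
    using c[OF n(5)] m[OF n(1) n(2)] unfolding abs_le_iff by argo
  moreover have "\<bar>(2 * clamp_to B p - clamp_to B z * clamp_to B u) - (2 * clamp_to B p' - clamp_to B z' * clamp_to B u')\<bar> \<le> 2 * n + 2 * (B * n)"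
    using c[OF n(4)] m[OF n(1) n(3)] unfolding abs_le_iff by argo
  moreover have "\<bar>clamp_to B u - clamp_to B u'\<bar> \<le> n" by (rule c[OF n(3)])
  moreover have "\<bar>- 2 * (clamp_to B k * clamp_to B y) - (- 2 * (clamp_to B k' * clamp_to B y'))\<bar> \<le> 4 * (B * n)"
    using m[OF n(5) n(2)] unfolding abs_le_iff by argo
  moreover have "\<bar>(clamp_to B z - 2 * clamp_to B y - clamp_to B u) - (clamp_to B z' - 2 * clamp_to B y' - clamp_to B u')\<bar> \<le> 4 * n"
    using c[OF n(1)] c[OF n(2)] c[OF n(3)] unfolding abs_le_iff by argo
  ultimately have "norm (trunc_field B v - trunc_field B w) \<le> (4 * n + 2 * (B * n)) + (n + 2 * (B * n)) + (2 * n + 2 * (B * n))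
    + n + 4 * (B * n) + 4 * n"
    unfolding vw trunc_field_def prod.case diff_Pair
    by (intro order_trans[OF norm_state_le] add_mono)
  also have "\<dots> = (12 + 10 * B) * n" by (simp add: algebra_simps)
  finally show ?thesis by (simp add: n_def)
qed

lemma trunc_field_bounded:
  assumes B: "B \<ge> 0"
  shows "norm (trunc_field B v) \<le> 4 + 16 * B + 5 * (B * B)"
proof -
  obtain z y u p k l where v: "v = (z, y, u, p, k, l)" by (metis prod_cases6)
  note c = clamp_to(1,2)[OF B]
  have m: "0 \<le> clamp_to B s * clamp_to B t" "clamp_to B s * clamp_to B t \<le> B * B" for s t
    using c B by (auto intro: mult_mono)
  have "\<bar>3 + 2 * clamp_to B k + 2 * clamp_to B p - clamp_to B z * clamp_to B z\<bar> \<le> 3 + 4 * B + B * B"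
    using c[of k] c[of p] m[of z z] B unfolding abs_le_iff by argo
  moreover have "\<bar>1 + clamp_to B k - clamp_to B z * clamp_to B y\<bar> \<le> 1 + B + B * B"
    using c[of k] m[of z y] B unfolding abs_le_iff by argo
  moreover have "\<bar>2 * clamp_to B p - clamp_to B z * clamp_to B u\<bar> \<le> 2 * B + B * B"
    using c[of p] m[of z u] B unfolding abs_le_iff by argo
  moreover have "\<bar>clamp_to B u\<bar> \<le> B" using c[of u] by auto
  moreover have "\<bar>- 2 * (clamp_to B k * clamp_to B y)\<bar> \<le> 2 * (B * B)"
    using m[of k y] B unfolding abs_le_iff by argo
  moreover have "\<bar>clamp_to B z - 2 * clamp_to B y - clamp_to B u\<bar> \<le> 4 * B"
    using c[of z] c[of y] c[of u] B unfolding abs_le_iff by argo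
  ultimately have "norm (trunc_field B v) \<le> (3 + 4 * B + B * B) + (1 + B + B * B) + (2 * B + B * B) + B + 2 * (B * B) + 4 * B"
    unfolding v trunc_field_def prod.case
    by (intro order_trans[OF norm_state_le] add_mono)
  then show ?thesis using B by (simp add: algebra_simps)
qed

lemma weight_props:
  "0 \<le> s \<Longrightarrow> s \<le> 1 \<Longrightarrow> norm (weight s v) \<le> norm v"
  "weight s (v - w) = weight s v - weight s w"
  "continuous_on A (\<lambda>(s, v). weight s v)"
proof -
  obtain z y u p k l where v: "v = (z, y, u, p, k, l)" by (metis prod_cases6)
  show "norm (weight s v) \<le> norm v" if "0 \<le> s" "s \<le> 1"
  proof -
    have "s\<^sup>2 \<le> 1" using that by (simp add: power_le_one)
    then have a: "(s\<^sup>2 * z)\<^sup>2 \<le> z\<^sup>2" "(s * y)\<^sup>2 \<le> y\<^sup>2" "(s * u)\<^sup>2 \<le> u\<^sup>2"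
      using that by (simp_all add: power_mult_distrib mult_left_le_one_le power_le_one)
    then show ?thesis
      unfolding v weight_def prod.case norm_prod_def fst_conv snd_conv real_norm_def
      by (intro real_sqrt_le_mono) auto
  qed
  show "weight s (v - w) = weight s v - weight s w"
    by (cases v; cases w) (auto simp: weight_def algebra_simps)
  show "continuous_on A (\<lambda>(s, v). weight s v)"
    unfolding weight_def case_prod_beta by (intro continuous_intros)
qed

text \<open>Integral form of \<open>w' = g - l * (w - c) / r\<close>, \<open>w 0 = c\<close>.
  Continuity is global but the identity stops at \<open>T\<close>, since a truncated solution lives
  on the half-line and obeys the true equation only up to a horizon.\<close>

definition solves_avg :: "real \<Rightarrow> nat \<Rightarrow> real \<Rightarrow> (real \<Rightarrow> real) \<Rightarrow> (real \<Rightarrow> real) \<Rightarrow> bool" where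
  "solves_avg T l c g w \<longleftrightarrow> continuous_on {0..} w \<and> (\<forall>r. 0 \<le> r \<and> r \<le> T \<longrightarrow> w r = c + r * avg l g r)"

section \<open>Existence and smoothness\<close>

definition picard_on :: "real \<Rightarrow> real \<Rightarrow> real \<Rightarrow> (real \<Rightarrow> real) \<Rightarrow> (real \<Rightarrow> real) \<Rightarrow> (real \<Rightarrow> real) \<Rightarrow> (real \<Rightarrow> real)
    \<Rightarrow> (real \<Rightarrow> real) \<Rightarrow> (real \<Rightarrow> real) \<Rightarrow> bool" where
  "picard_on T k0 m \<zeta> y u \<phi> k \<Lambda> \<longleftrightarrow>
     solves_avg T 2 0 (\<lambda>s. 3 + 2 * k s + 2 * \<phi> s - \<zeta> s * \<zeta> s) \<zeta> \<and>
     solves_avg T 1 0 (\<lambda>s. 1 + k s - \<zeta> s * y s) y \<and>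
     solves_avg T 1 0 (\<lambda>s. 2 * \<phi> s - \<zeta> s * u s) u \<and>
     solves_avg T 0 m u \<phi> \<and>
     solves_avg T 0 k0 (\<lambda>s. - 2 * (k s * y s)) k \<and>
     solves_avg T 0 0 (\<lambda>s. \<zeta> s - 2 * y s - u s) \<Lambda>"

lemma picard_onD:
  assumes "picard_on T k0 m \<zeta> y u \<phi> k \<Lambda>"
  shows "solves_avg T 2 0 (\<lambda>s. 3 + 2 * k s + 2 * \<phi> s - \<zeta> s * \<zeta> s) \<zeta>" "solves_avg T 1 0 (\<lambda>s. 1 + k s - \<zeta> s * y s) y"
    "solves_avg T 1 0 (\<lambda>s. 2 * \<phi> s - \<zeta> s * u s) u" "solves_avg T 0 m u \<phi>"
    "solves_avg T 0 k0 (\<lambda>s. - 2 * (k s * y s)) k" "solves_avg T 0 0 (\<lambda>s. \<zeta> s - 2 * y s - u s) \<Lambda>"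
  using assms by (simp_all add: picard_on_def)

lemma solves_avg_continuous: "solves_avg T l c g w \<Longrightarrow> continuous_on {0..} w"
  and solves_avg_eq: "solves_avg T l c g w \<Longrightarrow> 0 \<le> r \<Longrightarrow> r \<le> T \<Longrightarrow> w r = c + r * avg l g r"
  and solves_avg_init: "solves_avg T l c g w \<Longrightarrow> 0 \<le> T \<Longrightarrow> w 0 = c"
  by (simp_all add: solves_avg_def)

lemma avg_cong:
  assumes "\<And>s. 0 \<le> s \<Longrightarrow> s \<le> r \<Longrightarrow> g s = h s" "r \<ge> 0"
  shows "avg l g r = avg l h r"
  unfolding avg_def
proof (rule integral_cong)
  fix s :: real assume "s \<in> {0..1}"
  then have "0 \<le> s * r" "s * r \<le> r" using assms(2) by (auto simp: mult_left_le_one_le)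
  then show "s ^ l * g (s * r) = s ^ l * h (s * r)" using assms(1) by simp
qed

lemma solves_avg_transfer:
  assumes "solves_avg T l c g w" "continuous_on {0..} w'"
    and eq: "\<And>r. 0 \<le> r \<Longrightarrow> r \<le> T \<Longrightarrow> w' r = w r \<and> g' r = g r"
  shows "solves_avg T l c g' w'"
  unfolding solves_avg_def
proof (intro conjI allI impI)
  fix r assume r: "0 \<le> r \<and> r \<le> T"
  then have "avg l g' r = avg l g r" using eq by (intro avg_cong) auto
  then show "w' r = c + r * avg l g' r" using solves_avg_eq[OF assms(1)] eq r by simp
qed fact

lemma solves_avg_DERIV:
  assumes w: "solves_avg T l c g w" and g: "continuous_on {0..} g" and r: "0 < r" "r < T"
  shows "(w has_real_derivative g r - l * (w r - c) / r) (at r)"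
proof -
  have "((\<lambda>r. c + r * avg l g r) has_real_derivative g r - l * (w r - c) / r) (at r)"
    using DERIV_add[OF DERIV_const avg_primitive_has_derivative[OF g r(1)], of c l] solves_avg_eq[OF w, of r] r by simp
  then show ?thesis
    by (rule has_field_derivative_transform_within_open[of _ _ _ "{0<..<T}"])
      (use r solves_avg_eq[OF w] in auto)
qed

text \<open>With \<open>avg l g r\<close> in place of \<open>(w r - c) / r\<close> one formula also
  covers \<open>r = 0\<close>, where both sides equal \<open>g 0 / (l + 1)\<close>.\<close>

lemma solves_avg_derivative:
  assumes w: "\<And>T. solves_avg T l c g w" and g: "continuous_on {0..} g" and r: "r \<ge> 0"
  shows "(w has_real_derivative g r - l * avg l g r) (at r within {0..})"
proof (cases "r = 0")
  case True
  have "((\<lambda>t. avg l g t) \<longlongrightarrow> avg l g 0) (at 0 within {0..})"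
    using continuous_avg[OF g] by (auto simp: continuous_on_def)
  then have "((\<lambda>t. (w t - w 0) / (t - 0)) \<longlongrightarrow> avg l g 0) (at 0 within {0..})"
    by (rule Lim_transform_eventually) (auto simp: eventually_at_filter solves_avg_eq[OF w _ order_refl])
  moreover have "avg l g 0 = g 0 - l * avg l g 0" by (simp add: avg_0 field_simps)
  ultimately show ?thesis using True by (simp add: has_field_derivative_iff)
next
  case False
  then have "(w has_real_derivative g r - l * (w r - c) / r) (at r)"
    using r by (intro solves_avg_DERIV[OF w[of "r + 1"] g]) auto
  moreover have "l * (w r - c) / r = l * avg l g r" using False solves_avg_eq[OF w r order_refl] by simp
  ultimately show ?thesis by (metis has_field_derivative_at_within)
qed

lemma picard_flow:
  assumes "picard_on T k0 m \<zeta> y u \<phi> k \<Lambda>"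
  shows "flow_on T \<zeta> y u \<phi> k \<Lambda>"
proof -
  note p = picard_onD[OF assms]
  note c = p[THEN solves_avg_continuous]
  have D: "(w has_real_derivative g r - l * (w r - c) / r) (at r)"
    if "solves_avg T l c g w" "continuous_on {0..} g" "0 < r \<and> r < T" for l c g w r
    using solves_avg_DERIV[of T l c g w r] that by simp
  show ?thesis unfolding flow_on_def
  proof (intro conjI allI impI)
    fix r assume r: "0 < r \<and> r < T"
    show "(\<zeta> has_real_derivative - 2 * \<zeta> r / r - (\<zeta> r)\<^sup>2 + 3 + 2 * k r + 2 * \<phi> r) (at r)"
      by (rule DERIV_cong[OF D[OF p(1) _ r]])
        (auto intro!: continuous_intros c simp: power2_eq_square)
    show "(y has_real_derivative - y r / r - \<zeta> r * y r + 1 + k r) (at r)"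
      by (rule DERIV_cong[OF D[OF p(2) _ r]]) (auto intro!: continuous_intros c)
    show "(u has_real_derivative - u r / r - \<zeta> r * u r + 2 * \<phi> r) (at r)"
      by (rule DERIV_cong[OF D[OF p(3) _ r]]) (auto intro!: continuous_intros c)
    show "(\<phi> has_real_derivative u r) (at r)" "(k has_real_derivative - 2 * k r * y r) (at r)"
      "(\<Lambda> has_real_derivative \<zeta> r - 2 * y r - u r) (at r)"
      by (rule DERIV_cong[OF D[OF p(4) _ r]] DERIV_cong[OF D[OF p(5) _ r]] DERIV_cong[OF D[OF p(6) _ r]];
          auto intro!: continuous_intros c)+
  qed (use c in \<open>auto elim: continuous_on_subset\<close>)
qed

text \<open>Bootstrapping: the derivative \<open>g - l * avg l g\<close> is as smooth as
  \<open>g\<close>, at \<open>0\<close> too, and every \<open>g\<close> is polynomial in the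
  components.\<close>

lemma picard_smooth:
  assumes "\<And>T. picard_on T k0 m \<zeta> y u \<phi> k \<Lambda>"
  shows "Ck n \<zeta> \<and> Ck n y \<and> Ck n u \<and> Ck n \<phi> \<and> Ck n k \<and> Ck n \<Lambda>"
proof -
  note p = picard_onD[OF assms]
  have step: "Ck (Suc n) w" if w: "\<And>T. solves_avg T l c g w" and g: "Ck n g" for w g c l n
  proof -
    have "Ck n (\<lambda>r. g r - l * avg l g r)" by (intro Ck_diff Ck_mult Ck_const Ck_avg g)
    then show ?thesis unfolding Ck.simps
      using solves_avg_derivative[OF w Ck_continuous[OF g]] by (intro exI[of _ "\<lambda>r. g r - l * avg l g r"]) simp
  qed
  show ?thesis
  proof (induction n)
    case 0 then show ?case using p[of 0, THEN solves_avg_continuous] by simp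
  next
    case (Suc n)
    then have h: "Ck n \<zeta>" "Ck n y" "Ck n u" "Ck n \<phi>" "Ck n k" "Ck n \<Lambda>" by auto
    show ?case
      by (intro conjI; rule step[OF p(1)] step[OF p(2)] step[OF p(3)] step[OF p(4)] step[OF p(5)] step[OF p(6)];
          intro Ck_add Ck_diff Ck_mult Ck_const h)
  qed
qed

lemma picard_transfer:
  assumes "picard_on T k0 m \<zeta> y u \<phi> k \<Lambda>"
    and c: "continuous_on {0..} \<zeta>'" "continuous_on {0..} y'" "continuous_on {0..} u'"
      "continuous_on {0..} \<phi>'" "continuous_on {0..} k'" "continuous_on {0..} \<Lambda>'"
    and eq: "\<And>r. 0 \<le> r \<Longrightarrow> r \<le> T \<Longrightarrow> \<zeta>' r = \<zeta> r" "\<And>r. 0 \<le> r \<Longrightarrow> r \<le> T \<Longrightarrow> y' r = y r"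
      "\<And>r. 0 \<le> r \<Longrightarrow> r \<le> T \<Longrightarrow> u' r = u r" "\<And>r. 0 \<le> r \<Longrightarrow> r \<le> T \<Longrightarrow> \<phi>' r = \<phi> r"
      "\<And>r. 0 \<le> r \<Longrightarrow> r \<le> T \<Longrightarrow> k' r = k r" "\<And>r. 0 \<le> r \<Longrightarrow> r \<le> T \<Longrightarrow> \<Lambda>' r = \<Lambda> r"
  shows "picard_on T k0 m \<zeta>' y' u' \<phi>' k' \<Lambda>'"
  unfolding picard_on_def
  by (intro conjI; rule solves_avg_transfer[OF picard_onD(1)[OF assms(1)] c(1)] solves_avg_transfer[OF picard_onD(2)[OF assms(1)] c(2)]
      solves_avg_transfer[OF picard_onD(3)[OF assms(1)] c(3)] solves_avg_transfer[OF picard_onD(4)[OF assms(1)] c(4)]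
      solves_avg_transfer[OF picard_onD(5)[OF assms(1)] c(5)] solves_avg_transfer[OF picard_onD(6)[OF assms(1)] c(6)];
      simp add: eq)

lemma picard_init:
  assumes "picard_on T k0 m \<zeta> y u \<phi> k \<Lambda>" "0 \<le> T"
  shows "\<zeta> 0 = 0" "y 0 = 0" "u 0 = 0" "\<phi> 0 = m" "k 0 = k0" "\<Lambda> 0 = 0"
  using assms unfolding picard_on_def by (auto dest: solves_avg_init)

text \<open>All a priori bounds hold for the truncated solution whatever \<open>B \<ge> 0\<close>
  is: signs, because clamping kills products with a negative factor; upper bounds, because the
  subtracted terms are nonnegative and clamping does not increase a nonnegative number. No bound
  involves \<open>B\<close>, so choosing \<open>B\<close> from them is not circular.\<close>

lemma local_picard:
  assumes k0: "k0 > 0" and m: "m > 0" and T: "T \<ge> 0"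
  obtains \<zeta> y u \<phi> k \<Lambda> where "picard_on T k0 m \<zeta> y u \<phi> k \<Lambda>"
    "\<And>r. 0 \<le> r \<Longrightarrow> r \<le> T \<Longrightarrow> \<zeta> r \<ge> 0 \<and> y r \<ge> 0 \<and> u r \<ge> 0 \<and> \<phi> r \<ge> m \<and> 0 \<le> k r \<and> k r \<le> k0"
proof -
  \<comment> \<open>\<open>E\<close> bounds \<open>\<phi> + u\<close>, since
    \<open>(\<phi> + u)' \<le> 2 * (\<phi> + u)\<close> and the initial value is \<open>m\<close>.
    The factor \<open>3 + 2 * k0 + 2 * E\<close> bounds the slope of \<open>\<zeta>\<close>.\<close>
  define E where "E = m * exp (2 * T)"
  define B where "B = (3 + 2 * k0 + 2 * E) * (T + 1)"
  have E: "E > 0" using m by (simp add: E_def)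
  have BE: "3 + 2 * k0 + 2 * E \<le> B" "(3 + 2 * k0 + 2 * E) * T \<le> B"
    using k0 E T by (auto simp: B_def algebra_simps)
  have B0: "B \<ge> 0" "k0 \<le> B" "E \<le> B" using BE k0 E by auto
  have BT: "(1 + k0) * T \<le> B"
  proof -
    have "(1 + k0) * T \<le> (3 + 2 * k0 + 2 * E) * T" using k0 E T by (intro mult_right_mono) auto
    then show ?thesis using BE by simp
  qed
  let ?c = "clamp_to B"
  obtain V where Vc: "continuous_on {0..} V"
    and V: "\<And>r. r \<ge> 0 \<Longrightarrow> V r = (0, 0, 0, m, k0, 0) + r *\<^sub>R integral {0..1} (\<lambda>s. weight s (trunc_field B (V (s * r))))"
    by (rule volterra_exists[where G = "trunc_field B" and K = weight and ?V0.0 = "(0, 0, 0, m, k0, 0)",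
          OF _ trunc_field_lipschitz[OF B0(1)] trunc_field_bounded[OF B0(1)] weight_props]) (use B0 in auto)
  have Tc: "continuous_on UNIV (trunc_field B)"
    by (rule lipschitz_on_continuous_on[of "12 + 10 * B"])
      (use trunc_field_lipschitz[OF B0(1)] B0 in \<open>auto simp: lipschitz_on_def dist_norm\<close>)
  have Gc: "continuous_on {0..} (\<lambda>s. trunc_field B (V s))"
    by (rule continuous_on_compose2[OF Tc Vc]) auto
  \<comment> \<open>On a single coordinate \<open>weight s\<close> is multiplication by
    \<open>s ^ l\<close>, so each projection turns the vector equation into a scalar
    \<open>solves_avg\<close> equation.\<close>
  have comp: "solves_avg T l (h (0, 0, 0, m, k0, 0)) (\<lambda>s. h (trunc_field B (V s))) (\<lambda>r. h (V r))"
    if h: "bounded_linear h" and hw: "\<And>s v. h (weight s v) = s ^ l * h v"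
    for h :: "state \<Rightarrow> real" and l T
    unfolding solves_avg_def
  proof (intro conjI allI impI)
    interpret h: bounded_linear h by (rule h)
    show "continuous_on {0..} (\<lambda>r. h (V r))" by (rule h.continuous_on[OF Vc])
    fix r assume "0 \<le> r \<and> r \<le> T"
    then have r: "r \<ge> 0" by simp
    have "continuous_on {0..1} (\<lambda>s. (s, trunc_field B (V (s * r))))"
      by (intro continuous_intros continuous_on_scaled1[OF Gc r])
    from continuous_on_compose2[OF weight_props(3)[of UNIV] this]
    have "(\<lambda>s. weight s (trunc_field B (V (s * r)))) integrable_on {0..1}"
      by (intro integrable_continuous_real) simp
    from integral_linear[OF this h]
    show "h (V r) = h (0, 0, 0, m, k0, 0) + r * avg l (\<lambda>s. h (trunc_field B (V s))) r"
      unfolding V[OF r] by (simp add: h.add h.scaleR o_def hw avg_def)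
  qed
  define \<zeta> y u \<phi> k \<Lambda> where defs: "\<zeta> = (\<lambda>r. fst (V r))" "y = (\<lambda>r. fst (snd (V r)))" "u = (\<lambda>r. fst (snd (snd (V r))))"
    "\<phi> = (\<lambda>r. fst (snd (snd (snd (V r)))))" "k = (\<lambda>r. fst (snd (snd (snd (snd (V r))))))"
    "\<Lambda> = (\<lambda>r. snd (snd (snd (snd (snd (V r))))))"
  have Vs: "V r = (\<zeta> r, y r, u r, \<phi> r, k r, \<Lambda> r)" for r by (simp add: defs)
  define g1 g2 g3 g4 g5 g6 where g: "g1 = (\<lambda>s. 3 + 2 * ?c (k s) + 2 * ?c (\<phi> s) - ?c (\<zeta> s) * ?c (\<zeta> s))"
    "g2 = (\<lambda>s. 1 + ?c (k s) - ?c (\<zeta> s) * ?c (y s))" "g3 = (\<lambda>s. 2 * ?c (\<phi> s) - ?c (\<zeta> s) * ?c (u s))"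
    "g4 = (\<lambda>s. ?c (u s))" "g5 = (\<lambda>s. - 2 * (?c (k s) * ?c (y s)))" "g6 = (\<lambda>s. ?c (\<zeta> s) - 2 * ?c (y s) - ?c (u s))"
  have tf: "trunc_field B (V s) = (g1 s, g2 s, g3 s, g4 s, g5 s, g6 s)" for s
    by (simp add: Vs trunc_field_def g)
  have sol: "solves_avg T 2 0 g1 \<zeta>" "solves_avg T 1 0 g2 y" "solves_avg T 1 0 g3 u"
    "solves_avg T 0 m g4 \<phi>" "solves_avg T 0 k0 g5 k" "solves_avg T 0 0 g6 \<Lambda>" for T
    using comp[of "\<lambda>v. fst v" 2 T] comp[of "\<lambda>v. fst (snd v)" 1 T] comp[of "\<lambda>v. fst (snd (snd v))" 1 T]
      comp[of "\<lambda>v. fst (snd (snd (snd v)))" 0 T] comp[of "\<lambda>v. fst (snd (snd (snd (snd v))))" 0 T]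
      comp[of "\<lambda>v. snd (snd (snd (snd (snd v))))" 0 T]
    unfolding tf by (simp_all add: defs weight_def case_prod_beta bounded_linear_intros)
  note c = sol[THEN solves_avg_continuous]
  have gc: "continuous_on {0..} g1" "continuous_on {0..} g2" "continuous_on {0..} g3"
    "continuous_on {0..} g4" "continuous_on {0..} g5"
    unfolding g clamp_to_def by (intro continuous_intros c)+
  have D1: "(\<zeta> has_real_derivative g1 r - 2 * \<zeta> r / r) (at r)"
    and D2: "(y has_real_derivative g2 r - y r / r) (at r)"
    and D3: "(u has_real_derivative g3 r - u r / r) (at r)"
    and D4: "(\<phi> has_real_derivative g4 r) (at r)"
    and D5: "(k has_real_derivative g5 r) (at r)" if r: "r > 0" for r
    using solves_avg_DERIV[OF sol(1) gc(1) r less_add_one] solves_avg_DERIV[OF sol(2) gc(2) r less_add_one]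
      solves_avg_DERIV[OF sol(3) gc(3) r less_add_one] solves_avg_DERIV[OF sol(4) gc(4) r less_add_one]
      solves_avg_DERIV[OF sol(5) gc(5) r less_add_one] by simp_all
  have init: "\<zeta> 0 = 0" "y 0 = 0" "u 0 = 0" "\<phi> 0 = m" "k 0 = k0" using sol[of 0, THEN solves_avg_init] by simp_all
  note cl = clamp_to(1,2)[OF B0(1)]
  have k_ge: "k r \<ge> 0" if "r \<ge> 0" for r
  proof (rule barrier[where R = 0 and T = "r" and z' = g5 and z = k])
    fix r assume "0 < r" "k r < 0"
    then show "g5 r \<ge> 0" using B0 by (simp add: g clamp_to(5))
  qed (use that k0 init D5 in \<open>auto intro: continuous_on_subset[OF c(5)]\<close>)
  have nn: "w r \<ge> 0" if r: "r \<ge> 0" and w: "continuous_on {0..} w" "w 0 = 0"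
    and D: "\<And>r. r > 0 \<Longrightarrow> (w has_real_derivative f r - l * w r / r) (at r)"
    and f: "\<And>r. r > 0 \<Longrightarrow> w r < 0 \<Longrightarrow> f r \<ge> 0" and l: "l \<ge> 0" for w f and l r :: real
  proof (rule barrier[where R = 0 and T = r and z' = "\<lambda>r. f r - l * w r / r" and z = w])
    fix r assume r: "0 < r" "w r < 0"
    then have "l * w r / r \<le> 0" using l by (simp add: divide_le_0_iff mult_nonneg_nonpos)
    then show "f r - l * w r / r \<ge> 0" using f[OF r] by linarith
  qed (use r w D in \<open>auto intro: continuous_on_subset[OF w(1)]\<close>)
  have \<zeta>_ge: "\<zeta> r \<ge> 0" if "r \<ge> 0" for r
    by (rule nn[OF that c(1) init(1) D1]) (use cl B0 in \<open>auto simp: g clamp_to(5)\<close>)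
  have y_ge: "y r \<ge> 0" if "r \<ge> 0" for r
    by (rule nn[OF that c(2) init(2), where l = 1 and f = g2]) (use cl B0 D2 in \<open>auto simp: g clamp_to(5)\<close>)
  have u_ge: "u r \<ge> 0" if "r \<ge> 0" for r
    by (rule nn[OF that c(3) init(3), where l = 1 and f = g3]) (use cl B0 D3 in \<open>auto simp: g clamp_to(5)\<close>)
  have \<phi>_ge: "\<phi> r - m \<ge> 0" if "r \<ge> 0" for r
    by (rule barrier[where R = 0 and T = "r" and z' = g4 and z = "\<lambda>r. \<phi> r - m"])
      (use that init D4 cl in \<open>auto simp: g intro!: continuous_intros derivative_eq_intros continuous_on_subset[OF c(4)]\<close>)
  have k_le: "k0 - k r \<ge> 0" if "r \<ge> 0" for r
    by (rule barrier[where R = 0 and T = "r" and z' = "\<lambda>r. - g5 r" and z = "\<lambda>r. k0 - k r"])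
      (use that init D5 cl in \<open>auto simp: g intro!: continuous_intros derivative_eq_intros continuous_on_subset[OF c(5)]\<close>)
  have ckle: "?c (k r) \<le> k0" if "r \<ge> 0" for r
    using clamp_to(6)[OF k_ge[OF that]] k_le[OF that] order_trans by auto
  have y_le: "(1 + k0) * r - y r \<ge> 0" if "r \<ge> 0" for r
  proof (rule barrier[where R = 0 and T = "r" and z' = "\<lambda>r. (1 + k0) - (g2 r - y r / r)" and z = "\<lambda>r. (1 + k0) * r - y r"])
    fix r :: real assume r: "0 < r"
    have "y r / r \<ge> 0" using y_ge[of r] r by simp
    moreover have "?c (\<zeta> r) * ?c (y r) \<ge> 0" using cl by simp
    ultimately show "(1 + k0) - (g2 r - y r / r) \<ge> 0"
      using ckle[OF less_imp_le[OF r(1)]] unfolding g by argo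
  qed (use that init D2 in \<open>auto intro!: continuous_intros derivative_eq_intros continuous_on_subset[OF c(2)]\<close>)
  have S_le: "m - (\<phi> r + u r) * exp (- 2 * r) \<ge> 0" if "r \<ge> 0" for r
  proof (rule barrier[where R = 0 and T = "r" and z' = "\<lambda>r. (2 * (\<phi> r + u r) - (g4 r + (g3 r - u r / r))) * exp (- 2 * r)"
        and z = "\<lambda>r. m - (\<phi> r + u r) * exp (- 2 * r)"])
    show "continuous_on {0..r} (\<lambda>r. m - (\<phi> r + u r) * exp (- 2 * r))"
      by (intro continuous_intros continuous_on_subset[OF c(4)] continuous_on_subset[OF c(3)]) auto
  next
    fix r :: real assume r: "0 < r"
    show "((\<lambda>r. m - (\<phi> r + u r) * exp (- 2 * r)) has_real_derivative (2 * (\<phi> r + u r) - (g4 r + (g3 r - u r / r))) * exp (- 2 * r)) (at r)"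
      using D3[OF r] D4[OF r] by (auto intro!: derivative_eq_intros simp: algebra_simps)
    have "u r / r \<ge> 0" using u_ge[of r] r by simp
    moreover have "?c (\<zeta> r) * ?c (u r) \<ge> 0" using cl by simp
    moreover have "?c (u r) \<le> u r" "?c (\<phi> r) \<le> \<phi> r" using u_ge[of r] \<phi>_ge[of r] r m by (auto intro!: clamp_to(6))
    ultimately have "2 * (\<phi> r + u r) - (g4 r + (g3 r - u r / r)) \<ge> 0" using u_ge[OF less_imp_le[OF r]] unfolding g by argo
    then show "(2 * (\<phi> r + u r) - (g4 r + (g3 r - u r / r))) * exp (- 2 * r) \<ge> 0" by simp
  qed (use that init in auto)
  have S_le': "\<phi> r + u r \<le> E" if r: "0 \<le> r" "r \<le> T" for r
  proof -
    have "(\<phi> r + u r) * exp (- 2 * r) * exp (2 * r) \<le> m * exp (2 * r)"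
      using S_le[OF r(1)] by (intro mult_right_mono) auto
    moreover have "exp (- 2 * r) * exp (2 * r) = 1" by (simp flip: exp_add)
    ultimately have "\<phi> r + u r \<le> m * exp (2 * r)" by (simp only: mult.assoc mult_1_right)
    also have "\<dots> \<le> E" unfolding E_def using r m by (intro mult_left_mono) auto
    finally show ?thesis .
  qed
  have \<zeta>_le: "(3 + 2 * k0 + 2 * E) * r - \<zeta> r \<ge> 0" if r: "0 \<le> r" "r \<le> T" for r
  proof (rule barrier[where R = 0 and T = "T" and z' = "\<lambda>r. (3 + 2 * k0 + 2 * E) - (g1 r - 2 * \<zeta> r / r)"
        and z = "\<lambda>r. (3 + 2 * k0 + 2 * E) * r - \<zeta> r"])
    fix r :: real assume r: "0 < r" "r < T"
    have "\<zeta> r / r \<ge> 0" using \<zeta>_ge[of r] r by simp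
    moreover have "?c (\<zeta> r) * ?c (\<zeta> r) \<ge> 0" by simp
    moreover have "?c (\<phi> r) \<le> E"
      using clamp_to(6)[of "\<phi> r" B] \<phi>_ge[of r] m S_le'[of r] u_ge[of r] r by linarith
    ultimately show "(3 + 2 * k0 + 2 * E) - (g1 r - 2 * \<zeta> r / r) \<ge> 0"
      using ckle[OF less_imp_le[OF r(1)]] unfolding g by argo
  qed (use that init D1 in \<open>auto intro!: continuous_intros derivative_eq_intros continuous_on_subset[OF c(1)]\<close>)
  have cid: "?c (\<zeta> r) = \<zeta> r" "?c (y r) = y r" "?c (u r) = u r" "?c (\<phi> r) = \<phi> r" "?c (k r) = k r"
    if r: "0 \<le> r" "r \<le> T" for r
  proof -
    have "(3 + 2 * k0 + 2 * E) * r \<le> (3 + 2 * k0 + 2 * E) * T" "(1 + k0) * r \<le> (1 + k0) * T"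
      using r k0 E by (auto intro!: mult_left_mono)
    then have "\<zeta> r \<le> B" "y r \<le> B" "u r \<le> B" "\<phi> r \<le> B" "k r \<le> B"
      using \<zeta>_le[OF r] y_le[of r] S_le'[OF r] u_ge[of r] \<phi>_ge[of r] k_le[of r] r BE BT B0 m by linarith+
    then show "?c (\<zeta> r) = \<zeta> r" "?c (y r) = y r" "?c (u r) = u r" "?c (\<phi> r) = \<phi> r" "?c (k r) = k r"
      using \<zeta>_ge[of r] y_ge[of r] u_ge[of r] \<phi>_ge[of r] k_ge[of r] r m by (auto intro!: clamp_to(4))
  qed
  have "picard_on T k0 m \<zeta> y u \<phi> k \<Lambda>"
    unfolding picard_on_def
    by (intro conjI; rule solves_avg_transfer, rule sol, rule c, simp add: g cid)
  then show thesis
    using that \<zeta>_ge y_ge u_ge \<phi>_ge k_ge k_le by force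
qed

lemma continuous_on_Ici:
  fixes f :: "real \<Rightarrow> 'a::topological_space"
  assumes "\<And>T. T > 0 \<Longrightarrow> continuous_on {0..T} f"
  shows "continuous_on {0..} f"
  unfolding continuous_on_def
proof
  fix r :: real assume r: "r \<in> {0..}"
  have "(f \<longlongrightarrow> f r) (at r within {0..r+1})"
    using assms[of "r + 1"] r unfolding continuous_on_def by auto
  moreover have "at r within {0..} = at r within {0..r+1}"
    by (rule at_within_nhd[of _ "{..<r+1}"]) auto
  ultimately show "(f \<longlongrightarrow> f r) (at r within {0..})" by simp
qed

lemma flow_unique:
  assumes F: "flow_on T \<zeta>1 y1 u1 \<phi>1 k1 \<Lambda>1" and G: "flow_on T \<zeta>2 y2 u2 \<phi>2 k2 \<Lambda>2"
    and init: "\<zeta>1 0 = \<zeta>2 0" "y1 0 = y2 0" "u1 0 = u2 0" "\<phi>1 0 = \<phi>2 0" "k1 0 = k2 0" "\<Lambda>1 0 = \<Lambda>2 0"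
    and r: "0 \<le> r" "r \<le> T"
  shows "\<zeta>1 r = \<zeta>2 r" "y1 r = y2 r" "u1 r = u2 r" "\<phi>1 r = \<phi>2 r" "k1 r = k2 r" "\<Lambda>1 r = \<Lambda>2 r"
proof -
  have "\<exists>B. \<forall>s\<in>{0..T}. \<bar>f s\<bar> \<le> B" if "continuous_on {0..T} f" for f :: "real \<Rightarrow> real"
    using compact_imp_bounded[OF compact_continuous_image[OF that compact_Icc]] by (auto simp: bounded_iff)
  then obtain B1 B2 B3 B4 B5 where B: "\<forall>s\<in>{0..T}. \<bar>\<zeta>1 s\<bar> \<le> B1" "\<forall>s\<in>{0..T}. \<bar>k1 s\<bar> \<le> B2"
      "\<forall>s\<in>{0..T}. \<bar>\<zeta>2 s\<bar> \<le> B3" "\<forall>s\<in>{0..T}. \<bar>y2 s\<bar> \<le> B4" "\<forall>s\<in>{0..T}. \<bar>u2 s\<bar> \<le> B5"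
    using F G unfolding flow_on_def by metis
  define B where "B = Max {B1, B2, B3, B4, B5}"
  have "B1 \<le> B" "B2 \<le> B" "B3 \<le> B" "B4 \<le> B" "B5 \<le> B" by (simp_all add: B_def)
  then have "\<bar>\<zeta>1 r\<bar> \<le> B \<and> \<bar>k1 r\<bar> \<le> B \<and> \<bar>\<zeta>2 r\<bar> \<le> B \<and> \<bar>y2 r\<bar> \<le> B \<and> \<bar>u2 r\<bar> \<le> B" if "0 \<le> r" "r \<le> T" for r
    using B that by (meson atLeastAtMost_iff order_trans)
  from flow_dist[OF F G this r] have "(\<zeta>1 r - \<zeta>2 r)\<^sup>2 + (y1 r - y2 r)\<^sup>2 + (u1 r - u2 r)\<^sup>2 + (\<phi>1 r - \<phi>2 r)\<^sup>2
      + (k1 r - k2 r)\<^sup>2 + (\<Lambda>1 r - \<Lambda>2 r)\<^sup>2 \<le> 0" by (simp add: init)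
  moreover have "(\<zeta>1 r - \<zeta>2 r)\<^sup>2 \<ge> 0" "(y1 r - y2 r)\<^sup>2 \<ge> 0" "(u1 r - u2 r)\<^sup>2 \<ge> 0" "(\<phi>1 r - \<phi>2 r)\<^sup>2 \<ge> 0"
    "(k1 r - k2 r)\<^sup>2 \<ge> 0" "(\<Lambda>1 r - \<Lambda>2 r)\<^sup>2 \<ge> 0" by simp_all
  ultimately have "(\<zeta>1 r - \<zeta>2 r)\<^sup>2 = 0" "(y1 r - y2 r)\<^sup>2 = 0" "(u1 r - u2 r)\<^sup>2 = 0" "(\<phi>1 r - \<phi>2 r)\<^sup>2 = 0"
    "(k1 r - k2 r)\<^sup>2 = 0" "(\<Lambda>1 r - \<Lambda>2 r)\<^sup>2 = 0" by linarith+
  then show "\<zeta>1 r = \<zeta>2 r" "y1 r = y2 r" "u1 r = u2 r" "\<phi>1 r = \<phi>2 r" "k1 r = k2 r" "\<Lambda>1 r = \<Lambda>2 r" by simp_all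
qed

lemma global_picard:
  assumes k0: "k0 > 0" and m: "m > 0"
  obtains \<zeta> y u \<phi> k \<Lambda> where "\<And>T. picard_on T k0 m \<zeta> y u \<phi> k \<Lambda>"
    "\<And>r. 0 \<le> r \<Longrightarrow> \<zeta> r \<ge> 0 \<and> y r \<ge> 0 \<and> u r \<ge> 0 \<and> \<phi> r \<ge> m \<and> 0 \<le> k r \<and> k r \<le> k0"
proof -
  have "\<exists>\<zeta> y u \<phi> k \<Lambda>. picard_on T k0 m \<zeta> y u \<phi> k \<Lambda> \<and>
    (\<forall>r. 0 \<le> r \<longrightarrow> r \<le> T \<longrightarrow> \<zeta> r \<ge> 0 \<and> y r \<ge> 0 \<and> u r \<ge> 0 \<and> \<phi> r \<ge> m \<and> 0 \<le> k r \<and> k r \<le> k0)"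
    if T: "T \<ge> 0" for T
    by (rule local_picard[OF k0 m T]) blast
  then obtain Z Y U P K L where S: "\<And>T. T \<ge> 0 \<Longrightarrow> picard_on T k0 m (Z T) (Y T) (U T) (P T) (K T) (L T) \<and>
    (\<forall>r. 0 \<le> r \<longrightarrow> r \<le> T \<longrightarrow> Z T r \<ge> 0 \<and> Y T r \<ge> 0 \<and> U T r \<ge> 0 \<and> P T r \<ge> m \<and> 0 \<le> K T r \<and> K T r \<le> k0)"
    by metis
  have fl: "flow_on T (Z T) (Y T) (U T) (P T) (K T) (L T)" if "T \<ge> 0" for T
    using S[OF that] by (intro picard_flow) auto
  have flm: "flow_on T' (Z T) (Y T) (U T) (P T) (K T) (L T)" if "0 \<le> T'" "T' \<le> T" for T T'
    using fl[of T] that unfolding flow_on_def by (auto elim!: continuous_on_subset)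
  \<comment> \<open>Diagonal gluing: at \<open>r\<close> the solution with horizon \<open>r\<close>
    is used, and \<open>flow_unique\<close> identifies it with every later horizon.\<close>
  define \<zeta> y u \<phi> k \<Lambda> where defs: "\<zeta> = (\<lambda>r. Z r r)" "y = (\<lambda>r. Y r r)" "u = (\<lambda>r. U r r)" "\<phi> = (\<lambda>r. P r r)"
    "k = (\<lambda>r. K r r)" "\<Lambda> = (\<lambda>r. L r r)"
  have eq: "\<zeta> r = Z T r" "y r = Y T r" "u r = U T r" "\<phi> r = P T r" "k r = K T r" "\<Lambda> r = L T r"
    if r: "0 \<le> r" "r \<le> T" for r T
    using flow_unique[OF fl[OF r(1)] flm[OF r], of r] picard_init[OF S[OF r(1), THEN conjunct1] r(1)]
      picard_init[OF S[THEN conjunct1], of T] r unfolding defs by simp_all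
  have c: "continuous_on {0..} f" if "\<And>r T. 0 \<le> r \<Longrightarrow> r \<le> T \<Longrightarrow> f r = F T r"
    "\<And>T. T \<ge> 0 \<Longrightarrow> continuous_on {0..} (F T)" for f and F :: "real \<Rightarrow> real \<Rightarrow> real"
  proof (rule continuous_on_Ici)
    fix T :: real assume T: "T > 0"
    have "continuous_on {0..T} (F T)" using that(2)[of T] T by (auto elim: continuous_on_subset)
    then show "continuous_on {0..T} f"
      by (rule continuous_on_eq) (use that(1) in auto)
  qed
  note Sc = S[THEN conjunct1, THEN picard_onD(1), THEN solves_avg_continuous] S[THEN conjunct1, THEN picard_onD(2), THEN solves_avg_continuous]
    S[THEN conjunct1, THEN picard_onD(3), THEN solves_avg_continuous] S[THEN conjunct1, THEN picard_onD(4), THEN solves_avg_continuous]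
    S[THEN conjunct1, THEN picard_onD(5), THEN solves_avg_continuous] S[THEN conjunct1, THEN picard_onD(6), THEN solves_avg_continuous]
  show thesis
  proof
    show "picard_on T k0 m \<zeta> y u \<phi> k \<Lambda>" for T
    proof (rule picard_transfer)
      \<comment> \<open>For \<open>T < 0\<close> only continuity is claimed, and horizon
        \<open>0\<close> provides it.\<close>
      show "picard_on T k0 m (Z (max 0 T)) (Y (max 0 T)) (U (max 0 T)) (P (max 0 T)) (K (max 0 T)) (L (max 0 T))"
        using S[of "max 0 T"] by (auto simp: picard_on_def solves_avg_def)
      show "continuous_on {0..} \<zeta>" "continuous_on {0..} y" "continuous_on {0..} u"
        "continuous_on {0..} \<phi>" "continuous_on {0..} k" "continuous_on {0..} \<Lambda>"
        by (rule c[OF eq(1) Sc(1)] c[OF eq(2) Sc(2)] c[OF eq(3) Sc(3)] c[OF eq(4) Sc(4)] c[OF eq(5) Sc(5)] c[OF eq(6) Sc(6)]; assumption)+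
    qed (rule eq; simp)+
    show "\<zeta> r \<ge> 0 \<and> y r \<ge> 0 \<and> u r \<ge> 0 \<and> \<phi> r \<ge> m \<and> 0 \<le> k r \<and> k r \<le> k0" if "0 \<le> r" for r
      using S[OF that] that eq[of r r] by simp
  qed
qed

section \<open>Estimates along an expander\<close>

lemma barrier_0:
  fixes z :: "real \<Rightarrow> real"
  assumes "continuous_on {0..} z" "z 0 \<ge> 0" "\<And>r. 0 < r \<Longrightarrow> (z has_real_derivative z' r) (at r)"
    "\<And>r. 0 < r \<Longrightarrow> z r < 0 \<Longrightarrow> z' r \<ge> 0" "r \<ge> 0"
  shows "z r \<ge> 0"
  by (rule barrier[where R = 0 and T = r and z' = z' and z = z])
    (use assms in \<open>auto elim: continuous_on_subset\<close>)

lemma barrier_from: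
  fixes z :: "real \<Rightarrow> real"
  assumes "z R \<ge> 0" "\<And>r. R \<le> r \<Longrightarrow> (z has_real_derivative z' r) (at r)"
    "\<And>r. R \<le> r \<Longrightarrow> z r < 0 \<Longrightarrow> z' r \<ge> 0" "R \<le> r"
  shows "z r \<ge> 0"
proof (rule barrier[where R = R and T = r and z' = z' and z = z])
  show "continuous_on {R..r} z"
    using assms(2) by (intro DERIV_continuous_on[where D = z']) (auto intro: has_field_derivative_at_within)
qed (use assms in auto)

lemma monotone_from:
  fixes z :: "real \<Rightarrow> real"
  assumes "\<And>r. R \<le> r \<Longrightarrow> (z has_real_derivative z' r) (at r)" "\<And>r. R \<le> r \<Longrightarrow> z' r \<ge> 0" "R \<le> r"
  shows "z R \<le> z r"
  using assms by (intro DERIV_nonneg_imp_nondecreasing[of R r z]) auto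

lemma monotone_0:
  fixes z :: "real \<Rightarrow> real"
  assumes "continuous_on {0..} z" "\<And>r. 0 < r \<Longrightarrow> (z has_real_derivative z' r) (at r)"
    "\<And>r. 0 < r \<Longrightarrow> z' r \<ge> 0" "0 \<le> s" "s \<le> r"
  shows "z s \<le> z r"
proof (rule DERIV_nonneg_imp_increasing_open[where f = z and a = s and b = r])
  show "continuous_on {s..r} z" using assms(1) by (rule continuous_on_subset) (use assms(4) in auto)
  fix r' assume "s < r'" "r' < r"
  then have "0 < r'" using assms(4) by simp
  then show "\<exists>d. (z has_real_derivative d) (at r') \<and> d \<ge> 0" using assms(2,3) by blast
qed (rule assms(5))

locale expander_flow =
  fixes b0 m :: real and \<zeta> y u \<phi> k \<Lambda> :: "real \<Rightarrow> real"
  assumes b0: "b0 > 0" and m: "m > 0"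
    and flow: "\<And>T. flow_on T \<zeta> y u \<phi> k \<Lambda>"
    and init: "\<zeta> 0 = 0" "y 0 = 0" "u 0 = 0" "\<phi> 0 = m" "k 0 = 1 / b0\<^sup>2" "\<Lambda> 0 = 0"
begin

text \<open>Here \<open>x\<close> stands for \<open>a'/a\<close> and \<open>t\<close> for \<open>r a'/a\<close>, which is regular at \<open>0\<close>.\<close>

definition "k0 = 1 / b0\<^sup>2"
definition "\<xi> r = 1 / r + \<zeta> r"
definition "t r = 1 + r * \<zeta> r - 2 * r * y r - r * u r"
definition "x r = t r / r"
definition "v r = sqrt (2 * \<phi> r)"

lemma k0: "k0 > 0" using b0 by (simp add: k0_def)

text \<open>By uniqueness every flow with these initial values is the constructed one, so it
  inherits smoothness and signs.\<close>

lemma picard: "picard_on T k0 m \<zeta> y u \<phi> k \<Lambda>"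
  and nonneg: "r \<ge> 0 \<Longrightarrow> \<zeta> r \<ge> 0" "r \<ge> 0 \<Longrightarrow> y r \<ge> 0" "r \<ge> 0 \<Longrightarrow> u r \<ge> 0" "r \<ge> 0 \<Longrightarrow> \<phi> r \<ge> m"
    "r \<ge> 0 \<Longrightarrow> k r \<ge> 0" "r \<ge> 0 \<Longrightarrow> k r \<le> k0"
proof -
  obtain \<zeta>' y' u' \<phi>' k' \<Lambda>' where p: "\<And>T. picard_on T k0 m \<zeta>' y' u' \<phi>' k' \<Lambda>'"
    and n: "\<And>r. 0 \<le> r \<Longrightarrow> \<zeta>' r \<ge> 0 \<and> y' r \<ge> 0 \<and> u' r \<ge> 0 \<and> \<phi>' r \<ge> m \<and> 0 \<le> k' r \<and> k' r \<le> k0"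
    using global_picard[OF k0 m] by metis
  have eq: "\<zeta> r = \<zeta>' r" "y r = y' r" "u r = u' r" "\<phi> r = \<phi>' r" "k r = k' r" "\<Lambda> r = \<Lambda>' r" if "r \<ge> 0" for r
    using flow_unique[OF flow picard_flow[OF p], of r r] picard_init[OF p order_refl] init that by (simp_all add: k0_def)
  have "continuous_on {0..} \<zeta>" "continuous_on {0..} y" "continuous_on {0..} u"
    "continuous_on {0..} \<phi>" "continuous_on {0..} k" "continuous_on {0..} \<Lambda>"
    using flow unfolding flow_on_def by (auto intro!: continuous_on_Ici)
  then show "picard_on T k0 m \<zeta> y u \<phi> k \<Lambda>"
    by (rule picard_transfer[OF p[of T]]) (rule eq, assumption)+
  show "r \<ge> 0 \<Longrightarrow> \<zeta> r \<ge> 0" "r \<ge> 0 \<Longrightarrow> y r \<ge> 0" "r \<ge> 0 \<Longrightarrow> u r \<ge> 0" "r \<ge> 0 \<Longrightarrow> \<phi> r \<ge> m"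
    "r \<ge> 0 \<Longrightarrow> k r \<ge> 0" "r \<ge> 0 \<Longrightarrow> k r \<le> k0"
    using n eq by simp_all
qed

lemma smooth: "Ck n \<zeta>" "Ck n y" "Ck n u" "Ck n \<phi>" "Ck n k" "Ck n \<Lambda>"
  using picard_smooth[OF picard, of n] by auto

lemmas cont = smooth[THEN Ck_continuous]

text \<open>The equation for \<open>u\<close> is singular at \<open>0\<close>; the averaged form
  gives \<open>2 * m - m\<close>. This is what produces the boundary value
  \<open>f''(0) = - m\<close>.\<close>

lemma du_0: "(u has_real_derivative m) (at 0 within {0..})"
proof -
  have "continuous_on {0..} (\<lambda>s. 2 * \<phi> s - \<zeta> s * u s)" by (intro continuous_intros cont)
  from solves_avg_derivative[OF picard_onD(3)[OF picard] this order_refl]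
  show ?thesis by (simp add: avg_0 init)
qed

lemma \<phi>_pos: "r \<ge> 0 \<Longrightarrow> \<phi> r > 0"
  using nonneg(4)[of r] m by linarith

lemma v_pos: "r \<ge> 0 \<Longrightarrow> v r > 0" and v_sq: "r \<ge> 0 \<Longrightarrow> (v r)\<^sup>2 = 2 * \<phi> r"
  using \<phi>_pos[of r] by (auto simp: v_def)

lemma \<xi>_pos: "r > 0 \<Longrightarrow> \<xi> r > 0"
  using nonneg(1)[of r] by (simp add: \<xi>_def add_pos_nonneg)

lemma d\<zeta>: "r > 0 \<Longrightarrow> (\<zeta> has_real_derivative - 2 * \<zeta> r / r - (\<zeta> r)\<^sup>2 + 3 + 2 * k r + 2 * \<phi> r) (at r)"
  and d\<phi>: "r > 0 \<Longrightarrow> (\<phi> has_real_derivative u r) (at r)"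
  and dk: "r > 0 \<Longrightarrow> (k has_real_derivative - 2 * k r * y r) (at r)"
  and d\<Lambda>: "r > 0 \<Longrightarrow> (\<Lambda> has_real_derivative \<zeta> r - 2 * y r - u r) (at r)"
  and dy: "r > 0 \<Longrightarrow> (y has_real_derivative 1 + k r - \<xi> r * y r) (at r)"
  and du: "r > 0 \<Longrightarrow> (u has_real_derivative 2 * \<phi> r - \<xi> r * u r) (at r)"
proof -
  note f = flow[of "r + 1", unfolded flow_on_def, THEN conjunct2, THEN conjunct2, THEN conjunct2, THEN conjunct2,
      THEN conjunct2, THEN conjunct2, rule_format, of r]
  assume r: "r > 0"
  show "(\<zeta> has_real_derivative - 2 * \<zeta> r / r - (\<zeta> r)\<^sup>2 + 3 + 2 * k r + 2 * \<phi> r) (at r)"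
    "(\<phi> has_real_derivative u r) (at r)" "(k has_real_derivative - 2 * k r * y r) (at r)"
    "(\<Lambda> has_real_derivative \<zeta> r - 2 * y r - u r) (at r)" using f r by auto
  have "(y has_real_derivative - y r / r - \<zeta> r * y r + 1 + k r) (at r)" using f r by auto
  then show "(y has_real_derivative 1 + k r - \<xi> r * y r) (at r)"
    by (rule DERIV_cong) (simp add: \<xi>_def algebra_simps)
  have "(u has_real_derivative - u r / r - \<zeta> r * u r + 2 * \<phi> r) (at r)" using f r by auto
  then show "(u has_real_derivative 2 * \<phi> r - \<xi> r * u r) (at r)"
    by (rule DERIV_cong) (simp add: \<xi>_def algebra_simps)
qed

lemma dt: assumes r: "r > 0" shows "(t has_real_derivative r - \<zeta> r * t r) (at r)"
  unfolding t_def[abs_def]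
  by (rule DERIV_cong, (rule derivative_eq_intros refl d\<zeta>[OF r] dy[OF r] du[OF r])+)
    (use r in \<open>simp add: \<xi>_def field_simps power2_eq_square\<close>)

lemma t_cont: "continuous_on {0..} t"
  unfolding t_def[abs_def] by (intro continuous_intros cont)

lemma dx: assumes r: "r > 0" shows "(x has_real_derivative 1 - \<xi> r * x r) (at r)"
  unfolding x_def[abs_def]
  using r by (intro DERIV_cong[OF DERIV_divide[OF dt[OF r] DERIV_ident]])
    (simp_all add: \<xi>_def field_simps power2_eq_square)

lemma \<xi>_eq: "r > 0 \<Longrightarrow> \<xi> r = x r + 2 * y r + u r"
  by (simp add: \<xi>_def x_def t_def field_simps)

lemma t_nonneg: "r \<ge> 0 \<Longrightarrow> t r \<ge> 0"
proof (rule barrier_0[OF t_cont _ dt])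
  fix r assume r: "0 < r" "t r < 0"
  then have "\<zeta> r * t r \<le> 0" using nonneg(1)[of r] by (simp add: mult_nonneg_nonpos)
  then show "r - \<zeta> r * t r \<ge> 0" using r by simp
qed (auto simp: t_def)

lemma x_nonneg: "r > 0 \<Longrightarrow> x r \<ge> 0"
  using t_nonneg[of r] by (simp add: x_def)

lemma constraint: assumes r: "r > 0"
  shows "(\<xi> r)\<^sup>2 = (x r)\<^sup>2 + 2 * (y r)\<^sup>2 + 2 + 2 * k r + (v r)\<^sup>2"
proof -
  \<comment> \<open>\<open>e\<close> is \<open>r\<close> times the defect of the constraint; this factor makes it continuous and zero at \<open>0\<close>.\<close>
  define e where "e r = (2 * y r + u r) * (2 + 2 * (r * \<zeta> r) - r * (2 * y r + u r))
    - r * (2 * (y r)\<^sup>2 + 2 + 2 * k r + 2 * \<phi> r)" for r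
  have ec: "continuous_on {0..} e" unfolding e_def[abs_def] by (intro continuous_intros cont)
  have e0: "e 0 = 0" by (simp add: e_def init)
  \<comment> \<open>The defect obeys a linear homogeneous equation with nonpositive coefficient, so
    the barrier keeps both \<open>e\<close> and \<open>- e\<close> nonnegative.\<close>
  have de: "(e has_real_derivative - (1 / r + 2 * \<zeta> r) * e r) (at r)" if r: "r > 0" for r
    unfolding e_def[abs_def]
    by (rule DERIV_cong, (rule derivative_eq_intros refl d\<zeta>[OF r] dy[OF r] du[OF r] d\<phi>[OF r] dk[OF r])+)
      (use r in \<open>simp add: \<xi>_def field_simps power2_eq_square\<close>)
  have p: "1 / r + 2 * \<zeta> r \<ge> 0" if "r > 0" for r using that nonneg(1)[of r] by simp
  have "e r \<ge> 0"
  proof (rule barrier_0[OF ec _ de])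
    show "- (1 / s + 2 * \<zeta> s) * e s \<ge> 0" if "0 < s" "e s < 0" for s
      using mult_nonneg_nonpos[OF p[OF that(1)] less_imp_le[OF that(2)]] by (simp only: mult_minus_left)
  qed (use e0 r in auto)
  moreover have "- e r \<ge> 0"
  proof (rule barrier_0[where z = "\<lambda>r. - e r" and z' = "\<lambda>r. - (- (1 / r + 2 * \<zeta> r) * e r)"])
    show "- (- (1 / s + 2 * \<zeta> s) * e s) \<ge> 0" if "0 < s" "- e s < 0" for s
      using mult_nonneg_nonneg[OF p[OF that(1)], of "e s"] that(2) by (simp only: mult_minus_left minus_minus neg_less_0_iff_less less_imp_le)
    show "((\<lambda>r. - e r) has_real_derivative - (- (1 / s + 2 * \<zeta> s) * e s)) (at s)" if "0 < s" for s
      by (rule DERIV_minus[OF de[OF that]])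
    show "continuous_on {0..} (\<lambda>r. - e r)" by (intro continuous_intros ec)
  qed (use e0 r in auto)
  ultimately have "e r = 0" by simp
  moreover have "r * ((\<xi> r)\<^sup>2 - (x r)\<^sup>2) = (2 * y r + u r) * (2 + 2 * (r * \<zeta> r) - r * (2 * y r + u r))"
    using r by (simp add: \<xi>_def x_def t_def field_simps power2_eq_square)
  ultimately have "r * ((\<xi> r)\<^sup>2 - (x r)\<^sup>2 - (2 * (y r)\<^sup>2 + 2 + 2 * k r + 2 * \<phi> r)) = 0"
    by (simp add: e_def algebra_simps)
  then show ?thesis using r v_sq[of r] by simp
qed

lemma \<xi>_ge_v: assumes r: "r > 0" shows "\<xi> r \<ge> v r"
proof -
  have "(v r)\<^sup>2 \<le> (\<xi> r)\<^sup>2" using constraint[OF r] nonneg(5)[of r] r by simp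
  then show ?thesis using \<xi>_pos[OF r] by (simp add: power2_le_iff_abs_le)
qed

lemma v_cont: "continuous_on {0..} v"
  unfolding v_def[abs_def] by (intro continuous_intros cont)

lemma dv: assumes r: "r > 0" shows "(v has_real_derivative u r / v r) (at r)"
proof -
  have "\<phi> r > 0" using \<phi>_pos r by simp
  then show ?thesis unfolding v_def[abs_def]
    by (auto intro!: derivative_eq_intros d\<phi>[OF r] simp: field_simps)
qed

text \<open>As \<open>\<xi> \<ge> v\<close>, the derivative \<open>u' = v^2 - \<xi> * u\<close> is
  nonpositive once \<open>u > v\<close>. Because \<open>v' = u / v\<close>, this says
  \<open>v' \<le> 1\<close>, hence \<open>v_le\<close>.\<close>

lemma u_le_v: "r \<ge> 0 \<Longrightarrow> u r \<le> v r"
proof -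
  assume "r \<ge> 0"
  then have "v r - u r \<ge> 0"
  proof (rule barrier_0[where z = "\<lambda>r. v r - u r" and z' = "\<lambda>r. u r / v r - (2 * \<phi> r - \<xi> r * u r)", rotated 4])
    fix r :: real assume r: "0 < r" "v r - u r < 0"
    have "\<xi> r * u r \<ge> v r * v r" using \<xi>_ge_v[OF r(1)] r v_pos[of r] by (intro mult_mono) auto
    moreover have "u r / v r \<ge> 0" using nonneg(3)[of r] v_pos[of r] r by simp
    ultimately show "u r / v r - (2 * \<phi> r - \<xi> r * u r) \<ge> 0"
      using v_sq[of r] r unfolding power2_eq_square by simp
  qed (use v_pos[of 0] in \<open>auto simp: init intro!: continuous_intros v_cont cont derivative_eq_intros dv du\<close>)
  then show ?thesis by simp
qed

lemma v_le: assumes r: "r \<ge> 0" shows "v r \<le> sqrt (2 * m) + r"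
proof -
  have "sqrt (2 * m) + r - v r \<ge> 0"
  proof (rule barrier_0[where z = "\<lambda>r. sqrt (2 * m) + r - v r" and z' = "\<lambda>r. 1 - u r / v r", OF _ _ _ _ r])
    fix r :: real assume r: "0 < r"
    show "((\<lambda>r. sqrt (2 * m) + r - v r) has_real_derivative 1 - u r / v r) (at r)"
      by (auto intro!: derivative_eq_intros dv[OF r])
    show "1 - u r / v r \<ge> 0" using u_le_v[of r] v_pos[of r] r by simp
  qed (auto simp: v_def init intro!: continuous_intros cont)
  then show ?thesis by simp
qed

text \<open>The summand \<open>sqrt (2 * m) + r\<close> dominates \<open>u\<close>, and
  \<open>3 / r\<close> solves \<open>q' = - q^2 / 3\<close>, the Riccati equation that
  Cauchy--Schwarz with weights \<open>1\<close> and \<open>2\<close> gives for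
  \<open>x + 2y\<close>. The comparison is made for \<open>r * \<xi>\<close>, which is regular at
  \<open>0\<close>.\<close>

lemma \<xi>_le: assumes r: "r > 0" shows "\<xi> r \<le> 3 / r + sqrt (2 * m) + r"
proof -
  let ?V = "sqrt (2 * m)"
  have "3 + ?V * r + r\<^sup>2 - (1 + r * \<zeta> r) \<ge> 0"
  proof (rule barrier_0[where z = "\<lambda>r. 3 + ?V * r + r\<^sup>2 - (1 + r * \<zeta> r)"])
    fix r :: real assume r: "0 < r"
    show "((\<lambda>r. 3 + ?V * r + r\<^sup>2 - (1 + r * \<zeta> r)) has_real_derivative
      ?V + 2 * r - (\<zeta> r + r * (- 2 * \<zeta> r / r - (\<zeta> r)\<^sup>2 + 3 + 2 * k r + 2 * \<phi> r))) (at r)"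
      by (rule DERIV_cong, (rule derivative_eq_intros refl d\<zeta>[OF r])+) simp
    assume neg: "3 + ?V * r + r\<^sup>2 - (1 + r * \<zeta> r) < 0"
    then have "(2 + ?V * r + r\<^sup>2) / r < \<zeta> r" using r by (simp add: pos_divide_less_eq mult.commute)
    moreover have "(2 + ?V * r + r\<^sup>2) / r = 2 / r + ?V + r"
      using r by (simp add: add_divide_distrib power2_eq_square)
    ultimately have g: "\<xi> r > 3 / r + ?V + r" by (simp add: \<xi>_def)
    define q where "q = \<xi> r - ?V - r"
    have q: "q > 3 / r" using g by (simp add: q_def)
    then have q0: "q > 0" using r by (meson divide_pos_pos less_trans zero_less_numeral)
    have xu: "\<xi> r - u r \<ge> q" using u_le_v[of r] v_le[of r] r by (simp add: q_def)
    \<comment> \<open>Cauchy--Schwarz turns \<open>\<xi>' = 1 - x\<^sup>2 - 2y\<^sup>2\<close> into a Riccati inequality.\<close>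
    have "3 * ((x r)\<^sup>2 + 2 * (y r)\<^sup>2) \<ge> (x r + 2 * y r)\<^sup>2"
      using sum_squares_ge_zero[of "x r - y r" 0] by (simp add: power2_eq_square algebra_simps)
    also have "(x r + 2 * y r)\<^sup>2 = (\<xi> r - u r)\<^sup>2" using \<xi>_eq[OF r] by simp
    also have "(\<xi> r - u r)\<^sup>2 \<ge> q\<^sup>2" using xu q0 by (intro power_mono) auto
    also have "q\<^sup>2 \<ge> q * (3 / r)" using q q0 unfolding power2_eq_square by (intro mult_left_mono) auto
    finally have "q * (3 / r) \<le> 3 * ((x r)\<^sup>2 + 2 * (y r)\<^sup>2)" .
    moreover have "q * (3 / r) = 3 * (q / r)" by simp
    ultimately have "(x r)\<^sup>2 + 2 * (y r)\<^sup>2 \<ge> q / r" by argo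
    then have s: "r * ((x r)\<^sup>2 + 2 * (y r)\<^sup>2) \<ge> q" using r by (simp add: field_simps)
    have "\<zeta> r + r * (- 2 * \<zeta> r / r - (\<zeta> r)\<^sup>2 + 3 + 2 * k r + 2 * \<phi> r) = \<xi> r + r * (1 - (x r)\<^sup>2 - 2 * (y r)\<^sup>2)"
    proof -
      have "- 2 * \<zeta> r / r - (\<zeta> r)\<^sup>2 = 1 / r\<^sup>2 - (\<xi> r)\<^sup>2" using r by (simp add: \<xi>_def field_simps power2_eq_square)
      also have "\<dots> = 1 / r\<^sup>2 - ((x r)\<^sup>2 + 2 * (y r)\<^sup>2 + 2 + 2 * k r + 2 * \<phi> r)"
        using constraint[OF r] v_sq[of r] r by simp
      finally have F: "- 2 * \<zeta> r / r - (\<zeta> r)\<^sup>2 = 1 / r\<^sup>2 - ((x r)\<^sup>2 + 2 * (y r)\<^sup>2 + 2 + 2 * k r + 2 * \<phi> r)" .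
      have "r * (1 / r\<^sup>2) = 1 / r" using r by (simp add: power2_eq_square)
      then show ?thesis unfolding F by (simp add: \<xi>_def algebra_simps)
    qed
    then show "?V + 2 * r - (\<zeta> r + r * (- 2 * \<zeta> r / r - (\<zeta> r)\<^sup>2 + 3 + 2 * k r + 2 * \<phi> r)) \<ge> 0"
      using s by (simp add: q_def algebra_simps)
  qed (use r in \<open>auto intro!: continuous_intros cont\<close>)
  then have "\<zeta> r \<le> (2 + ?V * r + r\<^sup>2) / r" using r by (simp add: pos_le_divide_eq mult.commute)
  also have "\<dots> = 2 / r + ?V + r"
    using r by (simp add: add_divide_distrib power2_eq_square)
  finally show ?thesis by (simp add: \<xi>_def)
qed

text \<open>The comparison function \<open>g = c * r / (1 + r^2)\<close> satisfies
  \<open>g / r \<le> c\<close>, \<open>g \<le> c\<close>, \<open>g * r \<le> c\<close> and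
  \<open>g' \<le> c\<close>. With \<open>\<xi>_le\<close> this gives
  \<open>g' + \<xi> * g \<le> c * (5 + sqrt (2 * m)) = C\<close>: the \<open>5\<close> is
  \<open>3 + 1\<close> from the bound of \<open>\<xi>\<close> and \<open>1\<close> from
  \<open>g'\<close>.\<close>

lemma rate_lower_bound:
  fixes z z' :: "real \<Rightarrow> real"
  assumes z: "continuous_on {0..} z" "z 0 \<ge> 0" "\<And>r. 0 < r \<Longrightarrow> (z has_real_derivative z' r) (at r)"
    and z': "\<And>r. 0 < r \<Longrightarrow> z' r \<ge> C - \<xi> r * z r" and C: "C \<ge> 0" and r: "r \<ge> 0"
  shows "z r \<ge> C / (5 + sqrt (2 * m)) * r / (1 + r\<^sup>2)"
proof -
  let ?V = "sqrt (2 * m)"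
  define c where "c = C / (5 + ?V)"
  have V: "?V \<ge> 0" using m by simp
  have "5 + ?V > 0" using V by linarith
  then have c: "c \<ge> 0" "c * (5 + ?V) = C" using C by (simp_all add: c_def)
  have "z r - c * r / (1 + r\<^sup>2) \<ge> 0"
  proof (rule barrier_0[where z = "\<lambda>r. z r - c * r / (1 + r\<^sup>2)", OF _ _ _ _ r])
    have nz: "1 + r\<^sup>2 \<noteq> 0" for r :: real
      by (metis add_nonneg_eq_0_iff zero_le_one zero_le_power2 zero_neq_one)
    show "continuous_on {0..} (\<lambda>r. z r - c * r / (1 + r\<^sup>2))" using nz by (intro continuous_intros z) auto
    fix r :: real assume r: "0 < r"
    show "((\<lambda>r. z r - c * r / (1 + r\<^sup>2)) has_real_derivative z' r - (c * (1 + r\<^sup>2) - c * r * (2 * r)) / (1 + r\<^sup>2)\<^sup>2) (at r)"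
      using nz[of r] by (auto intro!: derivative_eq_intros z(3)[OF r] simp: power2_eq_square)
    assume neg: "z r - c * r / (1 + r\<^sup>2) < 0"
    define g where "g = c * r / (1 + r\<^sup>2)"
    have p: "1 + r\<^sup>2 > 0" by (simp add: add_pos_nonneg)
    have g0: "g \<ge> 0" using c r p by (simp add: g_def)
    have g1: "g \<le> c * r" "g \<le> c" "g * r \<le> c"
    proof -
      have "1 + r * r \<ge> 2 * r" using sum_squares_bound[of 1 r] by (simp add: power2_eq_square)
      then have rr: "r \<le> 1 + r * r" using r by linarith
      have "c * r * 1 \<le> c * r * (1 + r\<^sup>2)" using c r by (intro mult_left_mono) auto
      then show "g \<le> c * r" unfolding g_def using p by (simp add: pos_divide_le_eq)
      have "c * r \<le> c * (1 + r\<^sup>2)" using c rr by (intro mult_left_mono) (auto simp: power2_eq_square)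
      then show "g \<le> c" unfolding g_def using p by (simp add: pos_divide_le_eq)
      have "c * r * r \<le> c * (1 + r\<^sup>2)" using c by (simp add: power2_eq_square algebra_simps)
      then show "g * r \<le> c" unfolding g_def using p by (simp add: pos_divide_le_eq)
    qed
    have "\<xi> r * z r \<le> \<xi> r * g" using neg \<xi>_pos[OF r] by (intro mult_left_mono) (auto simp: g_def)
    also have "\<dots> \<le> (3 / r + ?V + r) * g" using \<xi>_le[OF r] g0 by (intro mult_right_mono) auto
    also have "\<dots> = 3 * g / r + ?V * g + g * r" by (simp add: algebra_simps)
    also have "\<dots> \<le> 3 * c + ?V * c + c"
    proof (intro add_mono g1 mult_left_mono V)
      show "3 * g / r \<le> 3 * c" using g1 r by (simp add: field_simps)
    qed
    finally have "\<xi> r * z r \<le> c * (4 + ?V)" by (simp add: algebra_simps)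
    moreover have "(c * (1 + r\<^sup>2) - c * r * (2 * r)) / (1 + r\<^sup>2)\<^sup>2 \<le> c"
    proof -
      have "(c * (1 + r\<^sup>2) - c * r * (2 * r)) = c * (1 - r\<^sup>2)" by (simp add: algebra_simps power2_eq_square)
      also have "\<dots> \<le> c * (1 + r\<^sup>2)\<^sup>2"
      proof (rule mult_left_mono[OF _ c(1)])
        have "(1 + r\<^sup>2)\<^sup>2 = 1 + 2 * r\<^sup>2 + (r\<^sup>2)\<^sup>2" by (simp add: power2_sum)
        then show "1 - r\<^sup>2 \<le> (1 + r\<^sup>2)\<^sup>2" using zero_le_power2[of r] zero_le_power2[of "r\<^sup>2"] by linarith
      qed
      finally show ?thesis using p by (simp add: pos_divide_le_eq)
    qed
    ultimately show "z' r - (c * (1 + r\<^sup>2) - c * r * (2 * r)) / (1 + r\<^sup>2)\<^sup>2 \<ge> 0"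
      using z'[OF r] c(2) by (simp add: algebra_simps)
  qed (use z in auto)
  then show ?thesis by (simp add: c_def)
qed

lemma u_ge: "r \<ge> 0 \<Longrightarrow> u r \<ge> 2 * m / (5 + sqrt (2 * m)) * r / (1 + r\<^sup>2)"
proof (rule rate_lower_bound[OF cont(3) _ du])
  fix r :: real assume "0 < r"
  then show "2 * m - \<xi> r * u r \<le> 2 * \<phi> r - \<xi> r * u r" using nonneg(4)[of r] by simp
qed (use m init in auto)

text \<open>Integrating \<open>u_ge\<close> yields only logarithmic growth, while in fact
  \<open>v' \<longlonglongrightarrow> 1\<close>; but this bound is explicit in \<open>m\<close>,
  which the uniform statements about parameters need.\<close>

lemma \<phi>_ge: assumes r: "r \<ge> 0" shows "\<phi> r \<ge> m + m / (5 + sqrt (2 * m)) * ln (1 + r\<^sup>2)"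
proof -
  define c where "c = m / (5 + sqrt (2 * m))"
  have p: "1 + r\<^sup>2 > 0" for r :: real by (simp add: add_pos_nonneg)
  have "\<phi> 0 - c * ln (1 + 0\<^sup>2) \<le> \<phi> r - c * ln (1 + r\<^sup>2)"
  proof (rule monotone_0[where z = "\<lambda>r. \<phi> r - c * ln (1 + r\<^sup>2)"])
    show "continuous_on {0..} (\<lambda>r. \<phi> r - c * ln (1 + r\<^sup>2))"
    proof (intro continuous_intros cont ballI)
      show "1 + r\<^sup>2 \<noteq> 0" for r :: real using p[of r] by linarith
    qed
    fix r :: real assume r: "0 < r"
    show "((\<lambda>r. \<phi> r - c * ln (1 + r\<^sup>2)) has_real_derivative u r - 2 * c * r / (1 + r\<^sup>2)) (at r)"
      using p[of r] by (auto intro!: derivative_eq_intros d\<phi>[OF r])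
    have "2 * c = 2 * m / (5 + sqrt (2 * m))" by (simp add: c_def)
    then show "u r - 2 * c * r / (1 + r\<^sup>2) \<ge> 0" using u_ge[of r] r by simp
  qed (use r in auto)
  then show ?thesis by (simp add: init c_def)
qed

lemma \<phi>_mono: "0 \<le> s \<Longrightarrow> s \<le> r \<Longrightarrow> \<phi> s \<le> \<phi> r"
  by (rule monotone_0[OF cont(4) d\<phi>]) (use nonneg(3) in auto)

lemma v_mono: "0 \<le> s \<Longrightarrow> s \<le> r \<Longrightarrow> v s \<le> v r"
  using \<phi>_mono by (simp add: v_def)

text \<open>Since \<open>\<zeta> \<ge> x - 1 / r\<close>, a value \<open>t > 1 + r\<close> forces
  \<open>\<zeta> \<ge> 1\<close> and thus \<open>t' < 0\<close>. The bound contains no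
  parameter.\<close>

lemma x_le: assumes r: "r > 0" shows "x r \<le> 1 + 1 / r"
proof -
  have "1 + r - t r \<ge> 0"
  proof (rule barrier_0[where z = "\<lambda>r. 1 + r - t r" and z' = "\<lambda>r. 1 - (r - \<zeta> r * t r)"])
    fix r :: real assume r: "0 < r" "1 + r - t r < 0"
    have "\<zeta> r \<ge> x r - 1 / r" using \<xi>_eq[OF r(1)] nonneg(2,3)[of r] r by (simp add: \<xi>_def)
    also have "x r - 1 / r = (t r - 1) / r" by (simp add: x_def diff_divide_distrib)
    also have "\<dots> \<ge> 1" using r by simp
    finally have "\<zeta> r * t r \<ge> 1 * t r" using r by (intro mult_right_mono) auto
    then show "1 - (r - \<zeta> r * t r) \<ge> 0" using r by linarith
  next
    show "continuous_on {0..} (\<lambda>r. 1 + r - t r)" by (intro continuous_intros t_cont)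
    show "((\<lambda>r. 1 + r - t r) has_real_derivative 1 - (r - \<zeta> r * t r)) (at r)" if "0 < r" for r
      by (auto intro!: derivative_eq_intros dt[OF that])
  qed (use r in \<open>simp_all add: t_def\<close>)
  then show ?thesis using r by (simp add: x_def field_simps)
qed

text \<open>Because \<open>\<xi> \<ge> 2 * y\<close>, the damping rate is at least \<open>1\<close>
  where \<open>y > 1 + k0\<close>, and there \<open>y\<close> decreases.\<close>

lemma y_le: "r \<ge> 0 \<Longrightarrow> y r \<le> 1 + k0"
proof -
  assume r: "r \<ge> 0"
  have "1 + k0 - y r \<ge> 0"
  proof (rule barrier_0[where z = "\<lambda>r. 1 + k0 - y r" and z' = "\<lambda>r. - (1 + k r - \<xi> r * y r)", OF _ _ _ _ r])
    fix r :: real assume r: "0 < r" "1 + k0 - y r < 0"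
    have "\<xi> r \<ge> 1" using \<xi>_eq[OF r(1)] x_nonneg[OF r(1)] nonneg(3)[of r] r k0 by simp
    then have "\<xi> r * y r \<ge> 1 * y r" using r k0 by (intro mult_right_mono) auto
    then show "- (1 + k r - \<xi> r * y r) \<ge> 0" using r nonneg(6)[of r] by simp
  qed (use k0 in \<open>auto simp: init intro!: continuous_intros cont derivative_eq_intros dy\<close>)
  then show ?thesis by simp
qed

lemma k_pos: "r \<ge> 0 \<Longrightarrow> k r > 0"
proof -
  assume r: "r \<ge> 0"
  have "k 0 * exp (2 * (1 + k0) * 0) \<le> k r * exp (2 * (1 + k0) * r)"
  proof (rule monotone_0[where z = "\<lambda>r. k r * exp (2 * (1 + k0) * r)"])
    fix r :: real assume r: "0 < r"
    show "((\<lambda>r. k r * exp (2 * (1 + k0) * r)) has_real_derivative 2 * k r * (1 + k0 - y r) * exp (2 * (1 + k0) * r)) (at r)"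
      by (rule DERIV_cong, (rule derivative_eq_intros refl dk[OF r])+) (simp add: algebra_simps)
    show "2 * k r * (1 + k0 - y r) * exp (2 * (1 + k0) * r) \<ge> 0"
      using nonneg(5)[of r] y_le[of r] r by simp
  qed (use r in \<open>auto intro!: continuous_intros cont\<close>)
  then have "k0 \<le> k r * exp (2 * (1 + k0) * r)" by (simp add: init k0_def)
  then have "0 < k r * exp (2 * (1 + k0) * r)" using k0 by linarith
  then show ?thesis by (simp add: zero_less_mult_iff)
qed

end

section \<open>Monotone quotients and their tails\<close>

context expander_flow
begin

text \<open>\<open>la\<close> and \<open>lb\<close> are the logarithms of \<open>a/v\<close> and \<open>b/v\<close>, and \<open>Da\<close>, \<open>Db\<close> their derivatives.\<close>

definition "p r = u r / \<phi> r"
definition "la r = ln r + \<Lambda> r - ln (2 * \<phi> r) / 2"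
definition "lb r = - ln (k r) / 2 - ln (2 * \<phi> r) / 2"
definition "Da r = x r - p r / 2"
definition "Db r = y r - p r / 2"

lemma dp: assumes r: "r > 0" shows "(p has_real_derivative 2 - \<xi> r * p r - (p r)\<^sup>2) (at r)"
proof -
  have f: "\<phi> r \<noteq> 0" using \<phi>_pos[of r] r by simp
  have "(p has_real_derivative ((2 * \<phi> r - \<xi> r * u r) * \<phi> r - u r * u r) / (\<phi> r * \<phi> r)) (at r)"
    unfolding p_def[abs_def] by (rule DERIV_divide[OF du[OF r] d\<phi>[OF r] f])
  then show ?thesis
    by (rule DERIV_cong) (use f in \<open>simp add: p_def field_simps power2_eq_square\<close>)
qed

lemma p_cont: "continuous_on {0..} p"
  unfolding p_def[abs_def] using \<phi>_pos by (intro continuous_intros cont) force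

lemma p_nonneg: "r \<ge> 0 \<Longrightarrow> p r \<ge> 0"
  using nonneg(3)[of r] \<phi>_pos[of r] by (simp add: p_def)

lemma p_le: assumes r: "r \<ge> 0" shows "p r \<le> 2 / v r"
proof -
  have "p r \<le> v r / \<phi> r" unfolding p_def using u_le_v[OF r] \<phi>_pos[OF r] by (intro divide_right_mono) auto
  also have "\<phi> r = v r * v r / 2" using v_sq[OF r] by (simp add: power2_eq_square)
  also have "v r / (v r * v r / 2) = 2 / v r" using v_pos[OF r] by simp
  finally show ?thesis .
qed

lemma p_sq_le: assumes r: "r \<ge> 0" shows "(p r)\<^sup>2 \<le> 2 / \<phi> r"
proof -
  have "(p r)\<^sup>2 \<le> (2 / v r)\<^sup>2" using p_le[OF r] p_nonneg[OF r] by (rule power_mono)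
  also have "\<dots> = 2 / \<phi> r" using v_sq[OF r] by (simp add: power_divide)
  finally show ?thesis .
qed

lemma dla: assumes r: "r > 0" shows "(la has_real_derivative Da r) (at r)"
proof -
  have f: "\<phi> r > 0" using \<phi>_pos[of r] r by simp
  have "(la has_real_derivative 1 / r + (\<zeta> r - 2 * y r - u r) - 2 * u r / (2 * \<phi> r) / 2) (at r)"
    unfolding la_def[abs_def] using f r
    by (auto intro!: derivative_eq_intros d\<Lambda>[OF r] d\<phi>[OF r] simp: field_simps)
  then show ?thesis
    by (rule DERIV_cong) (use \<xi>_eq[OF r] in \<open>simp add: Da_def p_def \<xi>_def\<close>)
qed

lemma dlb: assumes r: "r > 0" shows "(lb has_real_derivative Db r) (at r)"
proof -
  have f: "\<phi> r > 0" "k r > 0" using \<phi>_pos[of r] k_pos[of r] r by simp_all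
  have "(lb has_real_derivative - (- 2 * k r * y r / k r) / 2 - 2 * u r / (2 * \<phi> r) / 2) (at r)"
    unfolding lb_def[abs_def] using f
    by (auto intro!: derivative_eq_intros dk[OF r] d\<phi>[OF r] simp: field_simps)
  then show ?thesis
    by (rule DERIV_cong) (use f in \<open>simp add: Db_def p_def\<close>)
qed

lemma dDa: assumes r: "r > 0" shows "(Da has_real_derivative - \<xi> r * Da r + (p r)\<^sup>2 / 2) (at r)"
  unfolding Da_def[abs_def]
  by (rule DERIV_cong[OF DERIV_diff[OF dx[OF r] DERIV_cdivide[OF dp[OF r]]]]) (simp add: algebra_simps diff_divide_distrib)

lemma dDb: assumes r: "r > 0" shows "(Db has_real_derivative - \<xi> r * Db r + (k r + (p r)\<^sup>2 / 2)) (at r)"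
  unfolding Db_def[abs_def]
  by (rule DERIV_cong[OF DERIV_diff[OF dy[OF r] DERIV_cdivide[OF dp[OF r]]]]) (simp add: algebra_simps diff_divide_distrib)

lemma Da_nonneg: assumes r: "r > 0" shows "Da r \<ge> 0"
proof -
  \<comment> \<open>Multiplication by \<open>r\<close> makes \<open>Da\<close> continuous at
    \<open>0\<close>, as the barrier requires.\<close>
  have "t r - r * p r / 2 \<ge> 0"
  proof (rule barrier_0[where z = "\<lambda>r. t r - r * p r / 2"])
    show "continuous_on {0..} (\<lambda>r. t r - r * p r / 2)" by (intro continuous_intros t_cont p_cont) auto
    fix r :: real assume r: "0 < r"
    show "((\<lambda>r. t r - r * p r / 2) has_real_derivative - \<zeta> r * (t r - r * p r / 2) + r * (p r)\<^sup>2 / 2) (at r)"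
      by (rule DERIV_cong[OF DERIV_diff[OF dt[OF r] DERIV_cdivide[OF DERIV_mult[OF DERIV_ident dp[OF r]]]]])
        (use r in \<open>simp add: \<xi>_def field_simps power2_eq_square\<close>)
    assume neg: "t r - r * p r / 2 < 0"
    have "\<zeta> r * (t r - r * p r / 2) \<le> 0" using nonneg(1)[of r] r neg by (intro mult_nonneg_nonpos) auto
    moreover have "r * (p r)\<^sup>2 / 2 \<ge> 0" using r by simp
    ultimately show "- \<zeta> r * (t r - r * p r / 2) + r * (p r)\<^sup>2 / 2 \<ge> 0" by (simp only: mult_minus_left)
  qed (use r in \<open>auto simp: t_def\<close>)
  then show ?thesis using r by (simp add: Da_def x_def field_simps)
qed

lemma Db_nonneg: assumes r: "r \<ge> 0" shows "Db r \<ge> 0"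
proof (rule barrier_0[OF _ _ dDb _ r])
  show "continuous_on {0..} Db" unfolding Db_def[abs_def] by (intro continuous_intros cont p_cont) auto
  fix r :: real assume r: "0 < r" "Db r < 0"
  have "\<xi> r * Db r \<le> 0" using \<xi>_pos r by (intro mult_nonneg_nonpos) (auto intro: less_imp_le)
  moreover have "k r + (p r)\<^sup>2 / 2 \<ge> 0" using nonneg(5)[of r] r by simp
  ultimately show "- \<xi> r * Db r + (k r + (p r)\<^sup>2 / 2) \<ge> 0" by (simp only: mult_minus_left)
qed (auto simp: Db_def p_def init)

lemma la_mono: "0 < R \<Longrightarrow> R \<le> r \<Longrightarrow> la R \<le> la r"
  by (rule monotone_from[of R la Da]) (auto intro: dla Da_nonneg)

lemma lb_cont: "continuous_on {0..} lb"
  unfolding lb_def[abs_def]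
  by (intro continuous_intros cont) (use \<phi>_pos k_pos in \<open>force+\<close>)

lemma lb_mono: "0 \<le> R \<Longrightarrow> R \<le> r \<Longrightarrow> lb R \<le> lb r"
  by (rule monotone_0[of lb Db]) (auto intro: dlb Db_nonneg lb_cont)

text \<open>\<open>2 * k * \<phi>\<close> is the square of \<open>v / b\<close>, which is
  nonincreasing. This provides the decay of the source \<open>k\<close> in
  \<open>dDb\<close>.\<close>

lemma k\<phi>_le: assumes r: "r \<ge> 0" shows "k r * \<phi> r \<le> k0 * m"
proof -
  have "ln (k r) + ln (2 * \<phi> r) \<le> ln k0 + ln (2 * m)"
    using lb_mono[of 0 r] r unfolding lb_def by (simp add: init k0_def)
  then have "ln (k r * (2 * \<phi> r)) \<le> ln (k0 * (2 * m))"
    using k_pos[OF r] \<phi>_pos[OF r] k0 m by (simp add: ln_mult)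
  then show ?thesis using k_pos[OF r] \<phi>_pos[OF r] k0 m by simp
qed

text \<open>\<open>D\<close> is dominated by \<open>D(R) exp (- v(R) (r - R)) + c p / (2\<phi>)\<close>, which has an explicit primitive.\<close>

lemma tail:
  fixes l D S :: "real \<Rightarrow> real"
  assumes R: "R > 0" "\<phi> R \<ge> 4" and c: "c \<ge> 0"
    and l: "\<And>r. R \<le> r \<Longrightarrow> (l has_real_derivative D r) (at r)"
    and D: "\<And>r. R \<le> r \<Longrightarrow> (D has_real_derivative - \<xi> r * D r + S r) (at r)"
    and S: "\<And>r. R \<le> r \<Longrightarrow> S r \<le> c / \<phi> r" and DR: "D R \<ge> 0" and r: "R \<le> r"
  shows "l r \<le> l R + D R / v R + c / \<phi> R"
proof -
  define g where "g s = D R * exp (- v R * (s - R))" for s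
  have vR: "v R > 0" using v_pos R by simp
  have g0: "g s \<ge> 0" for s using DR by (simp add: g_def)
  have dg: "(g has_real_derivative - v R * g s) (at s)" for s
    unfolding g_def by (auto intro!: derivative_eq_intros)
  have main: "g s + c * (p s / \<phi> s) - D s \<ge> 0" if s: "R \<le> s" for s
  proof (rule barrier_from[where z = "\<lambda>s. g s + c * (p s / \<phi> s) - D s" and R = R])
    have "g R = D R" by (simp add: g_def)
    then show "g R + c * (p R / \<phi> R) - D R \<ge> 0" using c p_nonneg[of R] \<phi>_pos[of R] R by simp
    fix s assume s: "R \<le> s"
    then have s0: "s > 0" using R by simp
    have f: "\<phi> s > 0" using \<phi>_pos s0 by simp
    have f4: "\<phi> s \<ge> 4" using \<phi>_mono[of R s] R s by simp
    show "((\<lambda>s. g s + c * (p s / \<phi> s) - D s) has_real_derivative - v R * g s + c * (((2 - \<xi> s * p s - (p s)\<^sup>2) * \<phi> s - p s * u s) / (\<phi> s * \<phi> s)) - (- \<xi> s * D s + S s)) (at s)"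
      by (intro DERIV_diff DERIV_add dg DERIV_cmult DERIV_divide dp[OF s0] D[OF s] d\<phi>[OF s0]) (use f in auto)
    assume neg: "g s + c * (p s / \<phi> s) - D s < 0"
    have "((2 - \<xi> s * p s - (p s)\<^sup>2) * \<phi> s - p s * u s) / (\<phi> s * \<phi> s) = 2 * (1 - (p s)\<^sup>2) / \<phi> s - \<xi> s * (p s / \<phi> s)"
      using f by (simp add: p_def field_simps power2_eq_square)
    then have e: "c * (((2 - \<xi> s * p s - (p s)\<^sup>2) * \<phi> s - p s * u s) / (\<phi> s * \<phi> s)) = c * (2 * (1 - (p s)\<^sup>2) / \<phi> s) - \<xi> s * (c * (p s / \<phi> s))"
      by (simp only: right_diff_distrib mult.left_commute)
    \<comment> \<open>Here \<open>\<phi> R \<ge> 4\<close> is used: it makes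
      \<open>2 * (1 - p^2) \<ge> 1\<close>, so that \<open>c * p / \<phi>\<close> outweighs a source
      of size \<open>c / \<phi>\<close>.\<close>
    have "(p s)\<^sup>2 \<le> 2 / \<phi> s" using p_sq_le s0 by simp
    also have "\<dots> \<le> 1 / 2" using f4 by simp
    finally have "1 / \<phi> s \<le> 2 * (1 - (p s)\<^sup>2) / \<phi> s" using f by (intro divide_right_mono) auto
    then have "c * (1 / \<phi> s) \<le> c * (2 * (1 - (p s)\<^sup>2) / \<phi> s)" using c by (rule mult_left_mono)
    then have 1: "c * (2 * (1 - (p s)\<^sup>2) / \<phi> s) \<ge> S s" using S[OF s] by simp
    have "\<xi> s * (g s + c * (p s / \<phi> s)) \<le> \<xi> s * D s" using neg \<xi>_pos[OF s0] by (intro mult_left_mono) auto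
    then have 2: "\<xi> s * g s + \<xi> s * (c * (p s / \<phi> s)) \<le> \<xi> s * D s" by (simp only: distrib_left)
    have "v R \<le> \<xi> s" using v_mono[of R s] \<xi>_ge_v[OF s0] R s by simp
    then have 3: "v R * g s \<le> \<xi> s * g s" using g0 by (rule mult_right_mono)
    show "- v R * g s + c * (((2 - \<xi> s * p s - (p s)\<^sup>2) * \<phi> s - p s * u s) / (\<phi> s * \<phi> s)) - (- \<xi> s * D s + S s) \<ge> 0"
      unfolding e mult_minus_left using 1 2 3 by linarith
  qed (use s in auto)
  \<comment> \<open>From \<open>\<phi>' = p * \<phi>\<close>, a primitive of
    \<open>p / \<phi>\<close> is \<open>- 1 / \<phi>\<close>; the exponential part contributes
    \<open>D R / v R\<close> in total.\<close>
  have "- (l R + g R / v R + c * (1 / \<phi> R)) \<le> - (l r + g r / v R + c * (1 / \<phi> r))"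
  proof (rule monotone_from[where R = R and z = "\<lambda>s. - (l s + g s / v R + c * (1 / \<phi> s))"])
    fix s assume s: "R \<le> s"
    then have s0: "s > 0" using R by simp
    have f: "\<phi> s > 0" using \<phi>_pos s0 by simp
    have "((\<lambda>s. - (l s + g s / v R + c * (1 / \<phi> s))) has_real_derivative - (D s + (- v R * g s) / v R + c * ((0 * \<phi> s - 1 * u s) / (\<phi> s * \<phi> s)))) (at s)"
      by (intro DERIV_minus DERIV_add l[OF s] DERIV_cdivide dg DERIV_cmult DERIV_divide DERIV_const d\<phi>[OF s0]) (use f in auto)
    then show "((\<lambda>s. - (l s + g s / v R + c * (1 / \<phi> s))) has_real_derivative g s + c * (p s / \<phi> s) - D s) (at s)"
      by (rule DERIV_cong) (use f vR in \<open>simp add: p_def field_simps\<close>)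
  qed (use main r in auto)
  moreover have "g R = D R" by (simp add: g_def)
  moreover have "g r / v R \<ge> 0" "c * (1 / \<phi> r) \<ge> 0" using g0 vR c \<phi>_pos[of r] R r by auto
  ultimately show ?thesis by simp
qed

lemma Sa_le: "r \<ge> 0 \<Longrightarrow> (p r)\<^sup>2 / 2 \<le> 1 / \<phi> r"
  using p_sq_le[of r] by simp

lemma Sb_le: assumes r: "r \<ge> 0" shows "k r + (p r)\<^sup>2 / 2 \<le> (1 + k0 * m) / \<phi> r"
proof -
  have "k r \<le> k0 * m / \<phi> r" using k\<phi>_le[OF r] \<phi>_pos[OF r] by (simp add: pos_le_divide_eq)
  then show ?thesis using Sa_le[OF r] by (simp add: add_divide_distrib)
qed

lemma la_tail:
  assumes R: "R > 0" "\<phi> R \<ge> 4" "R \<le> r"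
  shows "la r \<le> la R + x R / v R + 1 / \<phi> R"
proof -
  have "la r \<le> la R + Da R / v R + 1 / \<phi> R"
    by (rule tail[OF R(1,2) _ dla dDa Sa_le Da_nonneg R(3)]) (use R in auto)
  moreover have "Da R / v R \<le> x R / v R"
    using v_pos[of R] p_nonneg[of R] R by (intro divide_right_mono) (auto simp: Da_def)
  ultimately show ?thesis by simp
qed

lemma lb_tail:
  assumes R: "R > 0" "\<phi> R \<ge> 4" "R \<le> r"
  shows "lb r \<le> lb R + y R / v R + (1 + k0 * m) / \<phi> R"
proof -
  have "lb r \<le> lb R + Db R / v R + (1 + k0 * m) / \<phi> R"
    by (rule tail[OF R(1,2) _ dlb dDb Sb_le Db_nonneg R(3)]) (use R k0 m in auto)
  moreover have "Db R / v R \<le> y R / v R"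
    using v_pos[of R] p_nonneg[of R] R by (intro divide_right_mono) (auto simp: Db_def)
  ultimately show ?thesis by simp
qed

section \<open>Limits of the logarithmic derivatives\<close>

text \<open>\<open>K / \<phi>\<close> is a supersolution: its own logarithmic derivative is
  \<open>- p\<close>, and \<open>\<xi> - p \<ge> v / 2\<close> for \<open>\<phi> \<ge> 4\<close>, so
  the damping exceeds the slope by at least \<open>(K / \<phi>) * (v / 2) = K / v\<close>.\<close>

lemma decay:
  fixes z z' :: "real \<Rightarrow> real"
  assumes R: "R > 0" "\<phi> R \<ge> 4"
    and z: "\<And>r. R \<le> r \<Longrightarrow> (z has_real_derivative z' r) (at r)"
    and z': "\<And>r. R \<le> r \<Longrightarrow> z' r \<le> - \<xi> r * z r + C / v r"
  obtains K where "K \<ge> 0" "\<And>r. R \<le> r \<Longrightarrow> z r \<le> K / \<phi> r"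
proof -
  define K where "K = max 0 (max C (z R * \<phi> R))"
  have K: "K \<ge> 0" "K \<ge> C" "K \<ge> z R * \<phi> R" by (auto simp: K_def)
  have "K * (1 / \<phi> r) - z r \<ge> 0" if r: "R \<le> r" for r
  proof (rule barrier_from[where z = "\<lambda>r. K * (1 / \<phi> r) - z r" and R = R])
    show "K * (1 / \<phi> R) - z R \<ge> 0" using K(3) R by (simp add: field_simps)
    fix s assume s: "R \<le> s"
    then have s0: "s > 0" using R by simp
    have f: "\<phi> s > 0" using \<phi>_pos s0 by simp
    have f4: "\<phi> s \<ge> 4" using \<phi>_mono[of R s] R s by simp
    show "((\<lambda>r. K * (1 / \<phi> r) - z r) has_real_derivative K * ((0 * \<phi> s - 1 * u s) / (\<phi> s * \<phi> s)) - z' s) (at s)"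
      by (intro DERIV_diff DERIV_cmult DERIV_divide DERIV_const d\<phi>[OF s0] z[OF s]) (use f in auto)
    assume neg: "K * (1 / \<phi> s) - z s < 0"
    have vs: "v s > 0" "v s * v s = 2 * \<phi> s" using v_pos[of s] v_sq[of s] s0 by (auto simp: power2_eq_square)
    have v2: "v s \<ge> 2"
      using f4 vs by (intro power2_le_imp_le[of 2 "v s"]) (auto simp: power2_eq_square)
    have pv: "p s \<le> v s / 2"
    proof -
      have "p s \<le> 2 / v s" using p_le s0 by simp
      also have "\<dots> \<le> v s / 2" using f4 vs by (simp add: field_simps)
      finally show ?thesis .
    qed
    have "(K / \<phi> s) * (v s / 2) \<le> (K / \<phi> s) * (\<xi> s - p s)"
      using K f pv \<xi>_ge_v[OF s0] by (intro mult_left_mono) auto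
    moreover have "(K / \<phi> s) * (v s / 2) = K / v s"
    proof -
      have "\<phi> s = v s * v s / 2" using vs by simp
      then show ?thesis using vs(1) by (simp add: field_simps)
    qed
    moreover have "C / v s \<le> K / v s" using K vs by (intro divide_right_mono) auto
    moreover have "\<xi> s * (K / \<phi> s) \<le> \<xi> s * z s" using neg \<xi>_pos[OF s0] by (intro mult_left_mono) auto
    moreover have "K * ((0 * \<phi> s - 1 * u s) / (\<phi> s * \<phi> s)) = - ((K / \<phi> s) * p s)" using f by (simp add: p_def field_simps)
    moreover have "(K / \<phi> s) * (\<xi> s - p s) = \<xi> s * (K / \<phi> s) - (K / \<phi> s) * p s" by (simp add: algebra_simps)
    ultimately show "K * ((0 * \<phi> s - 1 * u s) / (\<phi> s * \<phi> s)) - z' s \<ge> 0"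
      using z'[OF s] unfolding mult_minus_left by linarith
  qed (use r in auto)
  with K(1) show thesis by (intro that[of K]) auto
qed

lemma \<phi>_at_top: "filterlim \<phi> at_top at_top"
proof (rule filterlim_at_top_mono)
  have "m / (5 + sqrt (2 * m)) > 0" using m by (intro divide_pos_pos add_pos_nonneg) auto
  moreover have "filterlim (\<lambda>r::real. ln (1 + r\<^sup>2)) at_top at_top" by real_asymp
  ultimately have "filterlim (\<lambda>r. m / (5 + sqrt (2 * m)) * ln (1 + r\<^sup>2)) at_top at_top"
    using filterlim_tendsto_pos_mult_at_top[OF tendsto_const] by blast
  then show "filterlim (\<lambda>r. m + m / (5 + sqrt (2 * m)) * ln (1 + r\<^sup>2)) at_top at_top"
    by (rule filterlim_tendsto_add_at_top[OF tendsto_const])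
  show "eventually (\<lambda>r. m + m / (5 + sqrt (2 * m)) * ln (1 + r\<^sup>2) \<le> \<phi> r) at_top"
    using eventually_ge_at_top[of 0] by eventually_elim (rule \<phi>_ge)
qed

lemma v_at_top: "filterlim v at_top at_top"
proof -
  have "filterlim (\<lambda>r. 2 * \<phi> r) at_top at_top"
    by (rule filterlim_tendsto_pos_mult_at_top[OF tendsto_const _ \<phi>_at_top]) auto
  then show ?thesis unfolding v_def[abs_def]
    by (rule filterlim_compose[OF sqrt_at_top])
qed

lemma large_radius: obtains R where "R \<ge> 1" "\<phi> R \<ge> 4"
proof -
  have "eventually (\<lambda>r. \<phi> r \<ge> 4 \<and> r \<ge> 1) at_top"
    using \<phi>_at_top eventually_ge_at_top[of "1::real"] by (auto simp: filterlim_at_top intro: eventually_conj)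
  then show thesis using that by (auto simp: eventually_at_top_linorder)
qed

lemma inverse_v_tendsto: "((\<lambda>r. K / v r) \<longlongrightarrow> 0) at_top"
  by (rule real_tendsto_divide_at_top[OF tendsto_const v_at_top])

lemma v_decay_tendsto:
  assumes "eventually (\<lambda>r. 0 \<le> z r \<and> z r \<le> K / \<phi> r) at_top"
  shows "((\<lambda>r. v r * z r) \<longlongrightarrow> 0) at_top"
proof (rule tendsto_sandwich[OF _ _ tendsto_const inverse_v_tendsto[of "2 * K"]])
  show "eventually (\<lambda>r. 0 \<le> v r * z r) at_top"
    using assms eventually_ge_at_top[of 0]
  proof eventually_elim
    case (elim r)
    then show ?case using v_pos[of r] by (intro mult_nonneg_nonneg) auto
  qed
  show "eventually (\<lambda>r. v r * z r \<le> 2 * K / v r) at_top"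
    using assms eventually_ge_at_top[of 0]
  proof eventually_elim
    case (elim r)
    have "v r * z r \<le> v r * (K / \<phi> r)" using elim v_pos[of r] by (intro mult_left_mono) auto
    also have "\<phi> r = v r * v r / 2" using v_sq[of r] elim by (simp add: power2_eq_square)
    also have "v r * (K / (v r * v r / 2)) = 2 * K / v r" using v_pos[of r] elim by simp
    finally show ?case .
  qed
qed

text \<open>\<open>w = u / v\<close> is \<open>v'\<close>, and \<open>1 - w\<close> is driven by
  \<open>\<xi> - v\<close> and \<open>w^2 / v\<close>. By the constraint
  \<open>\<xi>^2 - v^2\<close> is bounded for \<open>r \<ge> 1\<close>, so both sources are of order
  \<open>1 / v\<close> and \<open>decay\<close> applies.\<close>

lemma w_tendsto: "((\<lambda>r. u r / v r) \<longlongrightarrow> 1) at_top"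
proof -
  obtain R where R: "R \<ge> 1" "\<phi> R \<ge> 4" by (rule large_radius)
  \<comment> \<open>The bounds are \<open>4\<close> for \<open>x^2\<close>,
    \<open>2 * (1 + k0)^2\<close> for \<open>2 * y^2\<close>, \<open>2 + 2 * k0\<close> for
    \<open>2 + 2 * k\<close>, and a last \<open>1\<close> for \<open>w^2\<close>.\<close>
  define C where "C = 7 + 2 * k0 + 2 * (1 + k0)\<^sup>2"
  have "\<exists>K\<ge>0. \<forall>r\<ge>R. 1 - u r / v r \<le> K / \<phi> r"
  proof (rule decay[where z = "\<lambda>r. 1 - u r / v r" and R = R and C = C and
        z' = "\<lambda>r. 0 - ((2 * \<phi> r - \<xi> r * u r) * v r - u r * (u r / v r)) / (v r * v r)"])
    fix r assume r: "R \<le> r"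
    then have r0: "r > 0" "r \<ge> 1" using R by auto
    have vr: "v r > 0" "v r * v r = 2 * \<phi> r" using v_pos[of r] v_sq[of r] r0 by (auto simp: power2_eq_square)
    show "((\<lambda>r. 1 - u r / v r) has_real_derivative 0 - ((2 * \<phi> r - \<xi> r * u r) * v r - u r * (u r / v r)) / (v r * v r)) (at r)"
      by (intro DERIV_diff DERIV_const DERIV_divide du[OF r0(1)] dv[OF r0(1)]) (use vr in auto)
    define w where "w = u r / v r"
    have w: "0 \<le> w" "w \<le> 1" using nonneg(3)[of r] u_le_v[of r] r0 vr by (auto simp: w_def)
    have uw: "u r = w * v r" using vr by (simp add: w_def)
    have "((2 * \<phi> r - \<xi> r * u r) * v r - u r * (u r / v r)) / (v r * v r) = v r - \<xi> r * w - w\<^sup>2 / v r"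
      unfolding vr(2)[symmetric] uw using vr(1) by (simp add: field_simps power2_eq_square)
    then have e: "0 - ((2 * \<phi> r - \<xi> r * u r) * v r - u r * (u r / v r)) / (v r * v r) = - \<xi> r * (1 - w) + (\<xi> r - v r) + w\<^sup>2 / v r"
      by (simp add: algebra_simps)
    have x2: "(x r)\<^sup>2 \<le> 4"
    proof -
      have "x r \<le> 2" using x_le[OF r0(1)] r0 by (smt (verit) divide_le_eq_1)
      then have "(x r)\<^sup>2 \<le> 2\<^sup>2" using x_nonneg[OF r0(1)] by (intro power_mono) auto
      then show ?thesis by simp
    qed
    have y2: "(y r)\<^sup>2 \<le> (1 + k0)\<^sup>2" using y_le[of r] nonneg(2)[of r] r0 by (intro power_mono) auto
    have "(\<xi> r - v r) * v r \<le> (\<xi> r - v r) * (\<xi> r + v r)"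
      using \<xi>_ge_v[OF r0(1)] vr \<xi>_pos[OF r0(1)] by (intro mult_left_mono) auto
    also have "\<dots> = (x r)\<^sup>2 + 2 * (y r)\<^sup>2 + 2 + 2 * k r"
      using constraint[OF r0(1)] by (simp add: algebra_simps power2_eq_square)
    also have "\<dots> \<le> C - 1" using x2 y2 nonneg(6)[of r] r0 by (simp add: C_def)
    finally have "\<xi> r - v r \<le> (C - 1) / v r" using vr by (simp add: pos_le_divide_eq)
    moreover have "w\<^sup>2 / v r \<le> 1 / v r" using w vr by (intro divide_right_mono) (auto simp: power_le_one)
    moreover have "(C - 1) / v r + 1 / v r = C / v r" by (simp add: add_divide_distrib[symmetric])
    ultimately have "0 - ((2 * \<phi> r - \<xi> r * u r) * v r - u r * (u r / v r)) / (v r * v r) \<le> - \<xi> r * (1 - w) + C / v r"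
      unfolding e by linarith
    then show "0 - ((2 * \<phi> r - \<xi> r * u r) * v r - u r * (u r / v r)) / (v r * v r) \<le> - \<xi> r * (1 - u r / v r) + C / v r"
      by (simp only: w_def)
  qed (use R in auto)
  then obtain K where K: "K \<ge> 0" "\<And>r. r \<ge> R \<Longrightarrow> 1 - u r / v r \<le> K / \<phi> r" by blast
  have "((\<lambda>r. 1 - u r / v r) \<longlongrightarrow> 0) at_top"
  proof (rule tendsto_sandwich[OF _ _ tendsto_const])
    show "((\<lambda>r. K / \<phi> r) \<longlongrightarrow> 0) at_top"
      by (rule real_tendsto_divide_at_top[OF tendsto_const \<phi>_at_top])
    show "eventually (\<lambda>r. 1 - u r / v r \<le> K / \<phi> r) at_top"
      using eventually_ge_at_top[of R] by eventually_elim (rule K)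
    show "eventually (\<lambda>r. 0 \<le> 1 - u r / v r) at_top"
      using eventually_ge_at_top[of 0] by eventually_elim (use u_le_v v_pos in auto)
  qed
  from tendsto_diff[OF tendsto_const[of 1] this] show ?thesis by simp
qed

lemma pv: assumes r: "r \<ge> 0" shows "v r * (p r / 2) = u r / v r"
proof -
  have "\<phi> r = v r * v r / 2" using v_sq[OF r] by (simp add: power2_eq_square)
  then show ?thesis using v_pos[OF r] by (simp add: p_def)
qed

lemma v_le_\<phi>: "\<phi> r \<ge> 4 \<Longrightarrow> v r \<le> \<phi> r"
  unfolding v_def using mult_right_mono[of 2 "\<phi> r" "\<phi> r"]
  by (intro real_le_lsqrt) (simp_all add: power2_eq_square)

text \<open>\<open>v * D\<close> tends to \<open>0\<close> by \<open>decay\<close>, and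
  \<open>v * p / 2 = u / v\<close> tends to \<open>1\<close>. For \<open>Da\<close> and
  \<open>Db\<close> the sum \<open>D + p / 2\<close> is \<open>a'/a\<close> and \<open>b'/b\<close>,
  so that \<open>a'\<close> has the same limit as \<open>a / v\<close>, and \<open>b'\<close> as
  \<open>b / v\<close>.\<close>

lemma v_log_derivative_tendsto:
  assumes D: "\<And>r. r > 0 \<Longrightarrow> (D has_real_derivative - \<xi> r * D r + S r) (at r)"
    and S: "\<And>r. r \<ge> 0 \<Longrightarrow> S r \<le> c / \<phi> r" and c: "c \<ge> 0" and nn: "\<And>r. r > 0 \<Longrightarrow> D r \<ge> 0"
  shows "((\<lambda>r. v r * (D r + p r / 2)) \<longlongrightarrow> 1) at_top"
proof -
  obtain R where R: "R \<ge> 1" "\<phi> R \<ge> 4" by (rule large_radius)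
  obtain K where K: "\<And>r. R \<le> r \<Longrightarrow> D r \<le> K / \<phi> r"
  proof (rule decay[where z = D and R = R and C = c and z' = "\<lambda>r. - \<xi> r * D r + S r"])
    fix r assume r: "R \<le> r"
    then have r0: "r > 0" using R by auto
    have "v r \<le> \<phi> r" using v_le_\<phi> \<phi>_mono[of R r] R r by simp
    then have "c / \<phi> r \<le> c / v r" using v_pos[of r] r0 c by (intro divide_left_mono) (auto intro: mult_pos_pos \<phi>_pos)
    then show "- \<xi> r * D r + S r \<le> - \<xi> r * D r + c / v r" using S[of r] r0 by simp
    show "(D has_real_derivative - \<xi> r * D r + S r) (at r)" by (rule D[OF r0])
  qed (use R in auto)
  have "((\<lambda>r. v r * D r) \<longlongrightarrow> 0) at_top"
    by (rule v_decay_tendsto[of _ K], use eventually_ge_at_top[of R] in eventually_elim) (use K nn R in auto)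
  from tendsto_add[OF this w_tendsto] have "((\<lambda>r. v r * D r + u r / v r) \<longlongrightarrow> 1) at_top" by simp
  moreover have "eventually (\<lambda>r. v r * D r + u r / v r = v r * (D r + p r / 2)) at_top"
    using eventually_ge_at_top[of 0] by eventually_elim (simp add: pv[symmetric] algebra_simps)
  ultimately show ?thesis by (rule Lim_transform_eventually)
qed

lemma xv_tendsto: "((\<lambda>r. v r * x r) \<longlongrightarrow> 1) at_top"
  using v_log_derivative_tendsto[OF dDa Sa_le] Da_nonneg by (simp add: Da_def)

lemma yv_tendsto: "((\<lambda>r. v r * y r) \<longlongrightarrow> 1) at_top"
  using v_log_derivative_tendsto[OF dDb Sb_le] Db_nonneg k0 m by (simp add: Db_def)

end

context expander_flow
begin

section \<open>The asymptotic cone angles\<close>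

definition "\<alpha> = exp (SUP r\<in>{1..}. la r)"
definition "\<beta> = exp (SUP r\<in>{1..}. lb r)"

lemma monotone_tendsto_Sup:
  fixes f :: "real \<Rightarrow> real"
  assumes mono: "\<And>r s. 1 \<le> r \<Longrightarrow> r \<le> s \<Longrightarrow> f r \<le> f s" and bdd: "bdd_above (f ` {1..})"
  shows "(f \<longlongrightarrow> (SUP r\<in>{1..}. f r)) at_top"
proof (rule increasing_tendsto)
  show "eventually (\<lambda>r. f r \<le> (SUP r\<in>{1..}. f r)) at_top"
    using eventually_ge_at_top[of 1] by eventually_elim (auto intro!: cSUP_upper bdd)
  fix c assume "c < (SUP r\<in>{1..}. f r)"
  then obtain r where r: "r \<ge> 1" "c < f r"
    using bdd by (auto simp: less_cSUP_iff)
  show "eventually (\<lambda>s. c < f s) at_top"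
    using eventually_ge_at_top[of r] by eventually_elim (use mono r in force)
qed

lemma la_tendsto: "(la \<longlongrightarrow> ln \<alpha>) at_top"
proof -
  obtain R where R: "R \<ge> 1" "\<phi> R \<ge> 4" by (rule large_radius)
  have "bdd_above (la ` {1..})"
  proof (rule bdd_aboveI2)
    fix r :: real assume r: "r \<in> {1..}"
    have "la r \<le> la (max r R)" using r by (intro la_mono) auto
    also have "\<dots> \<le> la R + x R / v R + 1 / \<phi> R" using R by (intro la_tail) auto
    finally show "la r \<le> la R + x R / v R + 1 / \<phi> R" .
  qed
  then show ?thesis using la_mono by (auto simp: \<alpha>_def intro: monotone_tendsto_Sup)
qed

lemma lb_tendsto: "(lb \<longlongrightarrow> ln \<beta>) at_top"
proof -
  obtain R where R: "R \<ge> 1" "\<phi> R \<ge> 4" by (rule large_radius)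
  have "bdd_above (lb ` {1..})"
  proof (rule bdd_aboveI2)
    fix r :: real assume r: "r \<in> {1..}"
    have "lb r \<le> lb (max r R)" using r by (intro lb_mono) auto
    also have "\<dots> \<le> lb R + y R / v R + (1 + k0 * m) / \<phi> R" using R by (intro lb_tail) auto
    finally show "lb r \<le> lb R + y R / v R + (1 + k0 * m) / \<phi> R" .
  qed
  then show ?thesis using lb_mono by (auto simp: \<beta>_def intro: monotone_tendsto_Sup)
qed

lemma \<alpha>_pos: "\<alpha> > 0" and \<beta>_pos: "\<beta> > 0"
  by (simp_all add: \<alpha>_def \<beta>_def)

lemma la_le: "R > 0 \<Longrightarrow> la R \<le> ln \<alpha>"
  by (rule tendsto_lowerbound[OF la_tendsto]) (auto intro!: eventually_mono[OF eventually_ge_at_top[of R]] la_mono)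

lemma lb_le: "R \<ge> 0 \<Longrightarrow> lb R \<le> ln \<beta>"
  by (rule tendsto_lowerbound[OF lb_tendsto]) (auto intro!: eventually_mono[OF eventually_ge_at_top[of R]] lb_mono)

lemma ln_\<alpha>_le: "R > 0 \<Longrightarrow> \<phi> R \<ge> 4 \<Longrightarrow> ln \<alpha> \<le> la R + x R / v R + 1 / \<phi> R"
  by (rule tendsto_upperbound[OF la_tendsto]) (auto intro!: eventually_mono[OF eventually_ge_at_top[of R]] la_tail)

lemma ln_\<beta>_le: "R > 0 \<Longrightarrow> \<phi> R \<ge> 4 \<Longrightarrow> ln \<beta> \<le> lb R + y R / v R + (1 + k0 * m) / \<phi> R"
  by (rule tendsto_upperbound[OF lb_tendsto]) (auto intro!: eventually_mono[OF eventually_ge_at_top[of R]] lb_tail)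

definition "a r = r * exp (\<Lambda> r)"
definition "a' r = exp (\<Lambda> r) * t r"
definition "b r = 1 / sqrt (k r)"

lemma exp_ln_v: assumes r: "r \<ge> 0" shows "exp (ln (2 * \<phi> r) / 2) = v r"
proof -
  have "exp (ln (2 * \<phi> r) / 2) = sqrt (2 * \<phi> r)"
    using \<phi>_pos[OF r] by (simp add: ln_sqrt[symmetric])
  then show ?thesis by (simp add: v_def)
qed

lemma exp_la: assumes r: "r > 0" shows "exp (la r) * v r = a r"
proof -
  have "exp (la r) * exp (ln (2 * \<phi> r) / 2) = a r"
    unfolding exp_add[symmetric] using r by (simp add: la_def a_def exp_add)
  then show ?thesis using r by (simp add: exp_ln_v)
qed

lemma exp_lb: assumes r: "r \<ge> 0" shows "exp (lb r) * v r = b r"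
proof -
  have "exp (lb r) * exp (ln (2 * \<phi> r) / 2) = exp (- (ln (k r) / 2))"
    unfolding exp_add[symmetric] by (simp add: lb_def)
  also have "\<dots> = inverse (exp (ln (sqrt (k r))))" unfolding exp_minus using k_pos[OF r] by (simp add: ln_sqrt)
  also have "\<dots> = b r" using k_pos[OF r] by (simp add: b_def field_simps)
  finally show ?thesis using r by (simp add: exp_ln_v)
qed

lemma a'_tendsto: "(a' \<longlongrightarrow> \<alpha>) at_top"
proof -
  have "((\<lambda>r. exp (la r) * (v r * x r)) \<longlongrightarrow> exp (ln \<alpha>) * 1) at_top"
    by (intro tendsto_mult tendsto_exp la_tendsto xv_tendsto)
  moreover have "eventually (\<lambda>r. exp (la r) * (v r * x r) = a' r) at_top"
    using eventually_gt_at_top[of 0]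
  proof eventually_elim
    case (elim r)
    have "exp (la r) * (v r * x r) = a r * x r" by (simp only: mult.assoc[symmetric] exp_la[OF elim])
    then show ?case using elim by (simp add: a_def a'_def x_def)
  qed
  ultimately have "(a' \<longlongrightarrow> exp (ln \<alpha>) * 1) at_top" by (rule Lim_transform_eventually)
  then show ?thesis using \<alpha>_pos by simp
qed

lemma b'_tendsto: "((\<lambda>r. y r * b r) \<longlongrightarrow> \<beta>) at_top"
proof -
  have "((\<lambda>r. exp (lb r) * (v r * y r)) \<longlongrightarrow> exp (ln \<beta>) * 1) at_top"
    by (intro tendsto_mult tendsto_exp lb_tendsto yv_tendsto)
  moreover have "eventually (\<lambda>r. exp (lb r) * (v r * y r) = y r * b r) at_top"
    using eventually_gt_at_top[of 0]
  proof eventually_elim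
    case (elim r)
    have "exp (lb r) * (v r * y r) = b r * y r"
      by (simp only: mult.assoc[symmetric] exp_lb[OF less_imp_le[OF elim]])
    then show ?case by simp
  qed
  ultimately have "((\<lambda>r. y r * b r) \<longlongrightarrow> exp (ln \<beta>) * 1) at_top" by (rule Lim_transform_eventually)
  then show ?thesis using \<beta>_pos by simp
qed

lemma da: assumes r: "r > 0" shows "(a has_real_derivative a' r) (at r)"
proof -
  have "(a has_real_derivative 1 * exp (\<Lambda> r) + exp (\<Lambda> r) * (\<zeta> r - 2 * y r - u r) * r) (at r)"
    unfolding a_def[abs_def] by (rule DERIV_mult[OF DERIV_ident DERIV_fun_exp[OF d\<Lambda>[OF r]]])
  then show ?thesis by (rule DERIV_cong) (simp add: a'_def t_def algebra_simps)
qed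

lemma da': assumes r: "r > 0" shows "(a' has_real_derivative a r - (2 * y r + u r) * a' r) (at r)"
proof -
  have "(a' has_real_derivative exp (\<Lambda> r) * (\<zeta> r - 2 * y r - u r) * t r + (r - \<zeta> r * t r) * exp (\<Lambda> r)) (at r)"
    unfolding a'_def[abs_def] by (rule DERIV_mult[OF DERIV_fun_exp[OF d\<Lambda>[OF r]] dt[OF r]])
  then show ?thesis by (rule DERIV_cong) (simp add: a'_def a_def algebra_simps)
qed

section \<open>Bounds relating the parameters to the cone angles\<close>

lemma a_cont: "continuous_on {0..} a" and a'_cont: "continuous_on {0..} a'"
  unfolding a_def[abs_def] a'_def[abs_def] by (intro continuous_intros cont t_cont)+

lemma a_nonneg: "r \<ge> 0 \<Longrightarrow> a r \<ge> 0" and a'_nonneg: "r \<ge> 0 \<Longrightarrow> a' r \<ge> 0"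
  using t_nonneg[of r] by (simp_all add: a_def a'_def)

text \<open>In \<open>a'' = a - (2y + u) a'\<close> the damping \<open>2y\<close> alone would carry
  the initial value \<open>1\<close> of \<open>a'\<close> along as
  \<open>(b0 / b)^2 = k / k0\<close>.\<close>

lemma a'_le: assumes r: "r \<ge> 0" shows "a' r \<le> a r + k r / k0"
proof -
  have "a r + k r / k0 - a' r \<ge> 0"
  proof (rule barrier_0[where z = "\<lambda>r. a r + k r / k0 - a' r", OF _ _ _ _ r])
    show "continuous_on {0..} (\<lambda>r. a r + k r / k0 - a' r)" using k0 by (intro continuous_intros a_cont a'_cont cont) auto
    show "a 0 + k 0 / k0 - a' 0 \<ge> 0" using b0 by (simp add: a_def a'_def init t_def k0_def)
    fix r :: real assume r: "0 < r"
    show "((\<lambda>r. a r + k r / k0 - a' r) has_real_derivative a' r + (- 2 * k r * y r) / k0 - (a r - (2 * y r + u r) * a' r)) (at r)"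
      by (intro DERIV_diff DERIV_add da da' DERIV_cdivide dk r)
    assume "a r + k r / k0 - a' r < 0"
    then have n: "a' r > a r + k r / k0" by simp
    have "k r / k0 \<ge> 0" using nonneg(5)[of r] k0 r by simp
    then have "2 * y r * (a' r - k r / k0) \<ge> 0" "a' r - a r \<ge> 0"
      using n nonneg(2)[of r] a_nonneg[of r] r by (auto intro!: mult_nonneg_nonneg)
    moreover have "u r * a' r \<ge> 0" using nonneg(3)[of r] a'_nonneg[of r] r by simp
    ultimately have "(a' r - a r) + 2 * y r * (a' r - k r / k0) + u r * a' r \<ge> 0" by linarith
    then show "a' r + (- 2 * k r * y r) / k0 - (a r - (2 * y r + u r) * a' r) \<ge> 0"
      by (simp add: algebra_simps)
  qed
  then show ?thesis by simp
qed

text \<open>\<open>a'_le\<close> with integrating factor \<open>exp (- r)\<close>. \<open>H\<close>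
  is any primitive of a majorant of \<open>(b0 / b)^2\<close>: the identity for large
  \<open>m\<close>, an arctangent for small \<open>b0\<close>.\<close>

lemma a_le: assumes R: "R \<ge> 0"
    and H: "continuous_on {0..} H" "H 0 = 0" "\<And>r. 0 < r \<Longrightarrow> (H has_real_derivative H' r) (at r)"
      "\<And>r. 0 < r \<Longrightarrow> r < R \<Longrightarrow> k r / k0 \<le> H' r"
  shows "a R \<le> exp R * H R"
proof -
  have "H R - a R * exp (- R) \<ge> 0"
  proof (rule barrier[where z = "\<lambda>r. H r - a r * exp (- r)" and R = 0 and T = R])
    have "{0..R} \<subseteq> {0..}" by auto
    then show "continuous_on {0..R} (\<lambda>r. H r - a r * exp (- r))"
      by (intro continuous_intros continuous_on_subset[OF H(1)] continuous_on_subset[OF a_cont])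
    fix r :: real assume r: "0 < r" "r < R"
    show "((\<lambda>r. H r - a r * exp (- r)) has_real_derivative H' r - (a' r * exp (- r) + exp (- r) * (-1) * a r)) (at r)"
      by (intro DERIV_diff H(3) r DERIV_mult da DERIV_fun_exp DERIV_minus DERIV_ident)
    have k: "k r / k0 \<ge> 0" using nonneg(5)[of r] k0 r by simp
    have "(a' r - a r) * exp (- r) \<le> (k r / k0) * exp (- r)" using a'_le[of r] r by (intro mult_right_mono) auto
    also have "\<dots> \<le> (k r / k0) * 1" using k r by (intro mult_left_mono) auto
    also have "\<dots> \<le> H' r" using H(4)[OF r] by simp
    finally show "H' r - (a' r * exp (- r) + exp (- r) * (-1) * a r) \<ge> 0" by (simp add: algebra_simps)
  qed (use R in \<open>auto simp: H a_def\<close>)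
  then have "a R * exp (- R) * exp R \<le> H R * exp R" by (intro mult_right_mono) auto
  moreover have "exp (- R) * exp R = 1" by (simp flip: exp_add)
  ultimately show ?thesis by (simp only: mult.assoc mult_1_right mult.commute[of "H R"])
qed

lemma k_ratio_le: "r \<ge> 0 \<Longrightarrow> k r / k0 \<le> 1"
  using nonneg(6)[of r] k0 by simp

lemma inverse_k_derivative: assumes r: "r > 0" shows "((\<lambda>r. 1 / k r) has_real_derivative 2 * y r / k r) (at r)"
proof -
  have "k r \<noteq> 0" using k_pos[of r] r by simp
  then show ?thesis
    by (rule DERIV_cong[OF DERIV_divide[OF DERIV_const dk[OF r]]]) (use k_pos[of r] r in \<open>simp add: field_simps\<close>)
qed

text \<open>Here \<open>1 / k = b^2\<close> and \<open>2 * y / k = (b^2)'\<close>. The source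
  \<open>2 + 2 * b^2 + 4 * b'^2\<close> is at least \<open>2\<close> whatever \<open>b0\<close>
  is.\<close>

lemma dh: assumes r: "r > 0"
  shows "((\<lambda>r. 2 * y r / k r) has_real_derivative 2 + 2 / k r + 4 * (y r)\<^sup>2 / k r - \<xi> r * (2 * y r / k r)) (at r)"
proof -
  have f: "k r \<noteq> 0" using k_pos[of r] r by simp
  have "((\<lambda>r. 2 * y r / k r) has_real_derivative (2 * (1 + k r - \<xi> r * y r) * k r - 2 * y r * (- 2 * k r * y r)) / (k r * k r)) (at r)"
    by (intro DERIV_divide DERIV_cmult dy r dk f)
  then show ?thesis by (rule DERIV_cong) (use f in \<open>simp add: field_simps power2_eq_square\<close>)
qed

lemma h_cont: "continuous_on {0..} (\<lambda>r. 2 * y r / k r)" and inverse_k_cont: "continuous_on {0..} (\<lambda>r. 1 / k r)"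
proof -
  have "\<forall>r\<in>{0..}. k r \<noteq> 0" using k_pos by force
  then show "continuous_on {0..} (\<lambda>r. 2 * y r / k r)" "continuous_on {0..} (\<lambda>r. 1 / k r)"
    by (auto intro!: continuous_intros cont)
qed

text \<open>\<open>rate_lower_bound\<close> with \<open>C = 2\<close> for \<open>(b^2)'\<close>. The
  condition on \<open>c\<close> involves \<open>m\<close> and \<open>R\<close> but not
  \<open>b0\<close>, so the spheres open up at a definite rate even as \<open>b0\<close> tends to
  \<open>0\<close>.\<close>

lemma inverse_k_ge: assumes R: "0 \<le> r" "r \<le> R" and c: "c \<ge> 0" "c * ((5 + sqrt (2 * m)) * (1 + R\<^sup>2)) \<le> 1"
  shows "1 / k r \<ge> b0\<^sup>2 + c * r\<^sup>2"
proof -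
  have V: "5 + sqrt (2 * m) > 0" using m by (simp add: add_pos_nonneg)
  have "1 / k r - (b0\<^sup>2 + c * r\<^sup>2) \<ge> 0"
  proof (rule barrier[where z = "\<lambda>r. 1 / k r - (b0\<^sup>2 + c * r\<^sup>2)" and R = 0 and T = R])
    show "continuous_on {0..R} (\<lambda>r. 1 / k r - (b0\<^sup>2 + c * r\<^sup>2))"
      by (intro continuous_intros continuous_on_subset[OF inverse_k_cont]) auto
    fix r :: real assume r: "0 < r" "r < R"
    show "((\<lambda>r. 1 / k r - (b0\<^sup>2 + c * r\<^sup>2)) has_real_derivative 2 * y r / k r - 2 * c * r) (at r)"
      by (rule DERIV_cong[OF DERIV_diff[OF inverse_k_derivative[OF r(1)] DERIV_add[OF DERIV_const DERIV_cmult[OF DERIV_power[OF DERIV_ident]]]]]) simp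
    have "2 * y r / k r \<ge> 2 / (5 + sqrt (2 * m)) * r / (1 + r\<^sup>2)"
    proof (rule rate_lower_bound[OF h_cont _ dh])
      fix s :: real assume "0 < s"
      then have "2 / k s \<ge> 0" "4 * (y s)\<^sup>2 / k s \<ge> 0" using nonneg(5)[of s] by auto
      then show "2 - \<xi> s * (2 * y s / k s) \<le> 2 + 2 / k s + 4 * (y s)\<^sup>2 / k s - \<xi> s * (2 * y s / k s)" by linarith
    qed (use r init in auto)
    moreover have "2 / (5 + sqrt (2 * m)) * r / (1 + r\<^sup>2) \<ge> 2 * c * r"
    proof -
      have p: "1 + r\<^sup>2 > 0" by (simp add: add_pos_nonneg)
      have "c * ((5 + sqrt (2 * m)) * (1 + r\<^sup>2)) \<le> c * ((5 + sqrt (2 * m)) * (1 + R\<^sup>2))"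
        using V c r by (intro mult_left_mono add_mono power_mono) auto
      then have "c * ((5 + sqrt (2 * m)) * (1 + r\<^sup>2)) \<le> 1" using c by linarith
      then have "c \<le> 1 / ((5 + sqrt (2 * m)) * (1 + r\<^sup>2))" using V p by (simp add: pos_le_divide_eq)
      then have "2 * r * c \<le> 2 * r * (1 / ((5 + sqrt (2 * m)) * (1 + r\<^sup>2)))" using r by (intro mult_left_mono) auto
      then show ?thesis by (simp add: mult_ac)
    qed
    ultimately show "2 * y r / k r - 2 * c * r \<ge> 0" by linarith
  qed (use R in \<open>auto simp: init\<close>)
  then show ?thesis by simp
qed

text \<open>With \<open>\<Delta>w = w'' + \<xi>w'\<close> one has \<open>\<Delta>(b\<^sup>2 + 1) \<ge> 2(b\<^sup>2 + 1)\<close> and \<open>\<Delta>\<phi> = 2\<phi>\<close>, so the Wronskian of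
  \<open>b\<^sup>2 + 1\<close> and \<open>\<phi>\<close> is nonnegative.\<close>

lemma b_squared_plus_1_ge: assumes r: "r \<ge> 0" shows "(1 / k r + 1) / \<phi> r \<ge> (b0\<^sup>2 + 1) / m"
proof -
  have z: "2 * y r / k r * \<phi> r - (1 / k r + 1) * u r \<ge> 0" if r: "r \<ge> 0" for r
  proof (rule barrier_0[where z = "\<lambda>r. 2 * y r / k r * \<phi> r - (1 / k r + 1) * u r", OF _ _ _ _ r])
    show "continuous_on {0..} (\<lambda>r. 2 * y r / k r * \<phi> r - (1 / k r + 1) * u r)"
      by (intro continuous_intros h_cont inverse_k_cont cont)
    fix r :: real assume r: "0 < r"
    have "((\<lambda>r. 2 * y r / k r * \<phi> r - (1 / k r + 1) * u r) has_real_derivative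
        ((2 + 2 / k r + 4 * (y r)\<^sup>2 / k r - \<xi> r * (2 * y r / k r)) * \<phi> r + u r * (2 * y r / k r))
        - ((2 * y r / k r + 0) * u r + (2 * \<phi> r - \<xi> r * u r) * (1 / k r + 1))) (at r)"
      by (intro DERIV_diff DERIV_mult DERIV_add DERIV_const dh d\<phi> du inverse_k_derivative r)
    then show "((\<lambda>r. 2 * y r / k r * \<phi> r - (1 / k r + 1) * u r) has_real_derivative
       4 * (y r)\<^sup>2 / k r * \<phi> r - \<xi> r * (2 * y r / k r * \<phi> r - (1 / k r + 1) * u r)) (at r)"
      by (rule DERIV_cong) (simp add: algebra_simps)
    assume "2 * y r / k r * \<phi> r - (1 / k r + 1) * u r < 0"
    then have "\<xi> r * (2 * y r / k r * \<phi> r - (1 / k r + 1) * u r) \<le> 0"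
      using \<xi>_pos[OF r] by (intro mult_nonneg_nonpos) auto
    moreover have "4 * (y r)\<^sup>2 / k r * \<phi> r \<ge> 0" using k_pos[of r] \<phi>_pos[of r] r by simp
    ultimately show "4 * (y r)\<^sup>2 / k r * \<phi> r - \<xi> r * (2 * y r / k r * \<phi> r - (1 / k r + 1) * u r) \<ge> 0" by linarith
  qed (auto simp: init)
  have "(1 / k 0 + 1) / \<phi> 0 \<le> (1 / k r + 1) / \<phi> r"
  proof (rule monotone_0[where z = "\<lambda>r. (1 / k r + 1) / \<phi> r"])
    show "continuous_on {0..} (\<lambda>r. (1 / k r + 1) / \<phi> r)"
      using \<phi>_pos by (intro continuous_intros inverse_k_cont cont) force
    fix r :: real assume r: "0 < r"
    have "((\<lambda>r. (1 / k r + 1) / \<phi> r) has_real_derivative ((2 * y r / k r + 0) * \<phi> r - (1 / k r + 1) * u r) / (\<phi> r * \<phi> r)) (at r)"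
      using \<phi>_pos[of r] r by (intro DERIV_divide DERIV_add DERIV_const d\<phi> inverse_k_derivative) auto
    then show "((\<lambda>r. (1 / k r + 1) / \<phi> r) has_real_derivative (2 * y r / k r * \<phi> r - (1 / k r + 1) * u r) / (\<phi> r * \<phi> r)) (at r)" by simp
    show "(2 * y r / k r * \<phi> r - (1 / k r + 1) * u r) / (\<phi> r * \<phi> r) \<ge> 0"
      using z[of r] r by (intro divide_nonneg_nonneg) auto
  qed (use r in auto)
  then show ?thesis by (simp add: init)
qed

text \<open>\<open>(b^2 + 1) / (2 * \<phi>)\<close> tends to \<open>\<beta>^2\<close> and never
  falls below its initial value. When \<open>\<beta>\<close> is bounded, this keeps \<open>m\<close>
  away from \<open>0\<close> and bounds \<open>b0\<close> in terms of \<open>m\<close>.\<close>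

lemma b0_bound: "b0\<^sup>2 + 1 \<le> 2 * m * \<beta>\<^sup>2"
proof -
  have "((\<lambda>r. (exp (lb r))\<^sup>2 + (1 / 2) / \<phi> r) \<longlongrightarrow> (exp (ln \<beta>))\<^sup>2 + 0) at_top"
    by (intro tendsto_add tendsto_power tendsto_exp lb_tendsto real_tendsto_divide_at_top[OF tendsto_const \<phi>_at_top])
  moreover have "eventually (\<lambda>r. (b0\<^sup>2 + 1) / m / 2 \<le> (exp (lb r))\<^sup>2 + (1 / 2) / \<phi> r) at_top"
    using eventually_ge_at_top[of 0]
  proof eventually_elim
    case (elim r)
    have "(exp (lb r))\<^sup>2 * (v r)\<^sup>2 = 1 / k r"
      unfolding power_mult_distrib[symmetric] exp_lb[OF elim] using k_pos[OF elim] by (simp add: b_def power_divide)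
    moreover have "2 * \<phi> r \<noteq> 0" using \<phi>_pos[OF elim] by simp
    ultimately have "(exp (lb r))\<^sup>2 = 1 / k r / (2 * \<phi> r)"
      unfolding v_sq[OF elim] by (metis nonzero_eq_divide_eq)
    then have "(exp (lb r))\<^sup>2 + (1 / 2) / \<phi> r = (1 / k r + 1) / \<phi> r / 2"
      by (simp add: add_divide_distrib)
    then show ?case using divide_right_mono[OF b_squared_plus_1_ge[OF elim], of 2] by simp
  qed
  ultimately have "(b0\<^sup>2 + 1) / m / 2 \<le> (exp (ln \<beta>))\<^sup>2 + 0"
    by (rule tendsto_lowerbound) simp
  then show ?thesis using m \<beta>_pos by (simp add: field_simps)
qed

text \<open>\<open>G\<close> is the energy \<open>s\<^sup>2 + (b s')\<^sup>2\<close> of the damped oscillator \<open>s = a/b\<close>.\<close>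

lemma \<alpha>_le_\<beta>: "\<alpha> \<le> \<beta>"
proof -
  \<comment> \<open>In variables regular at \<open>0\<close>: with \<open>s = a / b\<close> one has
    \<open>s^2 = exp (2 * \<Lambda>) * r^2 * k\<close> and
    \<open>b * s' = exp \<Lambda> * (t - r * y)\<close>. At \<open>r = 0\<close> the energy is
    \<open>1\<close>.\<close>
  let ?G = "\<lambda>r. exp (2 * \<Lambda> r) * (r\<^sup>2 * k r + (t r - r * y r)\<^sup>2)"
  have G: "?G r \<le> 1" if r: "r \<ge> 0" for r
  proof -
    have "- ?G 0 \<le> - ?G r"
    proof (rule monotone_0[where z = "\<lambda>r. - ?G r"])
      show "continuous_on {0..} (\<lambda>r. - ?G r)" by (intro continuous_intros cont t_cont)
      fix r :: real assume r: "0 < r"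
      have 1: "((\<lambda>r. exp (2 * \<Lambda> r)) has_real_derivative exp (2 * \<Lambda> r) * (2 * (\<zeta> r - 2 * y r - u r))) (at r)"
        by (intro DERIV_fun_exp DERIV_cmult d\<Lambda> r)
      have 2: "((\<lambda>r. (t r - r * y r) * (t r - r * y r)) has_real_derivative
          ((r - \<zeta> r * t r) - (1 * y r + (1 + k r - \<xi> r * y r) * r)) * (t r - r * y r)
          + ((r - \<zeta> r * t r) - (1 * y r + (1 + k r - \<xi> r * y r) * r)) * (t r - r * y r)) (at r)"
        by (intro DERIV_mult DERIV_diff DERIV_ident dt dy r)
      have 3: "((\<lambda>r. (r * r) * k r) has_real_derivative (1 * r + 1 * r) * k r + (- 2 * k r * y r) * (r * r)) (at r)"
        by (intro DERIV_mult DERIV_ident dk r)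
      have "((\<lambda>r. - ?G r) has_real_derivative - (exp (2 * \<Lambda> r) * (2 * (\<zeta> r - 2 * y r - u r)) * (r * r * k r + (t r - r * y r) * (t r - r * y r))
          + ((1 * r + 1 * r) * k r + (- 2 * k r * y r) * (r * r) + (((r - \<zeta> r * t r) - (1 * y r + (1 + k r - \<xi> r * y r) * r)) * (t r - r * y r)
          + ((r - \<zeta> r * t r) - (1 * y r + (1 + k r - \<xi> r * y r) * r)) * (t r - r * y r))) * exp (2 * \<Lambda> r))) (at r)"
        unfolding power2_eq_square by (rule DERIV_minus[OF DERIV_mult[OF 1 DERIV_add[OF 3 2]]])
      moreover have "- (exp (2 * \<Lambda> r) * (2 * (\<zeta> r - 2 * y r - u r)) * (r * r * k r + (t r - r * y r) * (t r - r * y r))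
          + ((1 * r + 1 * r) * k r + (- 2 * k r * y r) * (r * r) + (((r - \<zeta> r * t r) - (1 * y r + (1 + k r - \<xi> r * y r) * r)) * (t r - r * y r)
          + ((r - \<zeta> r * t r) - (1 * y r + (1 + k r - \<xi> r * y r) * r)) * (t r - r * y r))) * exp (2 * \<Lambda> r))
          = exp (2 * \<Lambda> r) * (2 * (2 * y r + u r) * (t r - r * y r)\<^sup>2)"
      proof -
        have \<zeta>: "\<zeta> r = (t r - 1) / r + 2 * y r + u r" using r by (simp add: t_def field_simps)
        have "(2 * (\<zeta> r - 2 * y r - u r)) * (r * r * k r + (t r - r * y r) * (t r - r * y r))
          + ((1 * r + 1 * r) * k r + (- 2 * k r * y r) * (r * r) + (((r - \<zeta> r * t r) - (1 * y r + (1 + k r - \<xi> r * y r) * r)) * (t r - r * y r)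
          + ((r - \<zeta> r * t r) - (1 * y r + (1 + k r - \<xi> r * y r) * r)) * (t r - r * y r)))
          = - (2 * (2 * y r + u r) * (t r - r * y r)\<^sup>2)"
          unfolding \<xi>_def \<zeta> using r by (simp add: field_simps power2_eq_square)
        moreover have "- (E * P * S + Q * E) = E * X" if "P * S + Q = - X" for E P S Q X :: real
        proof -
          have "- (E * P * S + Q * E) = - (E * (P * S + Q))" by (simp add: algebra_simps)
          then show ?thesis by (simp add: that)
        qed
        ultimately show ?thesis by blast
      qed
      ultimately show "((\<lambda>r. - ?G r) has_real_derivative exp (2 * \<Lambda> r) * (2 * (2 * y r + u r) * (t r - r * y r)\<^sup>2)) (at r)"
        by (rule DERIV_cong)
      show "exp (2 * \<Lambda> r) * (2 * (2 * y r + u r) * (t r - r * y r)\<^sup>2) \<ge> 0"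
        using nonneg(2,3)[of r] r by simp
    qed (use r in auto)
    then show ?thesis by (simp add: init t_def)
  qed
  have "la r \<le> lb r" if r: "r > 0" for r
  proof -
    have "exp (2 * \<Lambda> r) * (r\<^sup>2 * k r) \<le> ?G r" by (intro mult_left_mono) auto
    also have "\<dots> \<le> 1" using G r by simp
    finally have "ln (exp (2 * \<Lambda> r) * (r\<^sup>2 * k r)) \<le> ln 1" using r k_pos[of r] by simp
    then have "2 * \<Lambda> r + (2 * ln r + ln (k r)) \<le> 0" using r k_pos[of r] by (simp add: ln_mult ln_realpow)
    then show ?thesis by (simp add: la_def lb_def)
  qed
  then have "eventually (\<lambda>r. la r \<le> lb r) at_top" by (intro eventually_mono[OF eventually_gt_at_top[of 0]])
  then have "ln \<alpha> \<le> ln \<beta>" by (intro tendsto_le[OF _ lb_tendsto la_tendsto]) auto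
  then show ?thesis using \<alpha>_pos \<beta>_pos by simp
qed

text \<open>From a radius with \<open>\<phi> R \<ge> 4\<close> on, \<open>a / v\<close> gains at
  most a factor \<open>exp 2\<close>: the two tail terms \<open>x R / v R\<close> and
  \<open>1 / \<phi> R\<close> are at most \<open>1\<close> each.\<close>

lemma \<alpha>_le_a: assumes R: "R \<ge> 1" "\<phi> R \<ge> 4" shows "\<alpha> * v R \<le> a R * exp 2"
proof -
  have R0: "R > 0" using R by simp
  have v2: "v R \<ge> 2" unfolding v_def using R by (intro real_le_rsqrt) auto
  have "x R \<le> 2" using x_le[OF R0] R by (smt (verit) divide_le_eq_1)
  then have "x R / v R \<le> 1" using v2 by simp
  moreover have "1 / \<phi> R \<le> 1" using R by simp
  ultimately have "ln \<alpha> \<le> la R + 2" using ln_\<alpha>_le[OF R0 R(2)] by linarith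
  then have "exp (ln \<alpha>) \<le> exp (la R + 2)" by simp
  then have "\<alpha> * v R \<le> exp (la R) * exp 2 * v R" using \<alpha>_pos v2 by (simp add: exp_add mult_right_mono)
  also have "\<dots> = a R * exp 2" by (simp add: exp_la[OF R0, symmetric])
  finally show ?thesis .
qed

text \<open>For \<open>m \<ge> 4\<close> the radius \<open>R = 1\<close> is already admissible, and
  \<open>a 1 \<le> exp 1\<close>; so \<open>\<alpha> * sqrt (2 * m) \<le> exp 3\<close>, which is
  squared.\<close>

lemma m_bound: assumes "m \<ge> 4" shows "\<alpha>\<^sup>2 * (2 * m) \<le> exp 6"
proof -
  have f: "\<phi> 1 \<ge> 4" using nonneg(4)[of 1] assms by simp
  have "a 1 \<le> exp 1 * 1"
    by (rule a_le[where H = "\<lambda>r. r" and H' = "\<lambda>_. 1"]) (auto intro: k_ratio_le)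
  have "sqrt (2 * m) \<le> v 1" using nonneg(4)[of 1] by (simp add: v_def)
  then have "\<alpha> * sqrt (2 * m) \<le> \<alpha> * v 1" using \<alpha>_pos by simp
  also have "\<dots> \<le> a 1 * exp 2" by (rule \<alpha>_le_a) (use f in auto)
  also have "\<dots> \<le> exp 1 * exp 2" using \<open>a 1 \<le> exp 1 * 1\<close> by simp
  also have "\<dots> = exp 3" by (simp flip: exp_add)
  finally have "(\<alpha> * sqrt (2 * m))\<^sup>2 \<le> (exp 3)\<^sup>2" using \<alpha>_pos m by (intro power_mono) auto
  then show ?thesis using m by (simp add: power_mult_distrib flip: exp_double)
qed

text \<open>By \<open>inverse_k_ge\<close>, \<open>(b0 / b)^2 \<le> 1 / (1 + (q * r)^2)\<close> with
  \<open>q = sqrt c / b0\<close>. Its integral is at most \<open>(pi / 2) / q \<le> 2 / q\<close>,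
  of order \<open>b0\<close>, however large \<open>R\<close> is.\<close>

lemma \<alpha>_le_b0:
  assumes R: "R \<ge> 1" "\<phi> R \<ge> 4" and c: "c > 0" "c * ((5 + sqrt (2 * m)) * (1 + R\<^sup>2)) \<le> 1"
  shows "\<alpha> \<le> exp (R + 2) * b0 / sqrt c"
proof -
  define q where "q = sqrt c / b0"
  have q: "q > 0" using c b0 by (simp add: q_def)
  have q2: "q\<^sup>2 = c / b0\<^sup>2" using c by (simp add: q_def power_divide)
  have "a R \<le> exp R * (arctan (q * R) / q)"
  proof (rule a_le[where H = "\<lambda>r. arctan (q * r) / q" and H' = "\<lambda>r. 1 / (1 + (q * r)\<^sup>2)"])
    show "continuous_on {0..} (\<lambda>r. arctan (q * r) / q)" using q by (intro continuous_intros) auto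
    fix r :: real assume r: "0 < r"
    show "((\<lambda>r. arctan (q * r) / q) has_real_derivative 1 / (1 + (q * r)\<^sup>2)) (at r)"
      using q by (auto intro!: derivative_eq_intros simp: field_simps add_nonneg_eq_0_iff)
    assume "r < R"
    then have "1 / k r \<ge> b0\<^sup>2 + c * r\<^sup>2" using inverse_k_ge[of r R c] r c by simp
    moreover have bc: "b0\<^sup>2 + c * r\<^sup>2 > 0" using b0 c by (simp add: add_pos_nonneg)
    ultimately have "k r \<le> 1 / (b0\<^sup>2 + c * r\<^sup>2)" using k_pos[of r] r by (simp add: field_simps)
    then have "b0\<^sup>2 * k r \<le> b0\<^sup>2 * (1 / (b0\<^sup>2 + c * r\<^sup>2))" by (intro mult_left_mono) auto
    moreover have "k r / k0 = b0\<^sup>2 * k r" by (simp add: k0_def)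
    ultimately have "k r / k0 \<le> b0\<^sup>2 * (1 / (b0\<^sup>2 + c * r\<^sup>2))" by simp
    also have "\<dots> = 1 / (1 + (q * r)\<^sup>2)" using b0 bc unfolding power_mult_distrib q2 by (simp add: field_simps)
    finally show "k r / k0 \<le> 1 / (1 + (q * r)\<^sup>2)" .
  qed (use R in auto)
  also have "\<dots> \<le> exp R * (2 / q)"
    using arctan_ubound[of "q * R"] pi_less_4 q by (intro mult_left_mono divide_right_mono) auto
  finally have aR: "a R \<le> exp R * (2 / q)" .
  have v2: "v R \<ge> 2" unfolding v_def using R by (intro real_le_rsqrt) auto
  then have "\<alpha> * 2 \<le> \<alpha> * v R" using \<alpha>_pos by simp
  also have "\<dots> \<le> a R * exp 2" by (rule \<alpha>_le_a[OF R])
  also have "\<dots> \<le> exp R * (2 / q) * exp 2" by (intro mult_right_mono aR) auto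
  also have "\<dots> = 2 * (exp (R + 2) * b0 / sqrt c)" by (simp add: q_def exp_add)
  finally show ?thesis by simp
qed

end

lemma continuous_tendsto_at_right_0:
  fixes w :: "real \<Rightarrow> real"
  shows "continuous_on {0..} w \<Longrightarrow> (w \<longlongrightarrow> w 0) (at_right 0)"
  unfolding at_within_Ici_at_right[symmetric] continuous_on_def by auto

section \<open>Expanders and the reduced system\<close>

text \<open>Carries derivative formulas from \<open>r > 0\<close> to the end point: the witness in
  \<open>Ck 1\<close> and \<open>w'\<close> are both continuous and agree for
  \<open>r > 0\<close>.\<close>

lemma Ck_derivative:
  assumes w: "Ck 1 w" and d: "\<And>r. r > 0 \<Longrightarrow> (w has_real_derivative w' r) (at r)"
    and c: "continuous_on {0..} w'" and r: "r \<ge> 0"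
  shows "(w has_real_derivative w' r) (at r within {0..})"
proof -
  obtain g where g: "\<And>r. r \<ge> 0 \<Longrightarrow> (w has_real_derivative g r) (at r within {0..})" "continuous_on {0..} g"
    using w by auto
  have int: "at r within {0..} = at r" if "r > 0" for r :: real
    using that by (intro at_within_interior) auto
  have eq: "g r = w' r" if "r > 0" for r
    using g(1)[of r] d[OF that] that DERIV_unique by (simp add: int) blast
  have "g 0 = w' 0"
  proof (rule tendsto_unique[of "at_right (0::real)"])
    show "(g \<longlongrightarrow> g 0) (at_right 0)"
      by (rule continuous_tendsto_at_right_0[OF g(2)])
    have "(w' \<longlongrightarrow> w' 0) (at_right 0)"
      by (rule continuous_tendsto_at_right_0[OF c])
    then show "(g \<longlongrightarrow> w' 0) (at_right 0)"
      by (rule Lim_transform_eventually) (auto simp: eventually_at_filter eq)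
  qed simp
  then have "g r = w' r" using eq[of r] r by (cases "r = 0") auto
  then show ?thesis using g(1)[OF r] by simp
qed

lemma smooth_halfline_hderiv: "smooth_halfline w \<Longrightarrow> smooth_halfline (hderiv w)"
  unfolding smooth_halfline_def by (metis funpow_Suc_right comp_apply)

lemma smooth_halfline_derivative:
  assumes "smooth_halfline w" "r \<ge> 0"
  shows "(w has_real_derivative hderiv w r) (at r within {0..})"
proof -
  have "w differentiable_on {0..}" using assms(1) unfolding smooth_halfline_def by (metis funpow_0)
  then obtain d where "(w has_real_derivative d) (at r within {0..})"
    using assms(2) by (auto simp: differentiable_on_def real_differentiable_def)
  then show ?thesis using hderiv_eq assms(2) by metis
qed

lemma smooth_halfline_DERIV:
  assumes "smooth_halfline w" "r > 0"
  shows "(w has_real_derivative hderiv w r) (at r)"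
proof -
  have "at r within {0..} = at r" using assms(2) by (intro at_within_interior) auto
  then show ?thesis using smooth_halfline_derivative[of w r] assms by simp
qed

lemma smooth_halfline_continuous:
  assumes "smooth_halfline w" shows "continuous_on {0..} w"
  by (rule DERIV_continuous_on) (use smooth_halfline_derivative assms in auto)

lemma continuous_on_Ici_at_right:
  fixes F :: "real \<Rightarrow> real"
  assumes "\<And>r. r > 0 \<Longrightarrow> isCont F r" "(F \<longlongrightarrow> F 0) (at_right 0)"
  shows "continuous_on {0..} F"
  unfolding continuous_on_def
proof
  fix r :: real assume "r \<in> {0..}"
  then consider "r = 0" | "r > 0" by force
  then show "(F \<longlongrightarrow> F r) (at r within {0..})"
  proof cases
    case 1 then show ?thesis using assms(2) by (simp add: at_within_Ici_at_right)
  next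
    case 2
    then have "(F \<longlongrightarrow> F r) (at r)" using assms(1) by (simp add: isCont_def)
    then show ?thesis by (rule tendsto_within_subset[of _ _ _ UNIV, simplified]) 
  qed
qed

section \<open>From the reduced system to an expander\<close>

context expander_flow
begin

lemma b_pos: "r \<ge> 0 \<Longrightarrow> b r > 0"
  using k_pos by (simp add: b_def)

lemma a_pos: "r > 0 \<Longrightarrow> a r > 0"
  by (simp add: a_def)

lemma b_derivative: assumes r: "r \<ge> 0" shows "(b has_real_derivative y r * b r) (at r within {0..})"
proof -
  have dk0: "(k has_real_derivative - 2 * k r * y r) (at r within {0..})"
    by (rule Ck_derivative[OF smooth(5) _ _ r], erule dk) (intro continuous_intros cont)
  have kp: "k r > 0" by (rule k_pos[OF r])
  have "((\<lambda>x. sqrt (k x)) has_real_derivative inverse (sqrt (k r)) / 2 * (- 2 * k r * y r)) (at r within {0..})"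
    using DERIV_chain2[OF DERIV_real_sqrt[OF kp] dk0] by simp
  then have "((\<lambda>x. 1 / sqrt (k x)) has_real_derivative (0 * sqrt (k r) - 1 * (inverse (sqrt (k r)) / 2 * (- 2 * k r * y r))) / (sqrt (k r) * sqrt (k r))) (at r within {0..})"
    by (rule DERIV_divide[OF DERIV_const]) (use kp in simp)
  then have "((\<lambda>x. 1 / sqrt (k x)) has_real_derivative y r * (1 / sqrt (k r))) (at r within {0..})"
    by (rule DERIV_cong) (use kp in \<open>simp add: field_simps\<close>)
  then show ?thesis unfolding b_def .
qed

lemma Ck_a: "Ck n a"
proof -
  have "Ck n (\<lambda>r. exp (\<Lambda> r))" for n
  proof (rule Ck_linear_ode[where q = "\<lambda>r. \<zeta> r - 2 * y r - u r"])
    show "Ck n (\<lambda>r. \<zeta> r - 2 * y r - u r)" for n by (intro Ck_diff Ck_mult Ck_const smooth)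
    fix r :: real assume r: "r \<ge> 0"
    have "(\<Lambda> has_real_derivative \<zeta> r - 2 * y r - u r) (at r within {0..})"
      by (rule Ck_derivative[OF smooth(6) _ _ r], erule d\<Lambda>) (intro continuous_intros cont)
    from DERIV_chain2[OF DERIV_exp this]
    show "((\<lambda>r. exp (\<Lambda> r)) has_real_derivative (\<zeta> r - 2 * y r - u r) * exp (\<Lambda> r)) (at r within {0..})"
      by (simp add: mult.commute)
  qed
  then show ?thesis unfolding a_def[abs_def] by (intro Ck_mult Ck_id)
qed

lemma Ck_b: "Ck n b"
  by (rule Ck_linear_ode[OF b_derivative smooth(2)])

lemma hderiv_a: "r \<ge> 0 \<Longrightarrow> hderiv a r = a' r"
  by (rule hderiv_eq[OF Ck_derivative[OF Ck_a da a'_cont]])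

lemma hderiv_b: "r \<ge> 0 \<Longrightarrow> hderiv b r = y r * b r"
  by (rule hderiv_eq[OF b_derivative])

lemma hderiv_f: assumes r: "r \<ge> 0" shows "hderiv (\<lambda>r. m - \<phi> r) r = - u r"
proof (rule hderiv_eq[OF _ r])
  have "(\<phi> has_real_derivative u r) (at r within {0..})"
    by (rule Ck_derivative[OF smooth(4) d\<phi> cont(3) r])
  then show "((\<lambda>r. m - \<phi> r) has_real_derivative - u r) (at r within {0..})"
    by (auto intro!: derivative_eq_intros)
qed

lemma hderiv_hderiv_a: assumes r: "r > 0" shows "hderiv (hderiv a) r = a r - (2 * y r + u r) * a' r"
proof -
  have "hderiv (hderiv a) r = hderiv a' r" by (rule hderiv_cong) (use r hderiv_a in auto)
  also have "\<dots> = a r - (2 * y r + u r) * a' r"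
    by (rule hderiv_eq[OF has_field_derivative_at_within[OF da'[OF r]]]) (use r in simp)
  finally show ?thesis .
qed

lemma hderiv_hderiv_b: assumes r: "r > 0"
  shows "hderiv (hderiv b) r = (1 + k r - \<xi> r * y r + (y r)\<^sup>2) * b r"
proof -
  have "hderiv (hderiv b) r = hderiv (\<lambda>r. y r * b r) r" by (rule hderiv_cong) (use r hderiv_b in auto)
  also have "\<dots> = (1 + k r - \<xi> r * y r) * b r + (y r * b r) * y r"
    by (rule hderiv_eq[OF DERIV_mult[OF has_field_derivative_at_within[OF dy[OF r]] b_derivative]]) (use r in simp_all)
  finally show ?thesis by (simp add: algebra_simps power2_eq_square)
qed

lemma hderiv_hderiv_f: "r > 0 \<Longrightarrow> hderiv (hderiv (\<lambda>r. m - \<phi> r)) r = \<xi> r * u r - 2 * \<phi> r"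
  and hderiv_hderiv_f_0: "hderiv (hderiv (\<lambda>r. m - \<phi> r)) 0 = - m"
proof -
  have e: "hderiv (hderiv (\<lambda>r. m - \<phi> r)) r = hderiv (\<lambda>r. - u r) r" if "r \<ge> 0" for r
    by (rule hderiv_cong) (use that hderiv_f in auto)
  show "hderiv (hderiv (\<lambda>r. m - \<phi> r)) r = \<xi> r * u r - 2 * \<phi> r" if r: "r > 0"
  proof -
    have "hderiv (\<lambda>r. - u r) r = - (2 * \<phi> r - \<xi> r * u r)"
      by (rule hderiv_eq[OF has_field_derivative_at_within[OF DERIV_minus[OF du[OF r]]]]) (use r in simp)
    then show ?thesis using e[of r] r by simp
  qed
  show "hderiv (hderiv (\<lambda>r. m - \<phi> r)) 0 = - m"
    unfolding e[OF order_refl] by (rule hderiv_eq[OF DERIV_minus[OF du_0]]) simp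
qed

lemma is_expander: "S2xR2_expander b0 (- m) a b (\<lambda>r. m - \<phi> r)"
  unfolding S2xR2_expander_def
proof (intro conjI allI impI)
  show "smooth_halfline a" "smooth_halfline b" "smooth_halfline (\<lambda>r. m - \<phi> r)"
    by (intro smooth_halfline_Ck Ck_a Ck_b Ck_diff Ck_const smooth)+
  show "S2xR2_boundary_conditions b0 (- m) a b (\<lambda>r. m - \<phi> r)"
    unfolding S2xR2_boundary_conditions_def hderiv_hderiv_f_0
    using b0 by (simp add: hderiv_a hderiv_b hderiv_f init a_def a'_def b_def t_def real_sqrt_divide)
  fix r :: real assume r: "r > 0"
  show ab: "a r > 0" "b r > 0" using a_pos[OF r] b_pos[of r] r by simp_all
  have a': "a' r = x r * a r" using r by (simp add: a'_def a_def x_def)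
  have kb: "1 / b r = k r * b r"
    using k_pos[of r] r by (simp add: b_def real_div_sqrt)
  have \<xi>: "\<xi> r = x r + 2 * y r + u r" by (rule \<xi>_eq[OF r])
  \<comment> \<open>Trading \<open>2 * \<phi>\<close> for the other quantities turns the equation
    for \<open>f''\<close> into a polynomial identity.\<close>
  have c: "2 * \<phi> r = (\<xi> r)\<^sup>2 - (x r)\<^sup>2 - 2 * (y r)\<^sup>2 - 2 - 2 * k r"
    using constraint[OF r] v_sq[of r] r by simp
  have d: "hderiv a r = x r * a r" "hderiv b r = y r * b r" "hderiv (\<lambda>r. m - \<phi> r) r = - u r"
    using hderiv_a[of r] hderiv_b[of r] hderiv_f[of r] r a' by simp_all
  have q: "hderiv (hderiv a) r / a r = 1 - (2 * y r + u r) * x r"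
    "hderiv (hderiv b) r / b r = 1 + k r - \<xi> r * y r + (y r)\<^sup>2"
    "hderiv a r * hderiv b r / b r = x r * a r * y r" "hderiv a r * hderiv b r / a r = x r * y r * b r"
    unfolding hderiv_hderiv_a[OF r] hderiv_hderiv_b[OF r] d a' using ab by (simp_all add: field_simps)
  have "(1 - (hderiv b r)\<^sup>2) / b r = 1 / b r - (y r)\<^sup>2 * b r"
    unfolding d using ab by (simp add: field_simps power2_eq_square)
  then have q3: "(1 - (hderiv b r)\<^sup>2) / b r = (k r - (y r)\<^sup>2) * b r" unfolding kb by (simp add: algebra_simps)
  show "soliton_equations a b (\<lambda>r. m - \<phi> r) r"
    unfolding soliton_equations_def q q3
    unfolding hderiv_hderiv_a[OF r] hderiv_hderiv_b[OF r] hderiv_hderiv_f[OF r] d a' c \<xi>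
    by (simp add: algebra_simps power2_eq_square)
qed

lemma hderiv_a_tendsto: "(hderiv a \<longlongrightarrow> \<alpha>) at_top"
  by (rule Lim_transform_eventually[OF a'_tendsto])
    (use eventually_ge_at_top[of 0] in eventually_elim, simp add: hderiv_a)

lemma hderiv_b_tendsto: "(hderiv b \<longlongrightarrow> \<beta>) at_top"
  by (rule Lim_transform_eventually[OF b'_tendsto])
    (use eventually_ge_at_top[of 0] in eventually_elim, simp add: hderiv_b)

end

section \<open>From an expander to the reduced system\<close>

locale expander =
  fixes b0 m :: real and a b f :: "real \<Rightarrow> real"
  assumes pos: "b0 > 0" "m > 0" and exp: "S2xR2_expander b0 (- m) a b f"
begin

definition "x r = hderiv a r / a r"
definition "y r = hderiv b r / b r"
definition "u r = - hderiv f r"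
definition "k r = 1 / (b r)\<^sup>2"
definition "\<phi> r = m - f r"
definition "\<xi> r = x r + 2 * y r + u r"
text \<open>The values at \<open>0\<close>, here and for \<open>\<Lambda>\<close>, are the
  continuous extensions, by \<open>x_limit\<close> and \<open>a_over_r\<close>.\<close>

definition "\<zeta> r = (if r = 0 then 0 else \<xi> r - 1 / r)"
definition "\<Lambda> r = (if r = 0 then 0 else ln (a r / r))"

lemma sm: "smooth_halfline a" "smooth_halfline b" "smooth_halfline f"
  and pos_ab: "r > 0 \<Longrightarrow> a r > 0" "r > 0 \<Longrightarrow> b r > 0"
  and eqs: "r > 0 \<Longrightarrow> soliton_equations a b f r"
  and bc: "a 0 = 0" "hderiv a 0 = 1" "b 0 = b0" "hderiv b 0 = 0" "f 0 = 0" "hderiv f 0 = 0" "hderiv (hderiv f) 0 = - m"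
  using exp unfolding S2xR2_expander_def S2xR2_boundary_conditions_def by auto

lemma b_pos: "r \<ge> 0 \<Longrightarrow> b r > 0"
  using pos_ab(2)[of r] bc(3) pos by (cases "r = 0") auto

lemmas sm1 = sm[THEN smooth_halfline_hderiv]
lemmas sm2 = sm1[THEN smooth_halfline_hderiv]
lemmas sc = sm[THEN smooth_halfline_continuous] sm1[THEN smooth_halfline_continuous] sm2[THEN smooth_halfline_continuous]

lemmas right_limit = continuous_tendsto_at_right_0

lemma y_cont: "continuous_on {0..} y" and u_cont: "continuous_on {0..} u" and k_cont: "continuous_on {0..} k"
    and \<phi>_cont: "continuous_on {0..} \<phi>"
  unfolding y_def[abs_def] u_def[abs_def] k_def[abs_def] \<phi>_def[abs_def]
  using b_pos by (auto intro!: continuous_intros sc simp: less_imp_neq[symmetric])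

text \<open>In the third identity \<open>a''\<close> and \<open>b''\<close> have been substituted
  into the equation for \<open>f''\<close>. It does not contain \<open>f\<close> itself;
  \<open>\<phi>\<close> enters only through \<open>constraint\<close>.\<close>

lemma second: assumes r: "r > 0"
  shows "hderiv (hderiv a) r = (1 - (2 * y r + u r) * x r) * a r"
    "hderiv (hderiv b) r = (1 + k r - \<xi> r * y r + (y r)\<^sup>2) * b r"
    "hderiv u r = (\<xi> r)\<^sup>2 - (x r)\<^sup>2 - 2 * (y r)\<^sup>2 - 2 - 2 * k r - \<xi> r * u r"
proof -
  have ab: "a r > 0" "b r > 0" using pos_ab r by auto
  note e = eqs[OF r, unfolded soliton_equations_def]
  have d: "hderiv a r = x r * a r" "hderiv b r = y r * b r" "hderiv f r = - u r"
    using ab by (simp_all add: x_def y_def u_def)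
  show 1: "hderiv (hderiv a) r = (1 - (2 * y r + u r) * x r) * a r"
    using e[THEN conjunct2, THEN conjunct1] unfolding d using ab by (simp add: field_simps)
  have kb: "1 / b r = k r * b r" using ab by (simp add: k_def power2_eq_square)
  have "(1 - (y r * b r)\<^sup>2) / b r = 1 / b r - (y r)\<^sup>2 * b r"
    using ab by (simp add: field_simps power2_eq_square)
  then have q3: "(1 - (y r * b r)\<^sup>2) / b r = (k r - (y r)\<^sup>2) * b r" unfolding kb by (simp add: algebra_simps)
  have q4: "x r * a r * (y r * b r) / a r = x r * y r * b r" using ab by simp
  show 2: "hderiv (hderiv b) r = (1 + k r - \<xi> r * y r + (y r)\<^sup>2) * b r"
    using e[THEN conjunct2, THEN conjunct2] unfolding d q3 q4
    by (simp add: \<xi>_def algebra_simps power2_eq_square)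
  have "hderiv u r = - hderiv (hderiv f) r"
    unfolding u_def[abs_def]
    by (rule hderiv_eq[OF DERIV_minus[OF smooth_halfline_derivative[OF sm1(3)]]]) (use r in auto)
  also have "\<dots> = - ((1 - (2 * y r + u r) * x r) + 2 * (1 + k r - \<xi> r * y r + (y r)\<^sup>2) - 1)"
    using e[THEN conjunct1] unfolding 1 2 using ab by simp
  also have "\<dots> = (\<xi> r)\<^sup>2 - (x r)\<^sup>2 - 2 * (y r)\<^sup>2 - 2 - 2 * k r - \<xi> r * u r"
    by (simp add: \<xi>_def algebra_simps power2_eq_square)
  finally show "hderiv u r = (\<xi> r)\<^sup>2 - (x r)\<^sup>2 - 2 * (y r)\<^sup>2 - 2 - 2 * k r - \<xi> r * u r" .
qed

lemma dx: assumes r: "r > 0" shows "(x has_real_derivative 1 - \<xi> r * x r) (at r)"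
proof -
  have ar: "a r \<noteq> 0" using pos_ab(1)[OF r] by simp
  have "(x has_real_derivative (hderiv (hderiv a) r * a r - hderiv a r * hderiv a r) / (a r * a r)) (at r)"
    unfolding x_def[abs_def] by (intro DERIV_divide smooth_halfline_DERIV sm sm1 r ar)
  moreover have "hderiv a r = x r * a r" using ar by (simp add: x_def)
  ultimately show ?thesis
    by (elim DERIV_cong) (use ar in \<open>simp add: second[OF r] \<xi>_def field_simps\<close>)
qed

lemma dy: assumes r: "r > 0" shows "(y has_real_derivative 1 + k r - \<xi> r * y r) (at r)"
proof -
  have br: "b r \<noteq> 0" using pos_ab(2)[OF r] by simp
  have "(y has_real_derivative (hderiv (hderiv b) r * b r - hderiv b r * hderiv b r) / (b r * b r)) (at r)"
    unfolding y_def[abs_def] by (intro DERIV_divide smooth_halfline_DERIV sm sm1 r br)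
  moreover have "hderiv b r = y r * b r" using br by (simp add: y_def)
  ultimately show ?thesis
    by (elim DERIV_cong) (use br in \<open>simp add: second[OF r] power2_eq_square field_simps\<close>)
qed

lemma dk: assumes r: "r > 0" shows "(k has_real_derivative - 2 * k r * y r) (at r)"
proof -
  have br: "b r \<noteq> 0" using pos_ab(2)[OF r] by simp
  have "((\<lambda>r. 1 / (b r * b r)) has_real_derivative (0 * (b r * b r) - 1 * (hderiv b r * b r + hderiv b r * b r)) / ((b r * b r) * (b r * b r))) (at r)"
    by (intro DERIV_divide DERIV_const DERIV_mult smooth_halfline_DERIV sm r) (use br in simp)
  moreover have "hderiv b r = y r * b r" using br by (simp add: y_def)
  ultimately show ?thesis unfolding k_def[abs_def] power2_eq_square
    by (elim DERIV_cong) (use br in \<open>simp add: field_simps\<close>)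
qed

lemma d\<phi>: assumes r: "r > 0" shows "(\<phi> has_real_derivative u r) (at r)"
  unfolding \<phi>_def[abs_def] u_def
  by (rule DERIV_cong[OF DERIV_diff[OF DERIV_const smooth_halfline_DERIV[OF sm(3) r]]]) simp

lemma du: assumes r: "r > 0"
  shows "(u has_real_derivative (\<xi> r)\<^sup>2 - (x r)\<^sup>2 - 2 * (y r)\<^sup>2 - 2 - 2 * k r - \<xi> r * u r) (at r)"
proof -
  have d: "(u has_real_derivative - hderiv (hderiv f) r) (at r)"
    unfolding u_def[abs_def] by (rule DERIV_minus[OF smooth_halfline_DERIV[OF sm1(3) r]])
  have "hderiv u r = - hderiv (hderiv f) r"
    by (rule hderiv_eq[OF has_field_derivative_at_within[OF d]]) (use r in simp)
  then show ?thesis using d second(3)[OF r] by simp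
qed

lemma d\<xi>: assumes r: "r > 0" shows "(\<xi> has_real_derivative 1 - (x r)\<^sup>2 - 2 * (y r)\<^sup>2) (at r)"
  unfolding \<xi>_def[abs_def]
  by (rule DERIV_cong[OF DERIV_add[OF DERIV_add[OF dx[OF r] DERIV_cmult[OF dy[OF r]]] du[OF r]]])
    (simp add: \<xi>_def algebra_simps power2_eq_square)

lemma a_over_r: "((\<lambda>r. a r / r) \<longlongrightarrow> 1) (at_right 0)"
  using smooth_halfline_derivative[OF sm(1), of 0] by (simp add: bc has_field_derivative_iff at_within_Ici_at_right)

lemma u_over_r: "((\<lambda>r. u r / r) \<longlongrightarrow> m) (at_right 0)"
proof -
  have "((\<lambda>r. hderiv f r / r) \<longlongrightarrow> - m) (at_right 0)"
    using smooth_halfline_derivative[OF sm1(3), of 0] by (simp add: bc has_field_derivative_iff at_within_Ici_at_right)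
  from tendsto_minus[OF this] show ?thesis by (simp add: u_def)
qed

lemma constraint: assumes r: "r > 0"
  shows "(\<xi> r)\<^sup>2 - (x r)\<^sup>2 - 2 * (y r)\<^sup>2 - 2 - 2 * k r = 2 * \<phi> r"
proof -
  \<comment> \<open>\<open>g\<close> is constant: up to sign it is the defect of the first integral \<open>f'' + \<xi>f' = 2(f + f\<^sub>0)\<close>.\<close>
  define g where "g r = (\<xi> r)\<^sup>2 - (x r)\<^sup>2 - 2 * (y r)\<^sup>2 - 2 - 2 * k r - 2 * \<phi> r" for r
  have dg: "(g has_real_derivative 0) (at r)" if r: "r > 0" for r
  proof -
    have "((\<lambda>r. \<xi> r * \<xi> r - x r * x r - 2 * (y r * y r) - 2 - 2 * k r - 2 * \<phi> r) has_real_derivative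
      ((1 - (x r)\<^sup>2 - 2 * (y r)\<^sup>2) * \<xi> r + (1 - (x r)\<^sup>2 - 2 * (y r)\<^sup>2) * \<xi> r
      - ((1 - \<xi> r * x r) * x r + (1 - \<xi> r * x r) * x r)
      - 2 * ((1 + k r - \<xi> r * y r) * y r + (1 + k r - \<xi> r * y r) * y r) - 0 - 2 * (- 2 * k r * y r) - 2 * u r)) (at r)"
      by (intro DERIV_diff DERIV_mult DERIV_cmult DERIV_const d\<xi> dx dy dk d\<phi> r)
    then show ?thesis unfolding g_def[abs_def] power2_eq_square
      by (rule DERIV_cong) (simp add: \<xi>_def algebra_simps power2_eq_square)
  qed
  have const: "g s = g r" if s: "s > 0" for s
    by (rule DERIV_isconst3[of 0 "max r s + 1"]) (use dg r s in auto)
  \<comment> \<open>The constant is read off at \<open>0\<close>: since \<open>x\<close> behaves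
    like \<open>1 / s\<close> and \<open>u\<close> like \<open>m * s\<close>, both \<open>u'\<close>
    and \<open>\<xi> * u\<close> tend to \<open>m\<close>, while \<open>2 * \<phi>\<close> tends to
    \<open>2 * m\<close>. The boundary value of \<open>f''\<close> enters here.\<close>
  have "((\<lambda>s. hderiv u s + \<xi> s * u s - 2 * \<phi> s) \<longlongrightarrow> 0) (at_right 0)"
  proof -
    have hu: "hderiv u s = - hderiv (hderiv f) s" if "s \<ge> 0" for s
      unfolding u_def[abs_def]
      by (rule hderiv_eq[OF DERIV_minus[OF smooth_halfline_derivative[OF sm1(3) that]] that])
    have 1: "((\<lambda>s. - hderiv (hderiv f) s) \<longlongrightarrow> m) (at_right 0)"
      using tendsto_minus[OF right_limit[OF sc(9)]] by (simp add: bc)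
    have "((\<lambda>s. hderiv a s * (u s / s) / (a s / s)) \<longlongrightarrow> 1 * m / 1) (at_right 0)"
      using right_limit[OF sc(4)] by (intro tendsto_intros a_over_r u_over_r) (simp_all add: bc)
    then have "((\<lambda>s. x s * u s) \<longlongrightarrow> 1 * m / 1) (at_right 0)"
      by (rule Lim_transform_eventually) (auto simp: eventually_at_filter x_def)
    moreover have "((\<lambda>s. (2 * y s + u s) * u s) \<longlongrightarrow> (2 * y 0 + u 0) * u 0) (at_right 0)"
      by (intro tendsto_intros right_limit y_cont u_cont)
    ultimately have 2: "((\<lambda>s. x s * u s + (2 * y s + u s) * u s) \<longlongrightarrow> m + 0) (at_right 0)"
      by (intro tendsto_add) (simp_all add: u_def bc)
    have "((\<lambda>s. 2 * \<phi> s) \<longlongrightarrow> 2 * \<phi> 0) (at_right 0)"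
      by (intro tendsto_intros right_limit \<phi>_cont)
    moreover have "\<phi> 0 = m" by (simp add: \<phi>_def bc)
    ultimately have 3: "((\<lambda>s. 2 * \<phi> s) \<longlongrightarrow> 2 * m) (at_right 0)" by simp
    have "((\<lambda>s. - hderiv (hderiv f) s + (x s * u s + (2 * y s + u s) * u s) - 2 * \<phi> s) \<longlongrightarrow> m + (m + 0) - 2 * m) (at_right 0)"
      by (intro tendsto_intros 1 2 3)
    then have "((\<lambda>s. - hderiv (hderiv f) s + (x s * u s + (2 * y s + u s) * u s) - 2 * \<phi> s) \<longlongrightarrow> 0) (at_right 0)" by simp
    then show ?thesis
      by (rule Lim_transform_eventually) (auto simp: eventually_at_filter hu \<xi>_def algebra_simps)
  qed
  then have "((\<lambda>s. g r) \<longlongrightarrow> 0) (at_right (0::real))"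
  proof (rule Lim_transform_eventually)
    have "hderiv u s + \<xi> s * u s - 2 * \<phi> s = g r" if "s > 0" for s
      unfolding const[OF that, symmetric] using second(3)[OF that] by (simp add: g_def)
    then show "eventually (\<lambda>s. hderiv u s + \<xi> s * u s - 2 * \<phi> s = g r) (at_right 0)"
      by (auto simp: eventually_at_filter)
  qed
  then have "g r = 0" by (simp add: tendsto_const_iff)
  then show ?thesis by (simp add: g_def)
qed

lemma a''_0: "((\<lambda>r. hderiv (hderiv a) r) \<longlongrightarrow> 0) (at_right 0)"
proof -
  have "((\<lambda>r. - (2 * y r + u r) * hderiv a r + a r) \<longlongrightarrow> - (2 * y 0 + u 0) * hderiv a 0 + a 0) (at_right 0)"
    by (intro tendsto_intros right_limit y_cont u_cont sc)
  then have "((\<lambda>r. - (2 * y r + u r) * hderiv a r + a r) \<longlongrightarrow> 0) (at_right 0)" by (simp add: y_def u_def bc)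
  then show ?thesis
  proof (rule Lim_transform_eventually)
    have "- (2 * y r + u r) * hderiv a r + a r = hderiv (hderiv a) r" if r: "r > 0" for r
      unfolding second(1)[OF r] using pos_ab(1)[OF r] by (simp add: x_def field_simps)
    then show "eventually (\<lambda>r. - (2 * y r + u r) * hderiv a r + a r = hderiv (hderiv a) r) (at_right 0)"
      by (auto simp: eventually_at_filter)
  qed
qed

text \<open>Continuity of \<open>\<zeta>\<close> at \<open>0\<close> needs one more Taylor
  coefficient of \<open>a\<close>: by l'Hopital the limit is that of
  \<open>a'' / (a / r + a')\<close>, and \<open>a''\<close> tends to \<open>0\<close>.\<close>

lemma x_limit: "((\<lambda>r. x r - 1 / r) \<longlongrightarrow> 0) (at_right 0)"
proof -
  have ev: "eventually (\<lambda>r. r > 0 \<and> hderiv a r > 0) (at_right 0)"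
  proof (rule eventually_conj)
    show "eventually (\<lambda>r::real. r > 0) (at_right 0)" by (rule eventually_at_right_less)
    show "eventually (\<lambda>r. hderiv a r > 0) (at_right 0)"
      by (rule order_tendstoD(1)[OF right_limit[OF sc(4)]]) (simp add: bc)
  qed
  have "((\<lambda>r. (r * hderiv a r - a r) / (r * a r)) \<longlongrightarrow> 0) (at_right 0)"
  proof (rule lhopital_right_0[where f' = "\<lambda>r. r * hderiv (hderiv a) r" and g' = "\<lambda>r. a r + r * hderiv a r"])
    have "((\<lambda>r. r * hderiv a r - a r) \<longlongrightarrow> 0 * hderiv a 0 - a 0) (at_right 0)"
      by (intro tendsto_intros right_limit sc)
    then show "((\<lambda>r. r * hderiv a r - a r) \<longlongrightarrow> 0) (at_right 0)" by (simp add: bc)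
    have "((\<lambda>r. r * a r) \<longlongrightarrow> 0 * a 0) (at_right 0)" by (intro tendsto_intros right_limit sc)
    then show "((\<lambda>r. r * a r) \<longlongrightarrow> 0) (at_right 0)" by simp
    show "eventually (\<lambda>r. r * a r \<noteq> 0) (at_right 0)"
      using ev by eventually_elim (use pos_ab in force)
    show "eventually (\<lambda>r. a r + r * hderiv a r \<noteq> 0) (at_right 0)"
      using ev
    proof eventually_elim
      case (elim r)
      then have "a r + r * hderiv a r > 0" using pos_ab(1)[of r] by (intro add_pos_pos) auto
      then show ?case by simp
    qed
    show "eventually (\<lambda>r. ((\<lambda>r. r * hderiv a r - a r) has_real_derivative r * hderiv (hderiv a) r) (at r)) (at_right 0)"
      using ev
    proof eventually_elim
      case (elim r)
      have "((\<lambda>r. r * hderiv a r - a r) has_real_derivative 1 * hderiv a r + hderiv (hderiv a) r * r - hderiv a r) (at r)"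
        using elim by (intro DERIV_diff DERIV_mult DERIV_ident smooth_halfline_DERIV sm sm1) auto
      then show ?case by (rule DERIV_cong) simp
    qed
    show "eventually (\<lambda>r. ((\<lambda>r. r * a r) has_real_derivative a r + r * hderiv a r) (at r)) (at_right 0)"
      using ev
    proof eventually_elim
      case (elim r)
      have "((\<lambda>r. r * a r) has_real_derivative 1 * a r + hderiv a r * r) (at r)"
        using elim by (intro DERIV_mult DERIV_ident smooth_halfline_DERIV sm) auto
      then show ?case by (rule DERIV_cong) simp
    qed
    have "((\<lambda>r. hderiv (hderiv a) r / (a r / r + hderiv a r)) \<longlongrightarrow> 0 / (1 + 1)) (at_right 0)"
      using right_limit[OF sc(4)] by (intro tendsto_intros a''_0 a_over_r) (simp_all add: bc)
    then have "((\<lambda>r. hderiv (hderiv a) r / (a r / r + hderiv a r)) \<longlongrightarrow> 0) (at_right 0)" by simp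
    then show "((\<lambda>r. r * hderiv (hderiv a) r / (a r + r * hderiv a r)) \<longlongrightarrow> 0) (at_right 0)"
      by (rule Lim_transform_eventually) (auto simp: eventually_at_filter field_simps)
  qed
  then show ?thesis
  proof (rule Lim_transform_eventually)
    have "(r * hderiv a r - a r) / (r * a r) = x r - 1 / r" if "r > 0" for r
      using pos_ab(1)[OF that] that by (simp add: x_def field_simps)
    then show "eventually (\<lambda>r. (r * hderiv a r - a r) / (r * a r) = x r - 1 / r) (at_right 0)"
      by (auto simp: eventually_at_filter)
  qed
qed

lemma flow: "expander_flow b0 m \<zeta> y u \<phi> k \<Lambda>"
proof
  show "b0 > 0" "m > 0" by (rule pos)+
  show "\<zeta> 0 = 0" "y 0 = 0" "u 0 = 0" "\<phi> 0 = m" "k 0 = 1 / b0\<^sup>2" "\<Lambda> 0 = 0"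
    by (simp_all add: \<zeta>_def y_def u_def \<phi>_def k_def \<Lambda>_def bc)
  have \<zeta>r: "\<zeta> r = \<xi> r - 1 / r" and \<Lambda>r: "\<Lambda> r = ln (a r / r)" if "r > 0" for r
    using that by (simp_all add: \<zeta>_def \<Lambda>_def)
  have d\<zeta>: "(\<zeta> has_real_derivative - 2 * \<zeta> r / r - (\<zeta> r)\<^sup>2 + 3 + 2 * k r + 2 * \<phi> r) (at r)" if r: "r > 0" for r
  proof -
    have "((\<lambda>r. \<xi> r - 1 / r) has_real_derivative (1 - (x r)\<^sup>2 - 2 * (y r)\<^sup>2) - (0 * r - 1 * 1) / (r * r)) (at r)"
      by (intro DERIV_diff DERIV_divide DERIV_const DERIV_ident d\<xi> r) (use r in simp)
    moreover have "(1 - (x r)\<^sup>2 - 2 * (y r)\<^sup>2) - (0 * r - 1 * 1) / (r * r) = - 2 * \<zeta> r / r - (\<zeta> r)\<^sup>2 + 3 + 2 * k r + 2 * \<phi> r"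
      unfolding constraint[OF r, symmetric] \<zeta>r[OF r] using r by (simp add: field_simps power2_eq_square)
    ultimately have "((\<lambda>r. \<xi> r - 1 / r) has_real_derivative - 2 * \<zeta> r / r - (\<zeta> r)\<^sup>2 + 3 + 2 * k r + 2 * \<phi> r) (at r)"
      by (rule DERIV_cong)
    then show ?thesis
      by (rule has_field_derivative_transform_within_open[of _ _ _ "{0<..}"]) (use r \<zeta>r in auto)
  qed
  have d\<Lambda>: "(\<Lambda> has_real_derivative \<zeta> r - 2 * y r - u r) (at r)" if r: "r > 0" for r
  proof -
    have ar: "a r / r > 0" using pos_ab(1)[OF r] r by simp
    have "((\<lambda>r. ln (a r / r)) has_real_derivative inverse (a r / r) * ((hderiv a r * r - a r * 1) / (r * r))) (at r)"
      by (rule DERIV_chain2[OF DERIV_ln[OF ar] DERIV_divide[OF smooth_halfline_DERIV[OF sm(1) r] DERIV_ident]]) (use r in simp)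
    moreover have "inverse (a r / r) * ((hderiv a r * r - a r * 1) / (r * r)) = \<zeta> r - 2 * y r - u r"
      unfolding \<zeta>r[OF r] \<xi>_def x_def using pos_ab(1)[OF r] r by (simp add: field_simps)
    ultimately have "((\<lambda>r. ln (a r / r)) has_real_derivative \<zeta> r - 2 * y r - u r) (at r)" by simp
    then show ?thesis
      by (rule has_field_derivative_transform_within_open[of _ _ _ "{0<..}"]) (use r \<Lambda>r in auto)
  qed
  have \<zeta>c: "continuous_on {0..} \<zeta>"
  proof (rule continuous_on_Ici_at_right)
    show "isCont \<zeta> r" if "r > 0" for r using DERIV_isCont d\<zeta>[OF that] by blast
    have "((\<lambda>r. (x r - 1 / r) + (2 * y r + u r)) \<longlongrightarrow> 0 + (2 * y 0 + u 0)) (at_right 0)"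
      by (intro tendsto_intros x_limit right_limit y_cont u_cont)
    then have "((\<lambda>r. (x r - 1 / r) + (2 * y r + u r)) \<longlongrightarrow> \<zeta> 0) (at_right 0)" by (simp add: y_def u_def bc \<zeta>_def)
    then show "(\<zeta> \<longlongrightarrow> \<zeta> 0) (at_right 0)"
      by (rule Lim_transform_eventually) (auto simp: eventually_at_filter \<zeta>_def \<xi>_def)
  qed
  have \<Lambda>c: "continuous_on {0..} \<Lambda>"
  proof (rule continuous_on_Ici_at_right)
    show "isCont \<Lambda> r" if "r > 0" for r using DERIV_isCont d\<Lambda>[OF that] by blast
    have "((\<lambda>r. ln (a r / r)) \<longlongrightarrow> ln 1) (at_right 0)" by (intro tendsto_ln a_over_r) simp
    then have "((\<lambda>r. ln (a r / r)) \<longlongrightarrow> \<Lambda> 0) (at_right 0)" by (simp add: \<Lambda>_def)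
    then show "(\<Lambda> \<longlongrightarrow> \<Lambda> 0) (at_right 0)"
      by (rule Lim_transform_eventually) (auto simp: eventually_at_filter \<Lambda>_def)
  qed
  show "flow_on T \<zeta> y u \<phi> k \<Lambda>" for T
    unfolding flow_on_def
  proof (intro conjI allI impI)
    have s: "{0..T} \<subseteq> {0..}" by auto
    show "continuous_on {0..T} \<zeta>" "continuous_on {0..T} y" "continuous_on {0..T} u"
      "continuous_on {0..T} \<phi>" "continuous_on {0..T} k" "continuous_on {0..T} \<Lambda>"
      by (rule continuous_on_subset[OF _ s], fact \<zeta>c y_cont u_cont \<phi>_cont k_cont \<Lambda>c)+
    fix r assume "0 < r \<and> r < T"
    then have r: "r > 0" by simp
    have \<xi>: "\<xi> r = 1 / r + \<zeta> r" using \<zeta>r[OF r] by simp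
    show "(\<zeta> has_real_derivative - 2 * \<zeta> r / r - (\<zeta> r)\<^sup>2 + 3 + 2 * k r + 2 * \<phi> r) (at r)" by (rule d\<zeta>[OF r])
    show "(y has_real_derivative - y r / r - \<zeta> r * y r + 1 + k r) (at r)"
      by (rule DERIV_cong[OF dy[OF r]]) (simp add: \<xi> algebra_simps)
    show "(u has_real_derivative - u r / r - \<zeta> r * u r + 2 * \<phi> r) (at r)"
      by (rule DERIV_cong[OF du[OF r]], unfold constraint[OF r]) (simp add: \<xi> algebra_simps)
    show "(\<phi> has_real_derivative u r) (at r)" by (rule d\<phi>[OF r])
    show "(k has_real_derivative - 2 * k r * y r) (at r)" by (rule dk[OF r])
    show "(\<Lambda> has_real_derivative \<zeta> r - 2 * y r - u r) (at r)" by (rule d\<Lambda>[OF r])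
  qed
qed

end

section \<open>Uniqueness and the value of the asymptotic map\<close>

context expander_flow
begin

lemma expander_unique:
  assumes e: "S2xR2_expander b0 (- m) a2 b2 f2" and r: "r \<ge> 0"
  shows "a2 r = a r" "b2 r = b r"
proof -
  interpret e: expander b0 m a2 b2 f2 using b0 m e by unfold_locales
  interpret f: expander_flow b0 m e.\<zeta> e.y e.u e.\<phi> e.k e.\<Lambda> by (rule e.flow)
  have eq: "e.k r = k r" "e.\<Lambda> r = \<Lambda> r"
    using flow_unique[OF f.flow flow, of r r] f.init init r by simp_all
  show "a2 r = a r"
  proof (cases "r = 0")
    case False
    then have "a2 r / r > 0" using e.pos_ab(1)[of r] r by simp
    then have "exp (e.\<Lambda> r) = a2 r / r" using False by (simp add: e.\<Lambda>_def)
    then show ?thesis using False eq by (simp add: a_def)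
  qed (simp add: e.bc a_def)
  have "b2 r > 0" using e.b_pos[OF r] .
  then have "1 / sqrt (e.k r) = b2 r" by (simp add: e.k_def real_sqrt_divide)
  then show "b2 r = b r" using eq by (simp add: b_def)
qed

text \<open>Expanders are unique only on \<open>r \<ge> 0\<close>, but the definite description
  ranges over the limits of \<open>hderiv\<close>, and these see nothing else.\<close>

lemma asymptotic_map_eq: "asymptotic_map (b0, m) = (\<alpha>, \<beta>)"
proof -
  have "(THE p. \<exists>a b f. S2xR2_expander b0 (- m) a b f \<and>
      filterlim (hderiv a) (nhds (fst p)) at_top \<and> filterlim (hderiv b) (nhds (snd p)) at_top) = (\<alpha>, \<beta>)"
  proof (rule the_equality)
    show "\<exists>a b f. S2xR2_expander b0 (- m) a b f \<and>
      filterlim (hderiv a) (nhds (fst (\<alpha>, \<beta>))) at_top \<and> filterlim (hderiv b) (nhds (snd (\<alpha>, \<beta>))) at_top"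
      using is_expander hderiv_a_tendsto hderiv_b_tendsto by auto
    fix p assume "\<exists>a b f. S2xR2_expander b0 (- m) a b f \<and>
      filterlim (hderiv a) (nhds (fst p)) at_top \<and> filterlim (hderiv b) (nhds (snd p)) at_top"
    then obtain a2 b2 f2 where e: "S2xR2_expander b0 (- m) a2 b2 f2"
      and l: "filterlim (hderiv a2) (nhds (fst p)) at_top" "filterlim (hderiv b2) (nhds (snd p)) at_top" by blast
    have "hderiv a2 r = hderiv a r" "hderiv b2 r = hderiv b r" if "r \<ge> 0" for r
      using expander_unique[OF e] that by (auto intro: hderiv_cong)
    then have "eventually (\<lambda>r. hderiv a2 r = hderiv a r) at_top" "eventually (\<lambda>r. hderiv b2 r = hderiv b r) at_top"
      by (auto intro: eventually_mono[OF eventually_ge_at_top[of 0]])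
    then have "filterlim (hderiv a) (nhds (fst p)) at_top" "filterlim (hderiv b) (nhds (snd p)) at_top"
      using l by (auto intro: Lim_transform_eventually)
    then have "fst p = \<alpha>" "snd p = \<beta>"
      using tendsto_unique[OF trivial_limit_at_top_linorder] hderiv_a_tendsto hderiv_b_tendsto by blast+
    then show "p = (\<alpha>, \<beta>)" by (simp add: prod_eq_iff)
  qed
  then show ?thesis by (simp add: asymptotic_map_def case_prod_beta')
qed

end

lemma expander_flow_exists:
  assumes "b0 > 0" "m > 0"
  obtains \<zeta> y u \<phi> k \<Lambda> where "expander_flow b0 m \<zeta> y u \<phi> k \<Lambda>"
proof -
  have "1 / b0\<^sup>2 > 0" using assms by simp
  from global_picard[OF this assms(2)]
  obtain \<zeta> y u \<phi> k \<Lambda> where p: "\<And>T. picard_on T (1 / b0\<^sup>2) m \<zeta> y u \<phi> k \<Lambda>" by metis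
  have "expander_flow b0 m \<zeta> y u \<phi> k \<Lambda>"
    by (rule expander_flow.intro[OF assms picard_flow[OF p] picard_init[OF p order_refl]])
  then show thesis by (rule that)
qed

section \<open>Continuity and properness\<close>

context expander_flow
begin

text \<open>Supplies the constant of \<open>flow_dist\<close> uniformly for
  \<open>b0 \<ge> \<beta>0\<close> and \<open>m \<le> M\<close>; the bound of \<open>\<zeta>\<close>
  comes from \<open>x - 1 / r \<le> 1\<close>.\<close>

lemma flow_bounded:
  assumes "\<beta>0 > 0" "\<beta>0 \<le> b0" "m \<le> M" "0 \<le> r" "r \<le> R"
  defines "B \<equiv> 3 + 2 / \<beta>0\<^sup>2 + sqrt (2 * M) + R"
  shows "\<bar>\<zeta> r\<bar> \<le> B \<and> \<bar>k r\<bar> \<le> B \<and> \<bar>y r\<bar> \<le> B \<and> \<bar>u r\<bar> \<le> B"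
proof -
  have k0le: "k0 \<le> 1 / \<beta>0\<^sup>2" using assms unfolding k0_def by (intro divide_left_mono power_mono) auto
  have M: "sqrt (2 * m) \<le> sqrt (2 * M)" "sqrt (2 * M) \<ge> 0" using assms m by auto
  have i: "2 / \<beta>0\<^sup>2 \<ge> 0" "1 / \<beta>0\<^sup>2 \<le> 2 / \<beta>0\<^sup>2" by (simp_all add: divide_right_mono)
  have y2: "2 * y r \<le> 2 + 2 / \<beta>0\<^sup>2" using y_le[of r] k0le assms by simp
  have ul: "u r \<le> sqrt (2 * M) + R" using u_le_v[of r] v_le[of r] M assms by linarith
  have "\<zeta> r \<le> 1 + 2 * y r + u r"
  proof (cases "r = 0")
    case False
    then have r: "r > 0" using assms by simp
    show ?thesis using x_le[OF r] \<xi>_eq[OF r] by (simp add: \<xi>_def)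
  qed (simp add: init)
  then have "\<zeta> r \<le> B" using y2 ul by (simp add: B_def)
  moreover have "k r \<le> B" using nonneg(6)[OF assms(4)] k0le i M assms(4,5) unfolding B_def by linarith
  moreover have "y r \<le> B" using y2 nonneg(2)[OF assms(4)] i M assms(4,5) unfolding B_def by linarith
  moreover have "u r \<le> B" using ul i unfolding B_def by linarith
  ultimately show ?thesis using nonneg[of r] assms by auto
qed

text \<open>The error depends on the parameters only through a lower bound \<open>N\<close> of
  \<open>\<phi> R\<close>, which \<open>P_growth\<close> supplies uniformly.\<close>

lemma ln_\<alpha>_close:
  assumes R: "R \<ge> 1" and N: "4 \<le> N" "N \<le> \<phi> R"
  shows "\<bar>la R - ln \<alpha>\<bar> \<le> 2 / sqrt (2 * N) + 1 / N"
proof -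
  have R0: "R > 0" using R by simp
  have "sqrt (2 * N) \<le> v R" using N by (simp add: v_def)
  moreover have "x R \<le> 2" using x_le[OF R0] R by (smt (verit) divide_le_eq_1)
  ultimately have "x R / v R \<le> 2 / sqrt (2 * N)" using N by (intro frac_le) auto
  moreover have "1 / \<phi> R \<le> 1 / N" using N by (intro divide_left_mono) auto
  moreover have "ln \<alpha> \<le> la R + x R / v R + 1 / \<phi> R" using R N by (intro ln_\<alpha>_le) auto
  ultimately show ?thesis using la_le[OF R0] by linarith
qed

lemma ln_\<beta>_close:
  assumes R: "R \<ge> 1" and N: "4 \<le> N" "N \<le> \<phi> R" and \<kappa>: "k0 \<le> \<kappa>" and M: "m \<le> M"
  shows "\<bar>lb R - ln \<beta>\<bar> \<le> (1 + \<kappa>) / sqrt (2 * N) + (1 + \<kappa> * M) / N"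
proof -
  have R0: "R > 0" using R by simp
  have "sqrt (2 * N) \<le> v R" using N by (simp add: v_def)
  moreover have "y R \<le> 1 + \<kappa>" using y_le[of R] R \<kappa> by simp
  ultimately have 1: "y R / v R \<le> (1 + \<kappa>) / sqrt (2 * N)" using N k0 \<kappa> by (intro frac_le) auto
  have "k0 * m \<le> \<kappa> * M" using k0 m \<kappa> M by (intro mult_mono) auto
  moreover from this have "\<kappa> * M \<ge> 0" using mult_pos_pos[OF k0 m] by linarith
  ultimately have "(1 + k0 * m) / \<phi> R \<le> (1 + \<kappa> * M) / N" using N by (intro frac_le add_mono) auto
  moreover have "ln \<beta> \<le> lb R + y R / v R + (1 + k0 * m) / \<phi> R" using R N by (intro ln_\<beta>_le) auto
  ultimately show ?thesis using 1 lb_le[of R] R0 by linarith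
qed

end

text \<open>The distance is measured in \<open>(m, 1 / b0^2)\<close> because these are the initial
  values of \<open>\<phi>\<close> and \<open>k\<close>, the only ones in which two flows
  differ.\<close>

lemma parameter_dependence:
  assumes "expander_flow b0 m \<zeta> y u \<phi> k \<Lambda>" "expander_flow b0' m' \<zeta>' y' u' \<phi>' k' \<Lambda>'"
    and \<beta>0: "\<beta>0 > 0" "\<beta>0 \<le> b0" "\<beta>0 \<le> b0'" and M: "m \<le> M" "m' \<le> M" and R: "R \<ge> 0"
  defines "C \<equiv> exp ((20 * (3 + 2 / \<beta>0\<^sup>2 + sqrt (2 * M) + R) + 24) * R)"
  defines "D \<equiv> dist (m, 1 / b0\<^sup>2) (m', 1 / b0'\<^sup>2)"
  shows "\<bar>\<phi> R - \<phi>' R\<bar> \<le> sqrt C * D" "\<bar>k R - k' R\<bar> \<le> sqrt C * D" "\<bar>\<Lambda> R - \<Lambda>' R\<bar> \<le> sqrt C * D"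
proof -
  interpret E: expander_flow b0 m \<zeta> y u \<phi> k \<Lambda> by fact
  interpret F: expander_flow b0' m' \<zeta>' y' u' \<phi>' k' \<Lambda>' by fact
  have "(\<zeta> R - \<zeta>' R)\<^sup>2 + (y R - y' R)\<^sup>2 + (u R - u' R)\<^sup>2 + (\<phi> R - \<phi>' R)\<^sup>2
      + (k R - k' R)\<^sup>2 + (\<Lambda> R - \<Lambda>' R)\<^sup>2
    \<le> ((\<zeta> 0 - \<zeta>' 0)\<^sup>2 + (y 0 - y' 0)\<^sup>2 + (u 0 - u' 0)\<^sup>2 + (\<phi> 0 - \<phi>' 0)\<^sup>2
      + (k 0 - k' 0)\<^sup>2 + (\<Lambda> 0 - \<Lambda>' 0)\<^sup>2) * C"
    unfolding C_def
    by (rule flow_dist[OF E.flow F.flow _ R order_refl])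
      (use E.flow_bounded[OF \<beta>0(1,2) M(1)] F.flow_bounded[OF \<beta>0(1,3) M(2)] in blast)
  also have "\<dots> = D\<^sup>2 * C"
    by (simp add: E.init F.init D_def dist_Pair_Pair dist_real_def)
  finally have sum: "(\<zeta> R - \<zeta>' R)\<^sup>2 + (y R - y' R)\<^sup>2 + (u R - u' R)\<^sup>2 + (\<phi> R - \<phi>' R)\<^sup>2
      + (k R - k' R)\<^sup>2 + (\<Lambda> R - \<Lambda>' R)\<^sup>2 \<le> D\<^sup>2 * C" .
  have root: "\<bar>z\<bar> \<le> sqrt C * D" if "z\<^sup>2 \<le> D\<^sup>2 * C" for z
  proof -
    have "sqrt (z\<^sup>2) \<le> sqrt (D\<^sup>2 * C)" by (rule real_sqrt_le_mono[OF that])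
    then show ?thesis by (simp add: real_sqrt_mult D_def mult.commute)
  qed
  note nn = zero_le_power2[of "\<zeta> R - \<zeta>' R"] zero_le_power2[of "y R - y' R"] zero_le_power2[of "u R - u' R"]
    zero_le_power2[of "\<phi> R - \<phi>' R"] zero_le_power2[of "k R - k' R"] zero_le_power2[of "\<Lambda> R - \<Lambda>' R"]
  show "\<bar>\<phi> R - \<phi>' R\<bar> \<le> sqrt C * D" "\<bar>k R - k' R\<bar> \<le> sqrt C * D" "\<bar>\<Lambda> R - \<Lambda>' R\<bar> \<le> sqrt C * D"
    by (rule root, use sum nn in linarith)+
qed

section \<open>Continuity of the asymptotic map\<close>

lemma continuous_on_lipschitz_comp:
  fixes g :: "'a::topological_space \<Rightarrow> real" and h :: "'a \<Rightarrow> 'b::metric_space"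
  assumes h: "continuous_on A h" and L: "\<And>p q. p \<in> A \<Longrightarrow> q \<in> A \<Longrightarrow> \<bar>g p - g q\<bar> \<le> L * dist (h p) (h q)"
  shows "continuous_on A g"
  unfolding continuous_on_def
proof
  fix q assume q: "q \<in> A"
  have "((\<lambda>p. dist (h p) (h q)) \<longlongrightarrow> 0) (at q within A)"
    using h q unfolding continuous_on_def by (simp add: tendsto_dist_iff[symmetric])
  from tendsto_mult_right_zero[OF this, of L]
  have "((\<lambda>p. g p - g q) \<longlongrightarrow> 0) (at q within A)"
    by (rule Lim_null_comparison[rotated]) (use L q in \<open>auto simp: eventually_at_filter\<close>)
  then show "(g \<longlongrightarrow> g q) (at q within A)" by (simp add: LIM_zero_iff)
qed

lemma uniform_limit_by_growth:
  fixes f :: "real \<Rightarrow> 'a \<Rightarrow> real"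
  assumes N: "filterlim N at_top at_top"
    and f: "\<And>p R. p \<in> A \<Longrightarrow> R \<ge> 1 \<Longrightarrow> N R \<ge> 4 \<Longrightarrow> \<bar>f R p - l p\<bar> \<le> c1 / sqrt (2 * N R) + c2 / N R"
  shows "uniform_limit A f l at_top"
proof (rule uniform_limitI)
  fix e :: real assume e: "e > 0"
  have "filterlim (\<lambda>R. 2 * N R) at_top at_top"
    by (rule filterlim_tendsto_pos_mult_at_top[OF tendsto_const _ N]) simp
  then have "filterlim (\<lambda>R. sqrt (2 * N R)) at_top at_top" by (rule filterlim_compose[OF sqrt_at_top])
  then have "((\<lambda>R. c1 / sqrt (2 * N R) + c2 / N R) \<longlongrightarrow> 0 + 0) at_top"
    by (intro tendsto_add real_tendsto_divide_at_top[OF tendsto_const] N)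
  then have "eventually (\<lambda>R. c1 / sqrt (2 * N R) + c2 / N R < e) at_top"
    using e by (intro order_tendstoD(2)) auto
  moreover have "eventually (\<lambda>R. N R \<ge> 4) at_top" using N by (simp add: filterlim_at_top)
  ultimately show "eventually (\<lambda>R. \<forall>p\<in>A. dist (f R p) (l p) < e) at_top"
    using eventually_ge_at_top[of "1::real"]
  proof eventually_elim
    case (elim R)
    show ?case
    proof
      fix p assume "p \<in> A"
      from f[OF this, of R] elim show "dist (f R p) (l p) < e" by (simp add: dist_real_def)
    qed
  qed
qed

locale expander_family =
  fixes Z Y U P K L :: "real \<times> real \<Rightarrow> real \<Rightarrow> real"
  assumes family: "p \<in> quadrant \<Longrightarrow> expander_flow (fst p) (snd p) (Z p) (Y p) (U p) (P p) (K p) (L p)"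
begin

definition "A p = expander_flow.\<alpha> (P p) (L p)"
definition "B p = expander_flow.\<beta> (P p) (K p)"

lemma asymptotic_map: "p \<in> quadrant \<Longrightarrow> asymptotic_map p = (A p, B p)"
  using expander_flow.asymptotic_map_eq[OF family] by (simp add: A_def B_def)

lemma A_pos: "p \<in> quadrant \<Longrightarrow> A p > 0" and B_pos: "p \<in> quadrant \<Longrightarrow> B p > 0"
  and A_le_B: "p \<in> quadrant \<Longrightarrow> A p \<le> B p"
  unfolding A_def B_def
  using expander_flow.\<alpha>_pos[OF family] expander_flow.\<beta>_pos[OF family] expander_flow.\<alpha>_le_\<beta>[OF family] by blast+

lemma asymptotic_map_in_quadrant: "p \<in> quadrant \<Longrightarrow> asymptotic_map p \<in> quadrant"
  using A_pos B_pos by (simp add: asymptotic_map quadrant_def)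

lemma quadrant_iff: "p \<in> quadrant \<longleftrightarrow> fst p > 0 \<and> snd p > 0"
  by (auto simp: quadrant_def mem_Times_iff)

lemma growth_at_top:
  assumes "c > 0" shows "filterlim (\<lambda>R::real. c * ln (1 + R\<^sup>2)) at_top at_top"
proof -
  have "filterlim (\<lambda>R::real. ln (1 + R\<^sup>2)) at_top at_top" by real_asymp
  then show ?thesis by (rule filterlim_tendsto_pos_mult_at_top[OF tendsto_const assms])
qed

lemma P_growth:
  assumes p: "p \<in> quadrant" and bd: "0 < m1" "m1 \<le> snd p" "snd p \<le> M" and R: "R \<ge> 0"
  shows "P p R \<ge> m1 / (5 + sqrt (2 * M)) * ln (1 + R\<^sup>2)"
proof -
  interpret expander_flow "fst p" "snd p" "Z p" "Y p" "U p" "P p" "K p" "L p" by (rule family[OF p])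
  have "m1 / (5 + sqrt (2 * M)) \<le> snd p / (5 + sqrt (2 * snd p))"
    using bd by (intro frac_le add_pos_nonneg) auto
  then have "m1 / (5 + sqrt (2 * M)) * ln (1 + R\<^sup>2) \<le> snd p / (5 + sqrt (2 * snd p)) * ln (1 + R\<^sup>2)"
    by (intro mult_right_mono ln_ge_zero) auto
  then show ?thesis using \<phi>_ge[OF R] bd by linarith
qed

lemma local_continuity:
  assumes \<beta>0: "\<beta>0 > 0" and m1: "m1 > 0" "m1 < M"
  shows "continuous_on ({\<beta>0<..} \<times> {m1<..<M}) (\<lambda>p. ln (A p))" "continuous_on ({\<beta>0<..} \<times> {m1<..<M}) (\<lambda>p. ln (B p))"
proof -
  let ?S = "{\<beta>0<..} \<times> {m1<..<M}"
  have S: "p \<in> quadrant" "\<beta>0 \<le> fst p" "m1 \<le> snd p" "snd p \<le> M" if "p \<in> ?S" for p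
    using that assms by (auto simp: quadrant_def)
  have h: "continuous_on ?S (\<lambda>p. (snd p, 1 / (fst p)\<^sup>2))"
    using \<beta>0 by (intro continuous_intros) auto
  note dep = parameter_dependence[OF family family \<beta>0, where M = M]
  have c: "continuous_on ?S (\<lambda>p. P p R)" "continuous_on ?S (\<lambda>p. K p R)" "continuous_on ?S (\<lambda>p. L p R)" if R: "R \<ge> 0" for R
    by (rule continuous_on_lipschitz_comp[OF h], rule dep(1), use S R in auto)
      (rule continuous_on_lipschitz_comp[OF h], rule dep(2), use S R in auto,
       rule continuous_on_lipschitz_comp[OF h], rule dep(3), use S R in auto)
  have pos: "P p R > 0" "K p R > 0" if "p \<in> ?S" "R \<ge> 0" for p R
    using expander_flow.\<phi>_pos[OF family[OF S(1)[OF that(1)]] that(2)]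
      expander_flow.k_pos[OF family[OF S(1)[OF that(1)]] that(2)] .
  let ?N = "\<lambda>R. m1 / (5 + sqrt (2 * M)) * ln (1 + R\<^sup>2)"
  have N: "filterlim ?N at_top at_top"
    using m1 by (intro growth_at_top divide_pos_pos add_pos_nonneg) auto
  have lim: "continuous_on ?S l" if "\<And>R. R > 0 \<Longrightarrow> continuous_on ?S (f R)"
    "\<And>p R. p \<in> ?S \<Longrightarrow> R \<ge> 1 \<Longrightarrow> ?N R \<ge> 4 \<Longrightarrow> \<bar>f R p - l p\<bar> \<le> c1 / sqrt (2 * ?N R) + c2 / ?N R" for f l c1 c2
    by (rule uniform_limit_theorem[OF eventually_mono[OF eventually_gt_at_top[of 0] that(1)] uniform_limit_by_growth[OF N that(2)]]) auto
  show "continuous_on ?S (\<lambda>p. ln (A p))"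
  proof (rule lim)
    fix R :: real assume R: "R > 0"
    have "continuous_on ?S (\<lambda>p. ln R + L p R - ln (2 * P p R) / 2)"
      by (intro continuous_intros c) (use pos(1)[OF _ less_imp_le[OF R]] R less_imp_neq in \<open>fastforce+\<close>)
    then show "continuous_on ?S (\<lambda>p. expander_flow.la (P p) (L p) R)"
      by (rule continuous_on_eq) (simp add: expander_flow.la_def[OF family[OF S(1)]])
  next
    fix p R assume p: "p \<in> ?S" and R: "R \<ge> (1::real)" "?N R \<ge> 4"
    show "\<bar>expander_flow.la (P p) (L p) R - ln (A p)\<bar> \<le> 2 / sqrt (2 * ?N R) + 1 / ?N R"
      unfolding A_def
      by (rule expander_flow.ln_\<alpha>_close[OF family[OF S(1)[OF p]] R P_growth[OF S(1)[OF p] m1(1) S(3,4)[OF p]]]) (use R in simp)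
  qed
  show "continuous_on ?S (\<lambda>p. ln (B p))"
  proof (rule lim)
    fix R :: real assume R: "R > 0"
    have "continuous_on ?S (\<lambda>p. - ln (K p R) / 2 - ln (2 * P p R) / 2)"
      by (intro continuous_intros c) (use pos[OF _ less_imp_le[OF R]] R less_imp_neq in \<open>fastforce+\<close>)
    then show "continuous_on ?S (\<lambda>p. expander_flow.lb (P p) (K p) R)"
      by (rule continuous_on_eq) (simp add: expander_flow.lb_def[OF family[OF S(1)]])
  next
    fix p R assume p: "p \<in> ?S" and R: "R \<ge> (1::real)" "?N R \<ge> 4"
    have k: "expander_flow.k0 (fst p) \<le> 1 / \<beta>0\<^sup>2"
      unfolding expander_flow.k0_def[OF family[OF S(1)[OF p]]]
      using S(2)[OF p] \<beta>0 by (intro divide_left_mono power_mono) auto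
    show "\<bar>expander_flow.lb (P p) (K p) R - ln (B p)\<bar> \<le> (1 + 1 / \<beta>0\<^sup>2) / sqrt (2 * ?N R) + (1 + 1 / \<beta>0\<^sup>2 * M) / ?N R"
      unfolding B_def
      by (rule expander_flow.ln_\<beta>_close[OF family[OF S(1)[OF p]] R P_growth[OF S(1)[OF p] m1(1) S(3,4)[OF p]] k S(4)[OF p]]) (use R in simp)
  qed
qed

lemma asymptotic_map_continuous: "continuous_on quadrant asymptotic_map"
proof -
  have "isCont (\<lambda>p. (exp (ln (A p)), exp (ln (B p)))) p" if p: "p \<in> quadrant" for p
  proof -
    let ?S = "{fst p / 2<..} \<times> {snd p / 2<..<2 * snd p}"
    have pp: "fst p > 0" "snd p > 0" using p by (auto simp: quadrant_iff)
    have "continuous_on ?S (\<lambda>p. (exp (ln (A p)), exp (ln (B p))))"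
      using pp by (intro continuous_intros local_continuity) auto
    moreover have "open ?S" by (intro open_Times) auto
    moreover have "p \<in> ?S" using pp by (auto simp: mem_Times_iff)
    ultimately show ?thesis using continuous_on_eq_continuous_at[of ?S] by blast
  qed
  then have "continuous_on quadrant (\<lambda>p. (exp (ln (A p)), exp (ln (B p))))"
    by (intro continuous_at_imp_continuous_on) auto
  then show ?thesis
    by (rule continuous_on_eq) (use A_pos B_pos in \<open>simp add: asymptotic_map\<close>)
qed

section \<open>Properness of the asymptotic map\<close>

text \<open>The order of the bounds matters: \<open>b0_bound\<close> gives \<open>e1\<close>;
  \<open>m_bound\<close> gives \<open>e2\<close>, with \<open>4\<close> for the remaining
  \<open>m\<close>; \<open>b0_bound\<close> again gives \<open>d\<close>; and only with
  \<open>m\<close> in a compact interval does \<open>\<alpha>_le_b0\<close> give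
  \<open>c\<close>.\<close>

lemma preimage_in_box:
  assumes a: "0 < a1" and b: "0 < b2"
  obtains c d e1 e2 where "0 < c" "0 < e1"
    "\<And>p. p \<in> quadrant \<Longrightarrow> a1 \<le> A p \<Longrightarrow> B p \<le> b2 \<Longrightarrow> c \<le> fst p \<and> fst p \<le> d \<and> e1 \<le> snd p \<and> snd p \<le> e2"
proof -
  define e1 where "e1 = 1 / (2 * b2\<^sup>2)"
  define e2 where "e2 = max 4 (exp 6 / (2 * a1\<^sup>2))"
  define d where "d = sqrt (2 * e2 * b2\<^sup>2)"
  have e1: "e1 > 0" using b by (simp add: e1_def)
  have e2: "e2 > 0" by (simp add: e2_def)
  define g where "g = e1 / (5 + sqrt (2 * e2))"
  have g: "g > 0" using e1 e2 by (auto simp: g_def intro!: divide_pos_pos add_pos_nonneg)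
  \<comment> \<open>One radius for the whole strip \<open>e1 \<le> m \<le> e2\<close>, so that
    \<open>q\<close> and \<open>c\<close> do not depend on the point.\<close>
  have "eventually (\<lambda>R. g * ln (1 + R\<^sup>2) \<ge> 4 \<and> R \<ge> (1::real)) at_top"
    using growth_at_top[OF g] eventually_ge_at_top[of "1::real"] by (auto simp: filterlim_at_top intro: eventually_conj)
  then obtain R where R: "g * ln (1 + R\<^sup>2) \<ge> 4" "R \<ge> 1"
    by (auto simp: eventually_at_top_linorder)
  define q where "q = 1 / ((5 + sqrt (2 * e2)) * (1 + R\<^sup>2))"
  have q: "q > 0" using e2 unfolding q_def by (intro divide_pos_pos mult_pos_pos add_pos_nonneg) auto
  define c where "c = a1 * sqrt q / exp (R + 2)"
  show thesis
  proof
    show "c > 0" using a q by (simp add: c_def)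
    show "e1 > 0" by fact
    fix p assume p: "p \<in> quadrant" and pa: "a1 \<le> A p" and pb: "B p \<le> b2"
    interpret E: expander_flow "fst p" "snd p" "Z p" "Y p" "U p" "P p" "K p" "L p" by (rule family[OF p])
    have \<alpha>: "E.\<alpha> \<ge> a1" "E.\<beta> \<le> b2" using pa pb by (simp_all add: A_def B_def)
    have "2 * snd p * E.\<beta>\<^sup>2 \<le> 2 * snd p * b2\<^sup>2"
      using \<alpha> E.\<beta>_pos E.m by (intro mult_left_mono power_mono) auto
    then have bound: "(fst p)\<^sup>2 + 1 \<le> 2 * snd p * b2\<^sup>2" using E.b0_bound by linarith
    then have "1 \<le> snd p * (2 * b2\<^sup>2)" using zero_le_power2[of "fst p"] by linarith
    then have m1: "e1 \<le> snd p" using b by (simp add: e1_def pos_divide_le_eq)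
    have m2: "snd p \<le> e2"
    proof (cases "snd p \<ge> 4")
      case True
      have "a1\<^sup>2 * (2 * snd p) \<le> E.\<alpha>\<^sup>2 * (2 * snd p)"
        using \<alpha> a E.m by (intro mult_right_mono power_mono) auto
      also have "\<dots> \<le> exp 6" by (rule E.m_bound[OF True])
      finally have "snd p \<le> exp 6 / (2 * a1\<^sup>2)" using a by (simp add: pos_le_divide_eq mult_ac)
      then show ?thesis by (simp add: e2_def)
    qed (simp add: e2_def)
    have "(fst p)\<^sup>2 \<le> 2 * e2 * b2\<^sup>2"
    proof -
      have "2 * snd p * b2\<^sup>2 \<le> 2 * e2 * b2\<^sup>2" using m2 by (intro mult_right_mono) auto
      then show ?thesis using bound by linarith
    qed
    then have "fst p \<le> d" unfolding d_def by (rule real_le_rsqrt)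
    moreover have "c \<le> fst p"
    proof -
      have "g * ln (1 + R\<^sup>2) \<le> P p R"
        unfolding g_def by (rule P_growth[OF p e1 m1 m2]) (use R in simp)
      then have "P p R \<ge> 4" using R by simp
      moreover have "q * ((5 + sqrt (2 * snd p)) * (1 + R\<^sup>2)) \<le> 1"
      proof -
        have "(5 + sqrt (2 * snd p)) * (1 + R\<^sup>2) \<le> (5 + sqrt (2 * e2)) * (1 + R\<^sup>2)"
          using m2 by (intro mult_right_mono) auto
        then have "q * ((5 + sqrt (2 * snd p)) * (1 + R\<^sup>2)) \<le> q * ((5 + sqrt (2 * e2)) * (1 + R\<^sup>2))"
          using q by (intro mult_left_mono) auto
        moreover have "(5 + sqrt (2 * e2)) * (1 + R\<^sup>2) > 0" using e2 by (intro mult_pos_pos add_pos_nonneg) auto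
        then have "q * ((5 + sqrt (2 * e2)) * (1 + R\<^sup>2)) = 1" unfolding q_def by (metis less_irrefl nonzero_eq_divide_eq)
        ultimately show ?thesis by simp
      qed
      ultimately have "E.\<alpha> \<le> exp (R + 2) * fst p / sqrt q" using R q by (intro E.\<alpha>_le_b0) auto
      then have "a1 \<le> exp (R + 2) * fst p / sqrt q" using \<alpha> by linarith
      then show ?thesis using q by (simp add: c_def field_simps)
    qed
    ultimately show "c \<le> fst p \<and> fst p \<le> d \<and> e1 \<le> snd p \<and> snd p \<le> e2" using m1 m2 by blast
  qed
qed

lemma compact_preimage:
  assumes K: "compact C" "C \<subseteq> quadrant"
  shows "compact {p \<in> quadrant. asymptotic_map p \<in> C}"
proof (cases "C = {}")
  case False
  have c: "compact (fst ` C)" "compact (snd ` C)"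
    by (intro compact_continuous_image continuous_intros K)+
  obtain a1 where a1: "a1 \<in> fst ` C" "\<And>z. z \<in> fst ` C \<Longrightarrow> a1 \<le> z"
    using compact_attains_inf[OF c(1)] False by blast
  obtain b2 where b2: "b2 \<in> snd ` C" "\<And>z. z \<in> snd ` C \<Longrightarrow> z \<le> b2"
    using compact_attains_sup[OF c(2)] False by blast
  have "a1 > 0" "b2 > 0" using a1(1) b2(1) K(2) by (auto simp: quadrant_def)
  then obtain c d e1 e2 where box: "0 < c" "0 < e1"
    "\<And>p. p \<in> quadrant \<Longrightarrow> a1 \<le> A p \<Longrightarrow> B p \<le> b2 \<Longrightarrow> c \<le> fst p \<and> fst p \<le> d \<and> e1 \<le> snd p \<and> snd p \<le> e2"
    by (rule preimage_in_box) blast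
  let ?S = "{c..d} \<times> {e1..e2}"
  have S: "?S \<subseteq> quadrant" using box by (auto simp: quadrant_def)
  have "{p \<in> quadrant. asymptotic_map p \<in> C} = ?S \<inter> asymptotic_map -` C"
  proof (intro equalityI subsetI)
    fix p assume p: "p \<in> {p \<in> quadrant. asymptotic_map p \<in> C}"
    then have q: "p \<in> quadrant" "(A p, B p) \<in> C" by (auto simp: asymptotic_map)
    then have "a1 \<le> A p" "B p \<le> b2" using a1(2) b2(2) by force+
    then show "p \<in> ?S \<inter> asymptotic_map -` C" using box(3)[OF q(1)] p by (auto simp: mem_Times_iff)
  qed (use S in auto)
  moreover have "closed (?S \<inter> asymptotic_map -` C)"
    by (intro continuous_closed_preimage continuous_on_subset[OF asymptotic_map_continuous S] closed_Times compact_imp_closed K) auto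
  moreover have "compact ?S" by (intro compact_Times) auto
  ultimately show ?thesis by (metis compact_Int_closed inf.left_idem)
qed simp

lemma asymptotic_map_continuous_map: "continuous_map (top_of_set quadrant) (top_of_set quadrant) asymptotic_map"
  using asymptotic_map_continuous asymptotic_map_in_quadrant by (auto simp: continuous_map_in_subtopology)

lemma asymptotic_map_proper: "proper_map (top_of_set quadrant) (top_of_set quadrant) asymptotic_map"
proof (rule compact_imp_proper_map)
  \<comment> \<open>Compact preimages make a continuous map closed when the target is compactly
    generated, as an open subset of the plane is.\<close>
  show "k_space (top_of_set quadrant)"
  proof -
    have "open quadrant" unfolding quadrant_def by (intro open_Times) auto
    then have "locally_compact_space (top_of_set quadrant)"
      by (intro locally_compact_space_open_subset) (auto simp: locally_compact_space_euclidean)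
    then show ?thesis by (rule locally_compact_imp_k_space)
  qed
qed (use asymptotic_map_in_quadrant asymptotic_map_continuous_map compact_preimage in
    \<open>auto simp: compactin_subtopology kc_space_subtopology kc_space_euclidean\<close>)

end

section \<open>The degree\<close>

lemma quadrant_chart_inj: "inj_on quadrant_chart quadrant"
proof (rule inj_onI)
  fix p q assume pq: "p \<in> quadrant" "q \<in> quadrant" "quadrant_chart p = quadrant_chart q"
  obtain x y x' y' where e: "p = (x, y)" "q = (x', y')" by (metis surj_pair)
  define s where "s = (ln x)\<^sup>2 + (ln y)\<^sup>2"
  define s' where "s' = (ln x')\<^sup>2 + (ln y')\<^sup>2"
  have s: "s + 1 > 0" "s' + 1 > 0" by (simp_all add: s_def s'_def add_nonneg_pos)
  have c: "2 * ln x / (s + 1) = 2 * ln x' / (s' + 1)" "2 * ln y / (s + 1) = 2 * ln y' / (s' + 1)"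
    "(s - 1) / (s + 1) = (s' - 1) / (s' + 1)"
    using fun_cong[OF pq(3), of 0] fun_cong[OF pq(3), of 1] fun_cong[OF pq(3), of 2]
    by (simp_all add: e quadrant_chart_def Let_def s_def s'_def)
  have "(s - 1) * (s' + 1) = (s' - 1) * (s + 1)" using c(3) s by (simp add: frac_eq_eq)
  then have "s = s'" by (simp add: algebra_simps)
  then have "ln x = ln x'" "ln y = ln y'" using c s by simp_all
  then show "p = q" using pq by (simp add: e quadrant_def)
qed

lemma quadrant_chart_not_pole: "quadrant_chart p \<noteq> north_pole"
proof
  obtain x y where e: "p = (x, y)" by (metis surj_pair)
  define s where "s = (ln x)\<^sup>2 + (ln y)\<^sup>2"
  have s: "s + 1 > 0" by (simp add: s_def add_nonneg_pos)
  assume "quadrant_chart p = north_pole"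
  from fun_cong[OF this, of 2] have "(s - 1) / (s + 1) = 1"
    by (simp add: e quadrant_chart_def north_pole_def Let_def s_def)
  then show False using s by simp
qed

lemma topspace_nsphere_2: "topspace (nsphere 2) = {z. (z 0)\<^sup>2 + (z 1)\<^sup>2 + (z 2)\<^sup>2 = 1 \<and> (\<forall>i>2. z i = 0)}"
  by (auto simp: nsphere numeral_2_eq_2)

lemma quadrant_chart_in_sphere: "quadrant_chart p \<in> topspace (nsphere 2)"
proof -
  obtain x y where e: "p = (x, y)" by (metis surj_pair)
  define u v where uv: "u = ln x" "v = ln y"
  define s where "s = u\<^sup>2 + v\<^sup>2"
  have s: "s + 1 > 0" by (simp add: s_def add_nonneg_pos)
  have "(2 * u / (s + 1))\<^sup>2 + (2 * v / (s + 1))\<^sup>2 + ((s - 1) / (s + 1))\<^sup>2 = (4 * s + (s - 1)\<^sup>2) / (s + 1)\<^sup>2"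
    unfolding power_divide add_divide_distrib[symmetric] by (simp add: s_def power_mult_distrib)
  also have "4 * s + (s - 1)\<^sup>2 = (s + 1)\<^sup>2" by (simp add: power2_eq_square algebra_simps)
  finally have "(2 * u / (s + 1))\<^sup>2 + (2 * v / (s + 1))\<^sup>2 + ((s - 1) / (s + 1))\<^sup>2 = 1" using s by simp
  then show ?thesis by (simp add: topspace_nsphere_2 e quadrant_chart_def Let_def uv s_def)
qed

text \<open>\<open>u\<close> and \<open>v\<close> are the stereographic coordinates of
  \<open>z\<close> from the pole; \<open>z 2 < 1\<close> away from it.\<close>

lemma quadrant_chart_surj:
  assumes z: "z \<in> topspace (nsphere 2)" "z \<noteq> north_pole"
  shows "z \<in> quadrant_chart ` quadrant"
proof -
  have z1: "(z 0)\<^sup>2 + (z 1)\<^sup>2 + (z 2)\<^sup>2 = 1" "\<And>i. i > 2 \<Longrightarrow> z i = 0" using z(1) by (auto simp: topspace_nsphere_2)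
  have ne: "z 2 \<noteq> 1"
  proof
    assume "z 2 = 1"
    then have "(z 0)\<^sup>2 + (z 1)\<^sup>2 = 0" using z1 by simp
    then have z01: "z 0 = 0" "z 1 = 0" by (simp_all add: sum_power2_eq_zero_iff)
    have "z i = north_pole i" for i
    proof -
      consider "i = 0" | "i = 1" | "i = 2" | "i > 2" by linarith
      then show ?thesis by cases (use z01 z1 \<open>z 2 = 1\<close> in \<open>auto simp: north_pole_def\<close>)
    qed
    then show False using z(2) by blast
  qed
  have "(z 2)\<^sup>2 \<le> 1" using z1(1) zero_le_power2[of "z 0"] zero_le_power2[of "z 1"] by linarith
  then have "z 2 \<le> 1" by (simp add: abs_square_le_1 abs_le_iff)
  then have d: "1 - z 2 > 0" using ne by simp
  define u where "u = z 0 / (1 - z 2)"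
  define v where "v = z 1 / (1 - z 2)"
  have s: "u\<^sup>2 + v\<^sup>2 = (1 + z 2) / (1 - z 2)"
  proof -
    have "u\<^sup>2 + v\<^sup>2 = (1 - (z 2)\<^sup>2) / (1 - z 2)\<^sup>2"
      unfolding u_def v_def power_divide add_divide_distrib[symmetric] using z1(1) by (simp add: algebra_simps)
    also have "1 - (z 2)\<^sup>2 = (1 + z 2) * (1 - z 2)" by (simp add: power2_eq_square algebra_simps)
    finally show ?thesis using d by (simp add: power2_eq_square)
  qed
  have s1: "u\<^sup>2 + v\<^sup>2 + 1 = 2 / (1 - z 2)" unfolding s using d by (simp add: field_simps)
  have sm: "u\<^sup>2 + v\<^sup>2 - 1 = 2 * z 2 / (1 - z 2)" unfolding s using d by (simp add: field_simps)
  have uz: "u * (1 - z 2) = z 0" "v * (1 - z 2) = z 1" using d by (simp_all add: u_def v_def)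
  have "quadrant_chart (exp u, exp v) i = z i" for i
  proof -
    consider "i = 0" | "i = 1" | "i = 2" | "i > 2" by linarith
    then show ?thesis
      by cases (use d z1(2) uz in \<open>simp_all add: quadrant_chart_def Let_def s1 sm\<close>)
  qed
  then have "quadrant_chart (exp u, exp v) = z" by blast
  then show ?thesis by (force simp: quadrant_def)
qed

text \<open>The extension fixes the pole and no chart value is the pole, so it misses
  \<open>quadrant_chart q\<close> just as \<open>F\<close> misses \<open>q\<close>. The case
  distinction takes the place of extending proper maps continuously to the pole: on a discontinuous
  map the degree is \<open>0\<close> by convention.\<close>

lemma quadrant_degree_nonsurjective:
  assumes F: "continuous_map (top_of_set quadrant) (top_of_set quadrant) F"
      "proper_map (top_of_set quadrant) (top_of_set quadrant) F"
    and q: "q \<in> quadrant" "q \<notin> F ` quadrant"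
  shows "quadrant_degree F = 0"
proof -
  have "Brouwer_degree2 2 (compactified_map F) = 0"
  proof (cases "continuous_map (nsphere 2) (nsphere 2) (compactified_map F)")
    case True
    have "quadrant_chart q \<notin> compactified_map F ` topspace (nsphere 2)"
    proof
      assume "quadrant_chart q \<in> compactified_map F ` topspace (nsphere 2)"
      then obtain z where z: "z \<in> topspace (nsphere 2)" "quadrant_chart q = compactified_map F z" by blast
      then have zn: "z \<noteq> north_pole" using quadrant_chart_not_pole[of q] by (auto simp: compactified_map_def)
      define w where "w = inv_into quadrant quadrant_chart z"
      have w: "w \<in> quadrant" unfolding w_def by (rule inv_into_into[OF quadrant_chart_surj[OF z(1) zn]])
      have "F w \<in> quadrant" using F(1) w by (auto simp: continuous_map_in_subtopology)
      moreover have "quadrant_chart q = quadrant_chart (F w)" using z(2) zn by (simp add: compactified_map_def w_def)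
      ultimately have "q = F w" using quadrant_chart_inj q(1) by (auto dest: inj_onD)
      then show False using q(2) w by blast
    qed
    then have "compactified_map F ` topspace (nsphere 2) \<noteq> topspace (nsphere 2)"
      using quadrant_chart_in_sphere[of q] by blast
    then show ?thesis by (rule Brouwer_degree2_nonsurjective[OF True])
  next
    case False
    \<comment> \<open>All discontinuous maps induce the same map on homology, and a discontinuous constant has degree \<open>0\<close>.\<close>
    have "\<not> continuous_map (nsphere 2) (nsphere 2) (\<lambda>x i. 0)"
    proof
      assume "continuous_map (nsphere 2) (nsphere 2) (\<lambda>x i. 0)"
      then have "(\<lambda>i. 0) \<in> topspace (nsphere 2)"
        using in_topspace_nsphere[of 2] by (auto simp: continuous_map_def)
      then show False by (simp add: topspace_nsphere_2)
    qed
    then have "hom_induced 2 (nsphere 2) {} (nsphere 2) {} (compactified_map F)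
        = hom_induced 2 (nsphere 2) {} (nsphere 2) {} (\<lambda>x i. 0)"
      using False by (intro ext) (simp add: hom_induced_default)
    then have "Brouwer_degree2 2 (compactified_map F) = Brouwer_degree2 2 (\<lambda>x i. 0)"
      by (simp add: Brouwer_degree2_def)
    then show ?thesis by (simp add: Brouwer_degree2_const)
  qed
  then show ?thesis using F by (simp add: quadrant_degree_def)
qed

theorem theorem1p2:
  shows "deg_sym_exp_S2xD2 = 0"
proof -
  have "\<exists>\<zeta> y u \<phi> k \<Lambda>. expander_flow (fst p) (snd p) \<zeta> y u \<phi> k \<Lambda>" if "p \<in> quadrant" for p
  proof -
    have "fst p > 0" "snd p > 0" using that by (auto simp: quadrant_def)
    then show ?thesis by (rule expander_flow_exists) blast
  qed
  then obtain Z Y U P K L where "\<And>p. p \<in> quadrant \<Longrightarrow> expander_flow (fst p) (snd p) (Z p) (Y p) (U p) (P p) (K p) (L p)"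
    by metis
  then interpret expander_family Z Y U P K L by (rule expander_family.intro)
  have "(2, 1) \<notin> asymptotic_map ` quadrant"
    using A_le_B by (force simp: asymptotic_map)
  moreover have "(2, 1) \<in> quadrant" by (simp add: quadrant_def)
  ultimately show ?thesis
    unfolding deg_sym_exp_S2xD2_def
    by (intro quadrant_degree_nonsurjective asymptotic_map_continuous_map asymptotic_map_proper)
qed

end
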